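(* Consider the urn model described in the context. Assume that there is an integer constant $C$ with $A_n\vee B_n\vee N_n\le C$ for all $n\ge 1$; that $E[A_n]=E[B_n]=m_n$ for all $n$, with $m_n\to m\in(0,+\infty)$; that $$E[N_n|\mathcal F_{n-1}]\xrightarrow{a.s.}N,\qquad E[N_n^2|\mathcal F_{n-1}]\xrightarrow{a.s.}Q,\qquad E[N_n^{-1}|\mathcal F_{n-1}]\xrightarrow{a.s.}L,$$ where $N$ and $Q$ are strictly positive finite random variables and $L$ is a positive bounded random variable; and that $$E[A_n^2]\to q_A,\qquad E[B_n^2]\to q_B,\qquad E[A_nB_n]\to q_{AB},$$ where $q_A,q_B,q_{AB}$ are strictly positive finite constants. Let $Z$ be the almost sure limit of $Z_n$ (which exists under these assumptions) and let $M_n=\frac1n\sum_{j=1}^n\frac{X_j}{N_j}$. Then $$\bigl[\sqrt n\,(M_n-Z_n),\ \sqrt n\,(Z_n-Z)\bigr]\xrightarrow{stably}\mathcal N(0,U)\otimes\mathcal N(0,V),$$ where $$V=Z(1-Z)\,\frac{N[(1-Z)^2q_A+Z^2q_B+2Z(1-Z)q_{AB}]+Z(1-Z)Q[q_A+q_B-2q_{AB}]}{(mN)^2}$$ and $U=V+Z(1-Z)\,[L-2N^{-1}]$.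
   Context: Urn model. An urn initially contains $a\ge 1$ balls of color A and $b\ge 1$ balls of color B ($a,b$ integers). On a probability space $(\Omega,\mathcal A,P)$ there are random variables $N_n,X_n,A_n,B_n$, $n\ge 1$, where $N_n$ is the size of the sample drawn without replacement at time $n$, $X_n$ is the number of sampled balls of color A, and after the draw the sampled balls are returned together with $A_nX_n$ new balls of color A and $B_n(N_n-X_n)$ new balls of color B. Put, for $n\ge 0$, $H_n=a+\sum_{j=1}^n A_jX_j$ (balls of color A), $K_n=b+\sum_{j=1}^n B_j(N_j-X_j)$ (balls of color B), $S_n=H_n+K_n$. For each $n\ge1$: (A1) the conditional distribution of $N_n$ given $[N_1,X_1,A_1,B_1,\dots,N_{n-1},X_{n-1},A_{n-1},B_{n-1}]$ is concentrated on $\{1,\dots,S_{n-1}\}$; (A2) the conditional distribution of $X_n$ given $[N_1,X_1,A_1,B_1,\dots,N_{n-1},X_{n-1},A_{n-1},B_{n-1},N_n]$ is hypergeometric with parameters $N_n,S_{n-1},H_{n-1}$, i.e. it gives mass $\binom{H_{n-1}}{k}\binom{S_{n-1}-H_{n-1}}{N_n-k}/\binom{S_{n-1}}{N_n}$ to $k$; (A3) the random vector $[A_n,B_n]$ takes values in $(\mathbb N\setminus\{0\})^2$ and is independent of $[N_1,X_1,A_1,B_1,\dots,N_{n-1},X_{n-1},A_{n-1},B_{n-1},N_n,X_n]$ ($A_n$ and $B_n$ may be correlated with each other and their law may depend on $n$). The proportion of balls of color A is $Z_n=H_n/S_n$, $n\ge0$. Filtration: $\mathcal F_0=\{\emptyset,\Omega\}$,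 $\mathcal F_n=\sigma(N_1,X_1,A_1,B_1,\dots,N_n,X_n,A_n,B_n)$ for $n\ge1$. Stable convergence. A kernel on a Polish space $S$ is a family $K=\{K(\omega):\omega\in\Omega\}$ of Borel probability measures on $S$ such that $\omega\mapsto Kf(\omega)=\int f(x)\,K(\omega)(dx)$ is $\mathcal A$-measurable for every bounded Borel $f:S\to\mathbb R$. A sequence $(Y_n)$ of $S$-valued random variables converges stably to $K$ if, for every $F\in\mathcal A$ with $P(F)>0$, the conditional laws $P(Y_n\in\cdot\,|\,F)$ converge weakly to $E[K(\cdot)\,|\,F]$. For a non-negative random variable $V$, $\mathcal N(0,V)$ denotes the kernel $\{\mathcal N(0,V(\omega)):\omega\in\Omega\}$ on $\mathbb R$, with $\mathcal N(0,0)=\delta_0$; $\mathcal N(0,U)\otimes\mathcal N(0,V)$ is the kernel on $\mathbb R^2$ given by the product measures $\mathcal N(0,U(\omega))\otimes\mathcal N(0,V(\omega))$. *)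

theory Defs
  imports "HOL-Probability.Probability"
begin

section \<open>Stable convergence\<close>

text \<open>
  A kernel on \<open>'s\<close> is a measurable map \<open>K \<in> M \<rightarrow>\<^sub>M prob_algebra borel\<close>. For an event \<open>F\<close> of positive
  probability, \<open>uniform_measure M F\<close> is the conditional measure \<open>P(\<cdot> | F)\<close>, so that
  \<open>bind (uniform_measure M F) K\<close> is the mixture \<open>E[K(\<cdot>) | F]\<close>.
\<close>

definition weakly_converges ::
    "(nat \<Rightarrow> 's::topological_space measure) \<Rightarrow> 's measure \<Rightarrow> bool" where
  "weakly_converges \<mu> \<nu> \<longleftrightarrow>
     (\<forall>f :: 's \<Rightarrow> real. continuous_on UNIV f \<longrightarrow> bounded (range f) \<longrightarrow>
        (\<lambda>n. \<integral>x. f x \<partial>\<mu> n) \<longlonglongrightarrow> (\<integral>x. f x \<partial>\<nu>))"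

definition converges_stably ::
    "'w measure \<Rightarrow> (nat \<Rightarrow> 'w \<Rightarrow> 's::polish_space) \<Rightarrow> ('w \<Rightarrow> 's measure) \<Rightarrow> bool" where
  "converges_stably M Y K \<longleftrightarrow>
     K \<in> M \<rightarrow>\<^sub>M prob_algebra borel \<and>
     (\<forall>n. Y n \<in> borel_measurable M) \<and>
     (\<forall>F\<in>sets M. measure M F > 0 \<longrightarrow>
        weakly_converges (\<lambda>n. distr (uniform_measure M F) borel (Y n))
                         (bind (uniform_measure M F) K))"

text \<open>
  The centred normal law with variance \<open>v\<close>. Only \<open>v \<ge> 0\<close> is meaningful; negative values, which a
  non-negative random variable may take on a null set, are sent to the point mass at zero as well.
\<close>

definition centred_normal :: "real \<Rightarrow> real measure" where
  "centred_normal v =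
     (if v > 0 then density lborel (\<lambda>x. ennreal (normal_density 0 (sqrt v) x))
      else return borel 0)"

section \<open>The urn\<close>

text \<open>
  \<open>N n\<close>, \<open>X n\<close>, \<open>A n\<close>, \<open>B n\<close> are relevant for \<open>n \<ge> 1\<close> only. In \<open>urn_K\<close> the natural number
  subtraction \<open>N j \<omega> - X j \<omega>\<close> is an honest one almost surely, because in the urn model below
  \<open>X j \<le> N j\<close> almost surely.
\<close>

definition urn_H ::
    "nat \<Rightarrow> (nat \<Rightarrow> 'w \<Rightarrow> nat) \<Rightarrow> (nat \<Rightarrow> 'w \<Rightarrow> nat) \<Rightarrow> nat \<Rightarrow> 'w \<Rightarrow> nat" where
  "urn_H a X A n \<omega> = a + (\<Sum>j=1..n. A j \<omega> * X j \<omega>)"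

definition urn_K ::
    "nat \<Rightarrow> (nat \<Rightarrow> 'w \<Rightarrow> nat) \<Rightarrow> (nat \<Rightarrow> 'w \<Rightarrow> nat) \<Rightarrow> (nat \<Rightarrow> 'w \<Rightarrow> nat) \<Rightarrow> nat \<Rightarrow> 'w \<Rightarrow> nat" where
  "urn_K b N X B n \<omega> = b + (\<Sum>j=1..n. B j \<omega> * (N j \<omega> - X j \<omega>))"

definition urn_S ::
    "nat \<Rightarrow> nat \<Rightarrow> (nat \<Rightarrow> 'w \<Rightarrow> nat) \<Rightarrow> (nat \<Rightarrow> 'w \<Rightarrow> nat) \<Rightarrow> (nat \<Rightarrow> 'w \<Rightarrow> nat) \<Rightarrow>
     (nat \<Rightarrow> 'w \<Rightarrow> nat) \<Rightarrow> nat \<Rightarrow> 'w \<Rightarrow> nat" where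
  "urn_S a b N X A B n \<omega> = urn_H a X A n \<omega> + urn_K b N X B n \<omega>"

definition urn_Z ::
    "nat \<Rightarrow> nat \<Rightarrow> (nat \<Rightarrow> 'w \<Rightarrow> nat) \<Rightarrow> (nat \<Rightarrow> 'w \<Rightarrow> nat) \<Rightarrow> (nat \<Rightarrow> 'w \<Rightarrow> nat) \<Rightarrow>
     (nat \<Rightarrow> 'w \<Rightarrow> nat) \<Rightarrow> nat \<Rightarrow> 'w \<Rightarrow> real" where
  "urn_Z a b N X A B n \<omega> = real (urn_H a X A n \<omega>) / real (urn_S a b N X A B n \<omega>)"

definition urn_mean :: "(nat \<Rightarrow> 'w \<Rightarrow> nat) \<Rightarrow> (nat \<Rightarrow> 'w \<Rightarrow> nat) \<Rightarrow> nat \<Rightarrow> 'w \<Rightarrow> real" where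
  "urn_mean N X n \<omega> = (\<Sum>j=1..n. real (X j \<omega>) / real (N j \<omega>)) / real n"

text \<open>The sub-sigma-algebra generated by a set of variables with values in the natural numbers.\<close>

definition gen_sigma :: "'w measure \<Rightarrow> ('w \<Rightarrow> nat) set \<Rightarrow> 'w measure" where
  "gen_sigma M Ys = sigma (space M) {Y -` T \<inter> space M | Y T. Y \<in> Ys}"

definition urn_history ::
    "(nat \<Rightarrow> 'w \<Rightarrow> nat) \<Rightarrow> (nat \<Rightarrow> 'w \<Rightarrow> nat) \<Rightarrow> (nat \<Rightarrow> 'w \<Rightarrow> nat) \<Rightarrow> (nat \<Rightarrow> 'w \<Rightarrow> nat) \<Rightarrow>
     nat \<Rightarrow> ('w \<Rightarrow> nat) set" where
  "urn_history N X A B n = (\<Union>j\<in>{1..n}. {N j, X j, A j, B j})"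

definition urn_F ::
    "'w measure \<Rightarrow> (nat \<Rightarrow> 'w \<Rightarrow> nat) \<Rightarrow> (nat \<Rightarrow> 'w \<Rightarrow> nat) \<Rightarrow> (nat \<Rightarrow> 'w \<Rightarrow> nat) \<Rightarrow>
     (nat \<Rightarrow> 'w \<Rightarrow> nat) \<Rightarrow> nat \<Rightarrow> 'w measure" where
  "urn_F M N X A B n = gen_sigma M (urn_history N X A B n)"

text \<open>
  The conditional distribution of \<open>Y\<close> given \<open>G\<close>, as a mass function: \<open>cond_mass M G Y k\<close> is (a version
  of) \<open>P(Y = k | G)\<close>.
\<close>

definition cond_mass :: "'w measure \<Rightarrow> 'w measure \<Rightarrow> ('w \<Rightarrow> nat) \<Rightarrow> nat \<Rightarrow> 'w \<Rightarrow> real" where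
  "cond_mass M G Y k = real_cond_exp M G (indicator (Y -` {k} \<inter> space M))"

text \<open>
  Sample size \<open>n\<close>, population size \<open>s\<close>, number of marked individuals \<open>h\<close>. The guard is needed since
  \<open>n - k = 0\<close> for \<open>k > n\<close>.
\<close>

definition hypergeometric_mass :: "nat \<Rightarrow> nat \<Rightarrow> nat \<Rightarrow> nat \<Rightarrow> real" where
  "hypergeometric_mass n s h k =
     (if k \<le> n then real (h choose k) * real ((s - h) choose (n - k)) / real (s choose n) else 0)"

locale urn_model = prob_space M
  for M :: "'w measure" +
  fixes a b :: nat
    and N X A B :: "nat \<Rightarrow> 'w \<Rightarrow> nat"
  assumes a_ge_1: "a \<ge> 1"
    and b_ge_1: "b \<ge> 1"
    and random_variables: "\<And>n. n \<ge> 1 \<Longrightarrow>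
          N n \<in> M \<rightarrow>\<^sub>M count_space UNIV \<and> X n \<in> M \<rightarrow>\<^sub>M count_space UNIV \<and>
          A n \<in> M \<rightarrow>\<^sub>M count_space UNIV \<and> B n \<in> M \<rightarrow>\<^sub>M count_space UNIV"
    and sample_size: "\<And>n. n \<ge> 1 \<Longrightarrow>
          AE \<omega> in M. \<forall>k. k \<notin> {1..urn_S a b N X A B (n - 1) \<omega>} \<longrightarrow>
            cond_mass M (urn_F M N X A B (n - 1)) (N n) k \<omega> = 0"
    and sample: "\<And>n. n \<ge> 1 \<Longrightarrow>
          AE \<omega> in M. \<forall>k.
            cond_mass M (gen_sigma M (insert (N n) (urn_history N X A B (n - 1)))) (X n) k \<omega> =
            hypergeometric_mass (N n \<omega>) (urn_S a b N X A B (n - 1) \<omega>) (urn_H a X A (n - 1) \<omega>) k"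
    and reinforcement_pos: "\<And>n. n \<ge> 1 \<Longrightarrow> AE \<omega> in M. A n \<omega> \<noteq> 0 \<and> B n \<omega> \<noteq> 0"
    and reinforcement_indep: "\<And>n. n \<ge> 1 \<Longrightarrow>
          indep_set (sets (gen_sigma M {A n, B n}))
            (sets (gen_sigma M (insert (N n) (insert (X n) (urn_history N X A B (n - 1))))))"

end

theory Submission
  imports Defs "HOL-Real_Asymp.Real_Asymp"
begin

text \<open>
  The proportion satisfies \<open>Z\<^sub>j\<^sub>+\<^sub>1 - Z\<^sub>j = D\<^sub>j + R\<^sub>j\<close> with martingale differences \<open>D\<^sub>j = O(1/j)\<close> and remainders
  \<open>R\<^sub>j = O(1/j\<^sup>2)\<close>, and \<open>n (M\<^sub>n - Z\<^sub>n)\<close> is a sum of \<open>n\<close> bounded martingale differences up to \<open>O(log n)\<close>.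
  Hence \<open>s \<surd>n (M\<^sub>n - Z\<^sub>n) + t \<surd>n (Z\<^sub>n - Z)\<close> is, up to an error vanishing in mean, a single row of a
  martingale difference array: its first \<open>n\<close> entries carry the first summand and the later ones the
  second, so that one characteristic function argument yields the joint limit. The limiting
  conditional variance is \<open>s\<^sup>2 U + t\<^sup>2 V\<close> because the second moments of the hypergeometric law are explicit
  and the number of balls grows like \<open>m N n\<close>. Characteristic functions determine the weak limit in
  the plane by tightness and uniform approximation by trigonometric sums.
\<close>

section \<open>Weighted averages and hypergeometric moments\<close>

text \<open>The bound \<open>C\<close> makes every array entry bounded by a deterministic number,
  and the squares of these numbers have uniformly bounded row sums. The correction exp (V / 2) is
  therefore bounded, so neither truncation nor stopping of the rows is needed. The obstacle is that
  \<open>sqrt n\<close> divides in the first block and multiplies in the second, so that no row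
  extends another one. What helps is that all entries of a row are small at once: any fixed initial
  stage becomes negligible, so its events decouple from the rest of the row. The limits are
  conditionally independent because each time index belongs to one block only, which leaves no mixed
  term in s t. The form of U comes from the increment X / N - Z_j - (j + 1) D_j of the first block:
  the sampled fraction X / N has limiting conditional variance Z (1 - Z) L, the term (j + 1) D_j has
  V, and their covariance tends to Z (1 - Z) / N. Equality of the means of A and B is what centres
  D_j.\<close>

lemma toeplitz_weighted_average:
  fixes w :: "nat \<Rightarrow> nat \<Rightarrow> real" and x :: "nat \<Rightarrow> real"
  assumes x: "x \<longlonglongrightarrow> l"
    and fin: "\<And>n. finite (I n)"
    and nonneg: "\<And>n j. j \<in> I n \<Longrightarrow> 0 \<le> w n j"
    and total: "(\<lambda>n. \<Sum>j\<in>I n. w n j) \<longlonglongrightarrow> W"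
    and single: "\<And>j. (\<lambda>n. if j \<in> I n then w n j else 0) \<longlonglongrightarrow> 0"
  shows "(\<lambda>n. \<Sum>j\<in>I n. w n j * x j) \<longlonglongrightarrow> W * l"
proof -
  have "(\<lambda>n. \<Sum>j\<in>I n. w n j * (x j - l)) \<longlonglongrightarrow> 0"
  proof (rule LIMSEQ_I)
    fix e :: real assume e: "0 < e"
    \<comment> \<open>The tail, of total weight eventually below \<open>\<bar>W\<bar> + 1\<close>,
      may then contribute at most \<open>e / 2\<close>; the other half is left for the finitely many
      indices below \<open>J\<close>, whose single weights vanish.\<close>
    define d where "d = e / (2 * (\<bar>W\<bar> + 1))"
    have d: "0 < d" using e by (simp add: d_def)
    obtain J where J: "\<And>j. j \<ge> J \<Longrightarrow> \<bar>x j - l\<bar> < d"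
      using LIMSEQ_D[OF x d] by auto
    have "(\<lambda>n. \<Sum>j<J. (if j \<in> I n then w n j else 0) * \<bar>x j - l\<bar>) \<longlonglongrightarrow> (\<Sum>j<J. 0 * \<bar>x j - l\<bar>)"
      by (intro tendsto_intros single)
    then have "(\<lambda>n. \<Sum>j<J. (if j \<in> I n then w n j else 0) * \<bar>x j - l\<bar>) \<longlonglongrightarrow> 0" by simp
    then have "\<forall>\<^sub>F n in sequentially. (\<Sum>j<J. (if j \<in> I n then w n j else 0) * \<bar>x j - l\<bar>) < e / 2"
      by (rule order_tendstoD) (use e in simp)
    moreover have "\<forall>\<^sub>F n in sequentially. (\<Sum>j\<in>I n. w n j) < \<bar>W\<bar> + 1"
      by (rule order_tendstoD[OF total]) simp
    ultimately have "\<forall>\<^sub>F n in sequentially. norm ((\<Sum>j\<in>I n. w n j * (x j - l)) - 0) < e"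
    proof eventually_elim
      case (elim n)
      have "\<bar>\<Sum>j\<in>I n. w n j * (x j - l)\<bar> \<le> (\<Sum>j\<in>I n. \<bar>w n j * (x j - l)\<bar>)" by (rule sum_abs)
      also have "\<dots> \<le> (\<Sum>j\<in>I n. (if j < J then w n j * \<bar>x j - l\<bar> else 0) + d * w n j)"
      proof (rule sum_mono)
        fix j assume j: "j \<in> I n"
        have w: "0 \<le> w n j" by (rule nonneg[OF j])
        show "\<bar>w n j * (x j - l)\<bar> \<le> (if j < J then w n j * \<bar>x j - l\<bar> else 0) + d * w n j"
          using J[of j] d w mult_right_mono[of "\<bar>x j - l\<bar>" d "w n j"] by (auto simp: abs_mult mult.commute)
      qed
      also have "\<dots> = (\<Sum>j\<in>I n. if j < J then w n j * \<bar>x j - l\<bar> else 0) + d * (\<Sum>j\<in>I n. w n j)"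
        by (simp add: sum.distrib sum_distrib_left)
      also have "(\<Sum>j\<in>I n. if j < J then w n j * \<bar>x j - l\<bar> else 0)
          = (\<Sum>j<J. (if j \<in> I n then w n j else 0) * \<bar>x j - l\<bar>)"
      proof -
        have "(\<Sum>j\<in>I n. if j < J then w n j * \<bar>x j - l\<bar> else 0) = (\<Sum>j\<in>I n \<inter> {..<J}. w n j * \<bar>x j - l\<bar>)"
          using fin by (simp add: sum.If_cases lessThan_def)
        also have "\<dots> = (\<Sum>j\<in>{..<J} \<inter> I n. w n j * \<bar>x j - l\<bar>)" by (simp add: Int_commute)
        also have "\<dots> = (\<Sum>j<J. if j \<in> I n then w n j * \<bar>x j - l\<bar> else 0)"
          by (subst sum.inter_restrict) auto
        also have "\<dots> = (\<Sum>j<J. (if j \<in> I n then w n j else 0) * \<bar>x j - l\<bar>)"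
          by (rule sum.cong) auto
        finally show ?thesis .
      qed
      also have "\<dots> + d * (\<Sum>j\<in>I n. w n j) < e / 2 + d * (\<bar>W\<bar> + 1)"
        using elim d by (intro add_strict_mono mult_strict_left_mono) auto
      also have "\<dots> = e" unfolding d_def by (simp add: field_simps)
      finally show ?case by simp
    qed
    then show "\<exists>no. \<forall>n\<ge>no. norm ((\<Sum>j\<in>I n. w n j * (x j - l)) - 0) < e"
      by (simp add: eventually_sequentially)
  qed
  from tendsto_add[OF this tendsto_mult_right[OF total, of l]]
  show ?thesis by (simp add: algebra_simps sum.distrib sum_subtractf sum_distrib_left)
qed

lemma cesaro_mean_tendsto:
  fixes x :: "nat \<Rightarrow> real"
  assumes "x \<longlonglongrightarrow> l"
  shows "(\<lambda>n. (\<Sum>j<n. x j) / real n) \<longlonglongrightarrow> l"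
proof -
  have "(\<lambda>n. \<Sum>j<n. 1 / real n * x j) \<longlonglongrightarrow> 1 * l"
  proof (rule toeplitz_weighted_average[OF assms])
    have "\<forall>\<^sub>F n in sequentially. (\<Sum>j<n. 1 / real n) = 1"
      using eventually_gt_at_top[of 0] by eventually_elim simp
    then show "(\<lambda>n. \<Sum>j<n. 1 / real n) \<longlonglongrightarrow> 1" by (rule tendsto_eventually)
    fix j :: nat
    have "(\<lambda>n. 1 / real n) \<longlonglongrightarrow> 0" by (rule lim_const_over_n)
    then show "(\<lambda>n. if j \<in> {..<n} then 1 / real n else 0) \<longlonglongrightarrow> 0"
      by (rule Lim_null_comparison[rotated]) auto
  qed auto
  then show ?thesis by (simp add: sum_divide_distrib)
qed

text \<open>Comparison with the telescoping differences \<open>1 / q - 1 / (q + 1)\<close>. The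
  companion lower bound uses the same differences shifted by one index, and the two together pin
  down the tail sum to first order, as the total weight 1 in
  \<open>tail_weighted_average_tendsto\<close> requires.\<close>

lemma sum_inverse_square_le:
  assumes "0 < p"
  shows "(\<Sum>j=p..<q. 1 / (real (Suc j))\<^sup>2) \<le> 1 / real p"
proof -
  have "p \<le> q \<Longrightarrow> (\<Sum>j=p..<q. 1 / (real (Suc j))\<^sup>2) \<le> 1 / real p - 1 / real q"
  proof (induction q rule: dec_induct)
    case (step q)
    have "0 < real q" using step assms by simp
    then have "1 / (real (Suc q))\<^sup>2 \<le> 1 / real q - 1 / real (Suc q)"
      by (simp add: divide_simps power2_eq_square)
    then show ?case using step by simp
  qed simp
  then show ?thesis by (cases "p \<le> q") (auto intro: order_trans)
qed

lemma sum_inverse_square_ge: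
  assumes "p \<le> q"
  shows "1 / real (Suc p) - 1 / real (Suc q) \<le> (\<Sum>j=p..<q. 1 / (real (Suc j))\<^sup>2)"
  using assms
proof (induction q rule: dec_induct)
  case (step q)
  have "1 / real (Suc q) - 1 / real (Suc (Suc q)) \<le> 1 / (real (Suc q))\<^sup>2"
    by (simp add: divide_simps power2_eq_square)
  then show ?case using step by simp
qed simp

text \<open>These are the weights with which the conditional variances of
  \<open>sqrt n * drift j\<close> enter, once the factor \<open>1 / (j + 1)\<^sup>2\<close> is taken
  out of them. Cutting the sum at \<open>n\<^sup>2\<close> costs only a weight of order
  \<open>1 / n\<close>.\<close>

lemma tail_weighted_average_tendsto:
  fixes x :: "nat \<Rightarrow> real"
  assumes "x \<longlonglongrightarrow> l"
  shows "(\<lambda>n. \<Sum>j=n..<n\<^sup>2. real n / (real (Suc j))\<^sup>2 * x j) \<longlonglongrightarrow> l"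
proof -
  have "(\<lambda>n. \<Sum>j=n..<n\<^sup>2. real n / (real (Suc j))\<^sup>2 * x j) \<longlonglongrightarrow> 1 * l"
  proof (rule toeplitz_weighted_average[OF assms])
    show "(\<lambda>n. \<Sum>j=n..<n\<^sup>2. real n / (real (Suc j))\<^sup>2) \<longlonglongrightarrow> 1"
    proof (rule tendsto_sandwich)
      have eq: "(\<Sum>j=n..<n\<^sup>2. real n / (real (Suc j))\<^sup>2) = real n * (\<Sum>j=n..<n\<^sup>2. 1 / (real (Suc j))\<^sup>2)" for n
        by (simp add: sum_distrib_left)
      show "\<forall>\<^sub>F n in sequentially. (\<Sum>j=n..<n\<^sup>2. real n / (real (Suc j))\<^sup>2) \<le> 1"
        using eventually_gt_at_top[of 0]
      proof eventually_elim
        case (elim n)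
        show ?case unfolding eq using mult_left_mono[OF sum_inverse_square_le[of n "n\<^sup>2"], of "real n"] elim
          by simp
      qed
      show "\<forall>\<^sub>F n in sequentially. real n * (1 / real (Suc n) - 1 / real (Suc (n\<^sup>2)))
             \<le> (\<Sum>j=n..<n\<^sup>2. real n / (real (Suc j))\<^sup>2)"
        unfolding eq by (intro always_eventually allI mult_left_mono sum_inverse_square_ge)
          (auto simp: power2_eq_square)
      show "(\<lambda>n. real n * (1 / real (Suc n) - 1 / real (Suc (n\<^sup>2)))) \<longlonglongrightarrow> 1"
        by real_asymp
      show "(\<lambda>n. 1::real) \<longlonglongrightarrow> 1" by simp
    qed
    fix j
    have "\<forall>\<^sub>F n in sequentially. (if j \<in> {n..<n\<^sup>2} then real n / (real (Suc j))\<^sup>2 else 0) = 0"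
      using eventually_gt_at_top[of j] by eventually_elim auto
    then show "(\<lambda>n. if j \<in> {n..<n\<^sup>2} then real n / (real (Suc j))\<^sup>2 else 0) \<longlonglongrightarrow> 0"
      by (rule tendsto_eventually)
  qed auto
  then show ?thesis by simp
qed

text \<open>Strictly between \<open>r\<^sup>2\<close> and \<open>(r + 1)\<^sup>2\<close> there are
  \<open>2 * r\<close> indices, and each step there is at most \<open>c / (r\<^sup>2 + 1)\<close>,
  so the oscillation is of order \<open>1 / r\<close>.\<close>

lemma tendsto_from_squares:
  fixes x :: "nat \<Rightarrow> real"
  assumes step: "\<And>n. \<bar>x (Suc n) - x n\<bar> \<le> c / real (Suc n)"
    and sq: "(\<lambda>k. x (k\<^sup>2)) \<longlonglongrightarrow> l"
  shows "x \<longlonglongrightarrow> l"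
proof -
  define r where "r n = nat \<lfloor>sqrt (real n)\<rfloor>" for n
  have c: "0 \<le> c" using step[of 0] by simp
  have r1: "(r n)\<^sup>2 \<le> n" for n
  proof -
    have "real (r n) \<le> sqrt (real n)" unfolding r_def by simp
    then have "(real (r n))\<^sup>2 \<le> (sqrt (real n))\<^sup>2" by (intro power_mono) auto
    then have "real ((r n)\<^sup>2) \<le> real n" by simp
    then show ?thesis by (simp only: of_nat_le_iff)
  qed
  have r2: "n \<le> (r n)\<^sup>2 + 2 * r n" for n
  proof -
    have "sqrt (real n) < real (r n) + 1" unfolding r_def by linarith
    then have "(sqrt (real n))\<^sup>2 < (real (r n) + 1)\<^sup>2" by (intro power_strict_mono) auto
    then have "real n < real ((r n)\<^sup>2 + 2 * r n + 1)" by (simp add: power2_eq_square algebra_simps)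
    then show ?thesis by linarith
  qed
  have rlim: "filterlim r at_top sequentially"
    unfolding r_def by (intro filterlim_compose[OF filterlim_nat_sequentially] 
      filterlim_compose[OF filterlim_floor_sequentially] filterlim_compose[OF sqrt_at_top] filterlim_real_sequentially)
  have gap: "p \<le> q \<Longrightarrow> \<bar>x q - x p\<bar> \<le> c / real (Suc p) * real (q - p)" for p q
  proof (induction q rule: dec_induct)
    case (step q)
    have "\<bar>x (Suc q) - x q\<bar> \<le> c / real (Suc q)" by (rule assms(1))
    also have "\<dots> \<le> c / real (Suc p)" using step c by (intro divide_left_mono) auto
    finally have "\<bar>x (Suc q) - x q\<bar> \<le> c / real (Suc p)" .
    moreover have "real (Suc q - p) = real (q - p) + 1" using step by simp
    ultimately show ?case using step.IH by (simp only: distrib_left)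
  qed simp
  have diff: "\<bar>x n - x ((r n)\<^sup>2)\<bar> \<le> 2 * c * (real (r n) / real (Suc ((r n)\<^sup>2)))" for n
  proof -
    have "real (n - (r n)\<^sup>2) \<le> 2 * real (r n)" using r2[of n] by linarith
    then have "c / real (Suc ((r n)\<^sup>2)) * real (n - (r n)\<^sup>2) \<le> c / real (Suc ((r n)\<^sup>2)) * (2 * real (r n))"
      using c by (intro mult_left_mono) auto
    then show ?thesis using gap[OF r1[of n]] by (simp add: mult_ac)
  qed
  have "(\<lambda>k. 2 * c * (real k / real (Suc (k\<^sup>2)))) \<longlonglongrightarrow> 0"
  proof -
    have "(\<lambda>k. real k / real (Suc (k\<^sup>2))) \<longlonglongrightarrow> 0" by real_asymp
    from tendsto_mult_right_zero[OF this] show ?thesis by simp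
  qed
  from filterlim_compose[OF this rlim]
  have "(\<lambda>n. 2 * c * (real (r n) / real (Suc ((r n)\<^sup>2)))) \<longlonglongrightarrow> 0" .
  then have "(\<lambda>n. x n - x ((r n)\<^sup>2)) \<longlonglongrightarrow> 0"
    by (rule Lim_null_comparison[rotated]) (use diff in auto)
  from tendsto_add[OF this filterlim_compose[OF sq rlim]] show ?thesis by simp
qed

section \<open>Moments of the hypergeometric law\<close>

lemma vandermonde_weighted:
  assumes "1 \<le> n" "1 \<le> h"
  shows "(\<Sum>k\<le>n. k * (h choose k) * (g choose (n - k))) = h * ((h - 1 + g) choose (n - 1))"
proof -
  obtain n' h' where nh: "n = Suc n'" "h = Suc h'" using assms by (metis Suc_pred' less_eq_Suc_le One_nat_def)
  have "(\<Sum>k\<le>n. k * (h choose k) * (g choose (n - k))) = (\<Sum>k\<le>n'. Suc k * (h choose Suc k) * (g choose (n - Suc k)))"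
    unfolding nh by (subst sum.atMost_Suc_shift) simp
  also have "\<dots> = (\<Sum>k\<le>n'. h * ((h' choose k) * (g choose (n' - k))))"
    unfolding nh by (intro sum.cong refl) (simp only: Suc_times_binomial_eq diff_Suc_Suc mult.assoc[symmetric], simp add: mult_ac)
  also have "\<dots> = h * ((h' + g) choose n')" by (simp add: sum_distrib_left[symmetric] vandermonde)
  finally show ?thesis by (simp add: nh)
qed

lemma hypergeometric_mean:
  assumes h: "1 \<le> h" "h \<le> s" and n: "1 \<le> n" "n \<le> s"
  shows "(\<Sum>k\<le>n. real k * hypergeometric_mass n s h k) = real n * real h / real s"
proof -
  have "(\<Sum>k\<le>n. real k * hypergeometric_mass n s h k)
      = real (\<Sum>k\<le>n. k * (h choose k) * ((s - h) choose (n - k))) / real (s choose n)"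
    by (simp add: hypergeometric_mass_def sum_divide_distrib mult.assoc)
  also have "(\<Sum>k\<le>n. k * (h choose k) * ((s - h) choose (n - k))) = h * ((s - 1) choose (n - 1))"
    using vandermonde_weighted[OF n(1) h(1), of "s - h"] h by simp
  also have "real (h * ((s - 1) choose (n - 1))) / real (s choose n) = real n * real h / real s"
  proof -
    have "n * (s choose n) = s * ((s - 1) choose (n - 1))"
      using n by (intro times_binomial_minus1_eq) simp
    then have *: "real n * real (s choose n) = real s * real ((s - 1) choose (n - 1))"
      by (metis of_nat_mult)
    have "real s > 0" "real (s choose n) > 0" using n by (auto simp: zero_less_binomial)
    then show ?thesis using * by (simp add: field_simps)
  qed
  finally show ?thesis .
qed

text \<open>The falling factorial is used instead of the square since \<open>k * (k - 1)\<close> is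
  absorbed by the binomial coefficient: the factors \<open>h\<close> and \<open>h - 1\<close> come
  out, and Vandermonde's identity remains with all three parameters lowered by 2.\<close>

lemma hypergeometric_factorial_moment:
  assumes h: "1 \<le> h" "h \<le> s" and n: "1 \<le> n" "n \<le> s" and s: "2 \<le> s"
  shows "(\<Sum>k\<le>n. real k * (real k - 1) * hypergeometric_mass n s h k)
     = real n * (real n - 1) * (real h * (real h - 1) / (real s * (real s - 1)))"
proof (cases "2 \<le> n \<and> 2 \<le> h")
  case True
  then obtain n' h' s' where e: "n = Suc (Suc n')" "h = Suc (Suc h')" "s = Suc (Suc s')"
    using s by (metis One_nat_def Suc_1 Suc_le_D Suc_le_mono)
  have le: "h' \<le> s'" "n' \<le> s'" using h n e by auto
  have trm: "real (Suc (Suc k)) * (real (Suc (Suc k)) - 1) * real (h choose Suc (Suc k))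
     = real h * (real h - 1) * real (h' choose k)" for k
  proof -
    have 1: "real (Suc (Suc k)) * real (h choose Suc (Suc k)) = real h * real (Suc h' choose Suc k)"
      unfolding e by (metis Suc_times_binomial_eq of_nat_mult mult.commute)
    have 2: "real (Suc k) * real (Suc h' choose Suc k) = real (Suc h') * real (h' choose k)"
      by (metis Suc_times_binomial_eq of_nat_mult mult.commute)
    have "real (Suc (Suc k)) * (real (Suc (Suc k)) - 1) * real (h choose Suc (Suc k))
       = real (Suc k) * (real (Suc (Suc k)) * real (h choose Suc (Suc k)))" by (simp add: mult_ac)
    also have "\<dots> = real h * (real (Suc k) * real (Suc h' choose Suc k))" by (simp only: 1 mult_ac)
    also have "\<dots> = real h * (real h - 1) * real (h' choose k)" unfolding 2 e by (simp add: mult_ac)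
    finally show ?thesis .
  qed
  have "(\<Sum>k\<le>n. real k * (real k - 1) * hypergeometric_mass n s h k)
     = (\<Sum>k\<le>n. real k * (real k - 1) * real (h choose k) * real ((s - h) choose (n - k))) / real (s choose n)"
    by (simp add: hypergeometric_mass_def sum_divide_distrib mult.assoc)
  also have "(\<Sum>k\<le>n. real k * (real k - 1) * real (h choose k) * real ((s - h) choose (n - k)))
     = (\<Sum>k\<le>n'. real (Suc (Suc k)) * (real (Suc (Suc k)) - 1) * real (h choose Suc (Suc k)) * real ((s - h) choose (n' - k)))"
    unfolding e(1) by (subst sum.atMost_Suc_shift, subst sum.atMost_Suc_shift) simp
  also have "\<dots> = (\<Sum>k\<le>n'. real h * (real h - 1) * real ((h' choose k) * ((s' - h') choose (n' - k))))"
    unfolding trm by (intro sum.cong refl) (simp add: e mult_ac)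
  also have "\<dots> = real h * (real h - 1) * real (s' choose n')"
    by (simp only: sum_distrib_left[symmetric] of_nat_sum[symmetric] vandermonde) (simp add: le)
  also have "\<dots> / real (s choose n) = real n * (real n - 1) * (real h * (real h - 1) / (real s * (real s - 1)))"
  proof -
    have 1: "real n * real (s choose n) = real s * real (Suc s' choose Suc n')"
      unfolding e by (metis Suc_times_binomial_eq of_nat_mult mult.commute)
    have 2: "real (Suc n') * real (Suc s' choose Suc n') = real (Suc s') * real (s' choose n')"
      by (metis Suc_times_binomial_eq of_nat_mult mult.commute)
    have "real n * (real n - 1) * real (s choose n) = (real n - 1) * (real n * real (s choose n))" by (simp add: mult_ac)
    also have "\<dots> = real s * (real (Suc n') * real (Suc s' choose Suc n'))" unfolding 1 by (simp add: e mult_ac)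
    also have "\<dots> = real s * (real s - 1) * real (s' choose n')" unfolding 2 by (simp add: e mult_ac)
    finally have 3: "real n * (real n - 1) * real (s choose n) = real s * (real s - 1) * real (s' choose n')" .
    have "s choose n > 0" using n by (simp add: zero_less_binomial)
    then have pos: "real (s choose n) > 0" "real s * (real s - 1) > 0"
      using s by auto
    have "real h * (real h - 1) * real (s' choose n') * (real s * (real s - 1))
       = real h * (real h - 1) * (real n * (real n - 1) * real (s choose n))" unfolding 3 by (simp only: mult_ac)
    then show ?thesis using pos s unfolding times_divide_eq_right
      by (subst frac_eq_eq) (simp_all add: mult_ac)
  qed
  finally show ?thesis .
next
  \<comment> \<open>For \<open>n = 1\<close> or \<open>h = 1\<close> the right-hand side has a zero
    factor, and on the left no \<open>k \<ge> 2\<close> carries mass.\<close>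
  case False
  have "real k * (real k - 1) * hypergeometric_mass n s h k = 0" if "k \<le> n" for k
  proof (cases "k \<le> 1")
    case True then show ?thesis by (cases k) auto
  next
    case k: False
    then have "h = 1" using False h n that by auto
    then have "h choose k = 0" using k by simp
    then show ?thesis by (simp add: hypergeometric_mass_def)
  qed
  moreover have "n = 1 \<or> h = 1" using False h n by auto
  ultimately show ?thesis by (auto simp: sum.neutral)
qed

section \<open>Weak convergence in the plane\<close>

text \<open>The phase \<open>d\<close> covers sines and constants by the same clause, and the
  product-to-sum formula closes the class under products. Integrals of its members are governed by
  characteristic functions, since a cosine with phase is the real part of a rotated complex
  exponential.\<close>

inductive trig_sum :: "(real \<times> real \<Rightarrow> real) \<Rightarrow> bool" where
  wave: "trig_sum (\<lambda>z. c * cos (s * fst z + t * snd z + d))"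
| add: "trig_sum f \<Longrightarrow> trig_sum g \<Longrightarrow> trig_sum (\<lambda>z. f z + g z)"

lemma trig_sum_const: "trig_sum (\<lambda>z. c)"
  using trig_sum.wave[of c 0 0 0] by simp

lemma trig_sum_mult:
  assumes "trig_sum f" "trig_sum g"
  shows "trig_sum (\<lambda>z. f z * g z)"
  using assms(1)
proof (induction rule: trig_sum.induct)
  case (wave c s t d)
  show ?case using assms(2)
  proof (induction rule: trig_sum.induct)
    case (wave c' s' t' d')
    have "c * cos (s * fst z + t * snd z + d) * (c' * cos (s' * fst z + t' * snd z + d'))
      = (c * c' / 2) * cos ((s - s') * fst z + (t - t') * snd z + (d - d'))
      + (c * c' / 2) * cos ((s + s') * fst z + (t + t') * snd z + (d + d'))" for z :: "real \<times> real"
    proof -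
      have "(s - s') * fst z + (t - t') * snd z + (d - d') = (s * fst z + t * snd z + d) - (s' * fst z + t' * snd z + d')"
        "(s + s') * fst z + (t + t') * snd z + (d + d') = (s * fst z + t * snd z + d) + (s' * fst z + t' * snd z + d')"
        by (simp_all add: algebra_simps)
      then show ?thesis by (simp only: cos_diff cos_add) (simp add: field_simps)
    qed
    then show ?case by (simp only: trig_sum.add trig_sum.wave)
  next
    case (add f g)
    then show ?case using trig_sum.add by (simp add: distrib_left)
  qed
next
  case (add f g)
  then show ?case using trig_sum.add by (simp add: distrib_right)
qed

lemma trig_sum_polynomial:
  assumes "real_polynomial_function p"
  shows "trig_sum (\<lambda>z. p (sin (\<kappa> * fst z), sin (\<kappa> * snd z)))"
  using assms
proof (induction rule: real_polynomial_function.induct)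
  case (linear f)
  interpret bounded_linear f by fact
  define u v where "u = f (1, 0)" and "v = f (0, 1)"
  have eq: "f (x, y) = u * x + v * y" for x y
  proof -
    have "f (x, y) = f (x *\<^sub>R (1, 0) + y *\<^sub>R (0, 1))" by simp
    also have "\<dots> = u * x + v * y" by (simp only: add scaleR) (simp add: u_def v_def)
    finally show ?thesis .
  qed
  have shift: "sin x = cos (x + - pi / 2)" for x :: real
    by (simp add: cos_diff)
  have "f (sin (\<kappa> * fst z), sin (\<kappa> * snd z))
     = u * cos (\<kappa> * fst z + 0 * snd z + - pi / 2) + v * cos (0 * fst z + \<kappa> * snd z + - pi / 2)"
    for z :: "real \<times> real" by (simp only: eq shift mult_zero_left add_0_left add_0_right)
  then show ?case by (simp only: trig_sum.add trig_sum.wave)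
next
  case (const c)
  show ?case by (rule trig_sum_const)
next
  case (add f g)
  then show ?case by (intro trig_sum.add)
next
  case (mult f g)
  then show ?case by (intro trig_sum_mult)
qed

lemma trig_sum_continuous: "trig_sum f \<Longrightarrow> continuous_on UNIV f"
  by (induction rule: trig_sum.induct) (auto intro!: continuous_intros)

lemma trig_sum_bounded: "trig_sum f \<Longrightarrow> \<exists>B. \<forall>z. \<bar>f z\<bar> \<le> B"
proof (induction rule: trig_sum.induct)
  case (wave c s t d)
  have "\<bar>c * cos u\<bar> \<le> \<bar>c\<bar>" for u :: real
    by (simp add: abs_mult mult_left_le)
  then show ?case by blast
next
  case (add f g)
  then obtain B C where "\<And>z. \<bar>f z\<bar> \<le> B" "\<And>z. \<bar>g z\<bar> \<le> C" by blast
  then have "\<bar>f z + g z\<bar> \<le> B + C" for z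
    by (intro order_trans[OF abs_triangle_ineq] add_mono)
  then show ?case by blast
qed

text \<open>
  The substitution \<open>u = sin (x / R)\<close> is inverted by \<open>x = R arcsin u\<close> for \<open>\<bar>x\<bar> \<le> R\<close>, which turns
  algebraic polynomials on the square \<open>[-1, 1]\<^sup>2\<close> into trigonometric ones that stay bounded on the
  whole plane.
\<close>

lemma trig_sum_approximation:
  fixes f :: "real \<times> real \<Rightarrow> real"
  assumes cont: "continuous_on UNIV f" and bnd: "\<And>z. \<bar>f z\<bar> \<le> B" and R: "0 < R" and e: "0 < e"
  obtains p where "trig_sum p" "\<And>z. \<bar>p z\<bar> \<le> B + e" "\<And>z. norm z \<le> R \<Longrightarrow> \<bar>f z - p z\<bar> < e"
proof -
  define h where "h w = f (R * arcsin (fst w), R * arcsin (snd w))" for w :: "real \<times> real"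
  define S :: "(real \<times> real) set" where "S = {-1..1} \<times> {-1..1}"
  have "compact S" unfolding S_def by (intro compact_Times) auto
  moreover have "continuous_on S h" unfolding h_def S_def
    by (intro continuous_on_compose2[OF cont] continuous_intros) (auto simp: mem_Times_iff)
  ultimately obtain q where q: "real_polynomial_function q" "\<And>w. w \<in> S \<Longrightarrow> \<bar>h w - q w\<bar> < e"
    using Stone_Weierstrass_real_polynomial_function[OF _ _ e] by metis
  define p where "p z = q (sin (1 / R * fst z), sin (1 / R * snd z))" for z :: "real \<times> real"
  have in_S: "(sin x, sin y) \<in> S" for x y unfolding S_def by simp
  show ?thesis
  proof (rule that)
    show "trig_sum p" unfolding p_def by (rule trig_sum_polynomial[OF q(1)])
    fix z
    have "\<bar>h w\<bar> \<le> B" for w unfolding h_def by (rule bnd)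
    from q(2)[OF in_S, of "1 / R * fst z" "1 / R * snd z"] this[of "(sin (1 / R * fst z), sin (1 / R * snd z))"]
    show "\<bar>p z\<bar> \<le> B + e" unfolding p_def by linarith
    assume z: "norm z \<le> R"
    have arc: "R * arcsin (sin (1 / R * x)) = x" if "\<bar>x\<bar> \<le> R" for x
    proof -
      have "\<bar>1 / R * x\<bar> \<le> 1" using that R by (simp add: abs_mult)
      then have "- (pi / 2) \<le> 1 / R * x" "1 / R * x \<le> pi / 2" using pi_ge_two by linarith+
      from arcsin_sin[OF this] show ?thesis using R by simp
    qed
    have "\<bar>fst z\<bar> \<le> R" "\<bar>snd z\<bar> \<le> R"
      using z norm_fst_le[of "fst z" "snd z"] norm_snd_le[of "snd z" "fst z"] by auto
    then have "h (sin (1 / R * fst z), sin (1 / R * snd z)) = f z"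
      unfolding h_def by (simp add: arc[simplified])
    then show "\<bar>f z - p z\<bar> < e" using q(2)[OF in_S, of "1 / R * fst z" "1 / R * snd z"] unfolding p_def by simp
  qed
qed

lemma (in prob_space) integral_diff_le_tail:
  fixes f p :: "'a \<Rightarrow> real"
  assumes [measurable]: "f \<in> borel_measurable M" "p \<in> borel_measurable M" "T \<in> sets M"
    and f: "\<And>z. \<bar>f z\<bar> \<le> B" and p: "\<And>z. \<bar>p z\<bar> \<le> B + e" and e: "0 \<le> e" 
    and near: "\<And>z. z \<in> space M - T \<Longrightarrow> \<bar>f z - p z\<bar> \<le> e"
  shows "\<bar>(\<integral>z. f z \<partial>M) - (\<integral>z. p z \<partial>M)\<bar> \<le> e + (2 * B + e) * measure M T"
proof -
  have int: "integrable M f" "integrable M p"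
    using f p by (auto intro!: integrable_const_bound[where B="B + e"] simp: add_increasing2 e)
  have ind: "integrable M (\<lambda>z. indicator T z :: real)"
    by (intro integrable_const_bound[where B=1]) auto
  have "\<bar>(\<integral>z. f z \<partial>M) - (\<integral>z. p z \<partial>M)\<bar> = \<bar>\<integral>z. f z - p z \<partial>M\<bar>" using int by simp
  also have "\<dots> \<le> (\<integral>z. \<bar>f z - p z\<bar> \<partial>M)" by (rule integral_abs_bound)
  also have "\<dots> \<le> (\<integral>z. e + (2 * B + e) * indicator T z \<partial>M)"
  proof (rule integral_mono)
    show "integrable M (\<lambda>z. \<bar>f z - p z\<bar>)" using int by simp
    show "integrable M (\<lambda>z. e + (2 * B + e) * indicator T z)" using ind by simp
    fix z assume "z \<in> space M"
    then show "\<bar>f z - p z\<bar> \<le> e + (2 * B + e) * indicator T z"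
      using near[of z] f[of z] p[of z] e by (cases "z \<in> T") (auto simp: indicator_def)
  qed
  also have "\<dots> = e + (2 * B + e) * measure M T"
    using ind by (simp add: prob_space)
  finally show ?thesis .
qed

theorem weakly_converges_plane_I:
  fixes \<mu> :: "nat \<Rightarrow> (real \<times> real) measure" and \<nu> :: "(real \<times> real) measure"
  assumes \<mu>: "\<And>n. prob_space (\<mu> n)" "\<And>n. sets (\<mu> n) = sets borel"
    and \<nu>: "prob_space \<nu>" "sets \<nu> = sets borel"
    and tight: "\<And>e. 0 < e \<Longrightarrow> \<exists>R. \<forall>n. measure (\<mu> n) {z. norm z > R} \<le> e"
    and wave: "\<And>s t d. (\<lambda>n. \<integral>z. cos (s * fst z + t * snd z + d) \<partial>\<mu> n)
                  \<longlonglongrightarrow> (\<integral>z. cos (s * fst z + t * snd z + d) \<partial>\<nu>)"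
  shows "weakly_converges \<mu> \<nu>"
  unfolding weakly_converges_def
proof (intro allI impI)
  fix f :: "real \<times> real \<Rightarrow> real"
  assume cont: "continuous_on UNIV f" and "bounded (range f)"
  then obtain B where B: "\<And>z. \<bar>f z\<bar> \<le> B" by (auto simp: bounded_iff)
  then have B0: "0 \<le> B" using abs_ge_zero order_trans by blast
  interpret N: prob_space \<nu> by fact
  have trig: "(\<lambda>n. \<integral>z. p z \<partial>\<mu> n) \<longlonglongrightarrow> (\<integral>z. p z \<partial>\<nu>)" if "trig_sum p" for p
    using that
  proof (induction rule: trig_sum.induct)
    case (wave c s t d)
    show ?case by (simp add: tendsto_mult_left assms(6))
  next
    case (add f g)
    have int: "integrable M h" if h: "trig_sum h" "prob_space M" "sets M = sets borel" for h and M :: "(real \<times> real) measure"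
    proof -
      obtain B where "\<And>z. \<bar>h z\<bar> \<le> B" using trig_sum_bounded[OF h(1)] by auto
      moreover have "h \<in> borel_measurable M"
        using borel_measurable_continuous_onI[OF trig_sum_continuous[OF h(1)]] h(3)
        by (simp cong: measurable_cong_sets)
      ultimately show ?thesis using h(2)
        by (auto intro!: finite_measure.integrable_const_bound[where B=B] simp: prob_space_def)
    qed
    show ?case using add \<mu> \<nu> by (simp add: int tendsto_add)
  qed
  have tail_\<nu>: "\<exists>R0. \<forall>R\<ge>R0. measure \<nu> {z. norm z > R} \<le> e" if "0 < e" for e
  proof -
    have "(\<lambda>k. measure \<nu> {z. norm z > real k}) \<longlonglongrightarrow> measure \<nu> (\<Inter>k. {z. norm z > real k})"
      by (rule N.finite_Lim_measure_decseq) (auto simp: \<nu> decseq_def intro!: borel_open open_Collect_less continuous_intros)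
    moreover have "(\<Inter>k. {z :: real \<times> real. norm z > real k}) = {}"
    proof -
      have "\<exists>k. \<not> norm z > real k" for z :: "real \<times> real"
        using real_arch_simple[of "norm z"] by (auto simp: not_less)
      then show ?thesis by blast
    qed
    ultimately have "(\<lambda>k. measure \<nu> {z. norm z > real k}) \<longlonglongrightarrow> 0" by simp
    then have "\<forall>\<^sub>F k in sequentially. measure \<nu> {z. norm z > real k} < e"
      by (rule order_tendstoD) (use that in simp)
    then obtain k where k: "measure \<nu> {z. norm z > real k} < e" by (auto simp: eventually_sequentially)
    have "measure \<nu> {z. norm z > R} \<le> e" if "R \<ge> real k" for R
    proof -
      have "measure \<nu> {z. norm z > R} \<le> measure \<nu> {z. norm z > real k}"
        by (rule N.finite_measure_mono) (use that in \<open>auto simp: \<nu> intro!: borel_open open_Collect_less continuous_intros\<close>)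
      then show ?thesis using k by simp
    qed
    then show ?thesis by blast
  qed
  show "(\<lambda>n. \<integral>z. f z \<partial>\<mu> n) \<longlonglongrightarrow> (\<integral>z. f z \<partial>\<nu>)"
  proof (rule LIMSEQ_I)
    fix e :: real assume e: "0 < e"
    \<comment> \<open>Replacing \<open>f\<close> by \<open>p\<close> costs at most
      \<open>d + (2 * B + d) * d\<close>, which for \<open>d \<le> 1\<close> is at most
      \<open>d * (2 * B + 2)\<close>; this is to be at most \<open>e / 4\<close>. Three comparisons
      of that size are added at the end.\<close>
    define d where "d = min 1 (e / (4 * (2 * B + 2)))"
    have "d * (2 * B + 2) \<le> e / (4 * (2 * B + 2)) * (2 * B + 2)"
      unfolding d_def using B0 by (intro mult_right_mono) auto
    also have "\<dots> = e / 4" using B0 by (simp add: field_simps)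
    finally have d: "0 < d" "d \<le> 1" "d * (2 * B + 2) \<le> e / 4" using e B0 by (auto simp: d_def)
    obtain R1 where R1: "\<And>n. measure (\<mu> n) {z. norm z > R1} \<le> d" using tight[OF d(1)] by blast
    obtain R2 where R2: "\<And>R. R \<ge> R2 \<Longrightarrow> measure \<nu> {z. norm z > R} \<le> d" using tail_\<nu>[OF d(1)] by blast
    define R where "R = max 1 (max R1 R2)"
    have R0: "0 < R" unfolding R_def by simp
    obtain p where p: "trig_sum p" "\<And>z. \<bar>p z\<bar> \<le> B + d" "\<And>z. norm z \<le> R \<Longrightarrow> \<bar>f z - p z\<bar> < d"
      using trig_sum_approximation[OF cont B R0 d(1)] by metis
    have close: "\<bar>(\<integral>z. f z \<partial>M) - (\<integral>z. p z \<partial>M)\<bar> \<le> e / 4"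
      if "prob_space M" and sets: "sets M = sets borel" and tail: "measure M {z. norm z > R} \<le> d" for M
    proof -
      interpret prob_space M by fact
      have space: "space M = UNIV" using sets_eq_imp_space_eq[OF sets] by simp
      have "\<bar>(\<integral>z. f z \<partial>M) - (\<integral>z. p z \<partial>M)\<bar> \<le> d + (2 * B + d) * measure M {z. norm z > R}"
      proof (rule integral_diff_le_tail)
        show "f \<in> borel_measurable M" "p \<in> borel_measurable M"
          using borel_measurable_continuous_onI[OF trig_sum_continuous[OF p(1)]] borel_measurable_continuous_onI[OF cont] sets
          by (simp_all cong: measurable_cong_sets)
        show "{z. norm z > R} \<in> sets M" unfolding sets
          by (auto intro!: borel_open open_Collect_less continuous_intros)
        show "\<bar>f z - p z\<bar> \<le> d" if "z \<in> space M - {z. norm z > R}" for z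
          using p(3)[of z] that by auto
      qed (use B p d in auto)
      also have "\<dots> \<le> d + (2 * B + d) * d" using tail B0 d by (intro add_left_mono mult_left_mono) auto
      also have "\<dots> \<le> d + (2 * B + 1) * d" using d B0 by (intro add_left_mono mult_right_mono) auto
      also have "\<dots> = d * (2 * B + 2)" by (simp add: algebra_simps)
      finally show ?thesis using d by linarith
    qed
    have "measure (\<mu> n) {z. norm z > R} \<le> d" for n
    proof -
      interpret prob_space "\<mu> n" by fact
      have "measure (\<mu> n) {z. norm z > R} \<le> measure (\<mu> n) {z. norm z > R1}"
        by (rule finite_measure_mono) (auto simp: \<mu> R_def intro!: borel_open open_Collect_less continuous_intros)
      then show ?thesis using R1[of n] by simp
    qed
    then have c1: "\<bar>(\<integral>z. f z \<partial>\<mu> n) - (\<integral>z. p z \<partial>\<mu> n)\<bar> \<le> e / 4" for n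
      by (intro close \<mu>)
    have c2: "\<bar>(\<integral>z. f z \<partial>\<nu>) - (\<integral>z. p z \<partial>\<nu>)\<bar> \<le> e / 4"
      by (intro close \<nu> R2) (simp add: R_def)
    have "\<exists>no. \<forall>n\<ge>no. norm ((\<integral>z. p z \<partial>\<mu> n) - (\<integral>z. p z \<partial>\<nu>)) < e / 4"
      by (rule LIMSEQ_D[OF trig[OF p(1)]]) (use e in simp)
    then obtain no where no: "\<And>n. n \<ge> no \<Longrightarrow> \<bar>(\<integral>z. p z \<partial>\<mu> n) - (\<integral>z. p z \<partial>\<nu>)\<bar> < e / 4" by auto
    have "norm ((\<integral>z. f z \<partial>\<mu> n) - (\<integral>z. f z \<partial>\<nu>)) < e" if "n \<ge> no" for n
      using no[OF that] c1[of n] c2 e unfolding real_norm_def by linarith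
    then show "\<exists>no. \<forall>n\<ge>no. norm ((\<integral>z. f z \<partial>\<mu> n) - (\<integral>z. f z \<partial>\<nu>)) < e" by blast
  qed
qed

section \<open>Martingale difference arrays\<close>

lemma square_le_of_abs_le: "\<bar>x\<bar> \<le> b \<Longrightarrow> x\<^sup>2 \<le> b\<^sup>2" for x b :: real
  using power_mono[of "\<bar>x\<bar>" b 2] by simp

lemma norm_exp_minus_one_le: "norm (exp z - 1) \<le> norm z * exp \<bar>Re z\<bar>" for z :: complex
  using Taylor_exp[of z 0] by (simp add: mult.commute)

lemma iexp_quadratic_bound:
  fixes x :: real
  shows "norm (iexp x - 1 - \<i> * x + x\<^sup>2 / 2) \<le> \<bar>x\<bar> ^ 3"
proof -
  have "norm (iexp x - (\<Sum>k\<le>2. (\<i> * x) ^ k / fact k)) \<le> \<bar>x\<bar> ^ 3 / 2"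
    using Taylor_exp[of "\<i> * x" 2] by (simp add: numeral_3_eq_3 norm_mult del: power_Suc)
  also have "(\<Sum>k\<le>2. (\<i> * x) ^ k / fact k) = 1 + \<i> * x - x\<^sup>2 / 2"
    by (simp add: numeral_2_eq_2 power_mult_distrib power2_eq_square)
  finally have "norm (iexp x - 1 - \<i> * x + x\<^sup>2 / 2) \<le> \<bar>x\<bar> ^ 3 / 2"
    by (simp add: algebra_simps)
  then show ?thesis by (rule order_trans) simp
qed

lemma exp_minus_linear_bound:
  fixes u :: real
  assumes "0 \<le> u"
  shows "\<bar>exp (- u) - 1 + u\<bar> \<le> u\<^sup>2"
proof -
  have "exp (- u) \<le> 1 / (1 + u)"
    using exp_ge_add_one_self[of u] assms by (simp add: exp_minus divide_simps)
  also have "\<dots> \<le> 1 - u + u\<^sup>2"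
  proof -
    \<comment> \<open>The product equals \<open>1 + u ^ 3\<close>.\<close>
    have "1 \<le> (1 - u + u\<^sup>2) * (1 + u)" using assms by (simp add: algebra_simps power2_eq_square)
    then show ?thesis using assms by (simp add: divide_le_eq)
  qed
  finally show ?thesis using exp_ge_add_one_self[of "- u"] by linarith
qed

lemma (in finite_measure_subalgebra) integrable_bounded_mult:
  fixes \<Theta> :: "'a \<Rightarrow> 'b::{banach,second_countable_topology,real_normed_algebra}"
  assumes [measurable]: "\<Theta> \<in> borel_measurable M" and bnd: "AE x in M. norm (\<Theta> x) \<le> B" and g: "integrable M g"
  shows "integrable M (\<lambda>x. \<Theta> x * g x)"
proof (rule Bochner_Integration.integrable_bound)
  show "integrable M (\<lambda>x. B * norm (g x))" using g by simp
  show "AE x in M. norm (\<Theta> x * g x) \<le> norm (B * norm (g x))"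
    using bnd by eventually_elim
      (auto intro!: order_trans[OF norm_mult_ineq] mult_mono simp: abs_mult)
qed (use borel_measurable_integrable[OF g] in measurable)

text \<open>Real and imaginary part of \<open>\<Theta>\<close> are bounded by its norm, so the real
  pull-out rule applies to each of them.\<close>

lemma (in finite_measure_subalgebra) integral_complex_cond_exp:
  fixes \<Theta> :: "'a \<Rightarrow> complex"
  assumes \<Theta>: "\<Theta> \<in> borel_measurable F" and bnd: "AE x in M. norm (\<Theta> x) \<le> B" and g: "integrable M g"
  shows "(\<integral>x. \<Theta> x * of_real (g x) \<partial>M) = (\<integral>x. \<Theta> x * of_real (real_cond_exp M F g x) \<partial>M)"
proof -
  have [measurable]: "\<Theta> \<in> borel_measurable M" by (rule measurable_from_subalg[OF subalg \<Theta>])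
  have [measurable]: "g \<in> borel_measurable M" using g by simp
  have int: "integrable M (\<lambda>x. \<Theta> x * of_real (f x))" if "integrable M f" for f
    by (rule integrable_bounded_mult[OF _ bnd]) (use that in auto)
  have c: "integrable M (real_cond_exp M F g)" by (rule real_cond_exp_int(1)[OF g])
  have eq: "(\<integral>x. \<theta> x * real_cond_exp M F g x \<partial>M) = (\<integral>x. \<theta> x * g x \<partial>M)"
    if "\<theta> \<in> borel_measurable F" "AE x in M. \<bar>\<theta> x\<bar> \<le> B" for \<theta>
  proof -
    have "\<theta> \<in> borel_measurable M" by (rule measurable_from_subalg[OF subalg that(1)])
    then have "integrable M (\<lambda>x. \<theta> x * g x)"
      using integrable_bounded_mult[of \<theta> B g] that g by simp
    from real_cond_exp_intg(2)[OF this that(1)] show ?thesis by simp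
  qed
  have re: "AE x in M. \<bar>Re (\<Theta> x)\<bar> \<le> B" "AE x in M. \<bar>Im (\<Theta> x)\<bar> \<le> B"
    by (rule AE_mp[OF bnd], rule AE_I2, use abs_Re_le_cmod abs_Im_le_cmod order_trans in blast)+
  have "Re (\<integral>x. \<Theta> x * of_real (g x) \<partial>M) = Re (\<integral>x. \<Theta> x * of_real (real_cond_exp M F g x) \<partial>M)"
    using eq[of "\<lambda>x. Re (\<Theta> x)"] re \<Theta> int[OF g] int[OF c] by (simp flip: integral_Re)
  moreover have "Im (\<integral>x. \<Theta> x * of_real (g x) \<partial>M) = Im (\<integral>x. \<Theta> x * of_real (real_cond_exp M F g x) \<partial>M)"
    using eq[of "\<lambda>x. Im (\<Theta> x)"] re \<Theta> int[OF g] int[OF c] by (simp flip: integral_Im)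
  ultimately show ?thesis by (rule complex_eqI)
qed

lemma (in finite_measure_subalgebra) cond_square_bounds:
  assumes [measurable]: "\<xi> \<in> borel_measurable M" and b: "AE x in M. \<bar>\<xi> x\<bar> \<le> b"
  shows "AE x in M. 0 \<le> real_cond_exp M F (\<lambda>x. (\<xi> x)\<^sup>2) x \<and> real_cond_exp M F (\<lambda>x. (\<xi> x)\<^sup>2) x \<le> b\<^sup>2"
proof -
  have le: "AE x in M. (\<xi> x)\<^sup>2 \<le> b\<^sup>2" using b by eventually_elim (simp add: square_le_of_abs_le)
  have "integrable M (\<lambda>x. (\<xi> x)\<^sup>2)"
    by (rule integrable_const_bound[where B="b\<^sup>2"]) (use le in auto)
  from real_cond_exp_le_c[OF this le] real_cond_exp_ge_c[OF this, of 0] show ?thesis by auto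
qed

text \<open>Both exponentials are expanded to second order. The linear term drops out by the
  martingale property, and \<open>\<xi>\<^sup>2 / 2\<close> cancels against \<open>v / 2\<close>
  under the integral because the factor \<open>\<Theta>\<close> is \<open>F\<close>-measurable. Only
  the Taylor remainders survive, of size \<open>b ^ 3\<close> for the imaginary and
  \<open>b ^ 4\<close> for the real exponential.\<close>

lemma (in finite_measure_subalgebra) char_step_bound:
  fixes \<Theta> :: "'a \<Rightarrow> complex" and \<xi> :: "'a \<Rightarrow> real"
  assumes prob: "prob_space M"
    and \<Theta>: "\<Theta> \<in> borel_measurable F" and bnd: "AE x in M. norm (\<Theta> x) \<le> B" and B: "0 \<le> B"
    and \<xi>[measurable]: "\<xi> \<in> borel_measurable M" and b: "AE x in M. \<bar>\<xi> x\<bar> \<le> b"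
    and mds: "AE x in M. real_cond_exp M F \<xi> x = 0"
  defines "v \<equiv> real_cond_exp M F (\<lambda>x. (\<xi> x)\<^sup>2)"
  shows "norm (\<integral>x. \<Theta> x * (iexp (\<xi> x) - exp (- of_real (v x) / 2)) \<partial>M) \<le> B * (b ^ 3 + b ^ 4)"
proof -
  interpret prob_space M by fact
  have [measurable]: "\<Theta> \<in> borel_measurable M" by (rule measurable_from_subalg[OF subalg \<Theta>])
  have [measurable]: "v \<in> borel_measurable M" unfolding v_def by (rule borel_measurable_cond_exp2)
  have v: "AE x in M. 0 \<le> v x \<and> v x \<le> b\<^sup>2" unfolding v_def by (rule cond_square_bounds[OF \<xi> b])
  have int\<xi>: "integrable M \<xi>" by (rule integrable_const_bound[where B=b]) (use b in auto)
  have int\<xi>2: "integrable M (\<lambda>x. (\<xi> x)\<^sup>2)"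
  proof (rule integrable_const_bound[where B="b\<^sup>2"])
    show "AE x in M. norm ((\<xi> x)\<^sup>2) \<le> b\<^sup>2"
      using b by eventually_elim (simp add: square_le_of_abs_le)
  qed simp
  have intv: "integrable M v" unfolding v_def by (rule real_cond_exp_int(1)[OF int\<xi>2])
  have int: "integrable M (\<lambda>x. \<Theta> x * of_real (f x))" if "integrable M f" for f
    by (rule integrable_bounded_mult[OF _ bnd]) (use that in auto)
  define R where "R x = \<Theta> x * ((iexp (\<xi> x) - 1 - \<i> * \<xi> x + (\<xi> x)\<^sup>2 / 2) - of_real (exp (- v x / 2) - 1 + v x / 2))" for x
  have [measurable]: "R \<in> borel_measurable M" unfolding R_def by measurable
  have R: "AE x in M. norm (R x) \<le> B * (b ^ 3 + b ^ 4)"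
    using bnd b v
  proof eventually_elim
    case (elim x)
    have "norm (iexp (\<xi> x) - 1 - \<i> * \<xi> x + (\<xi> x)\<^sup>2 / 2) \<le> b ^ 3"
      using iexp_quadratic_bound[of "\<xi> x"] power_mono[OF elim(2), of 3] by simp
    moreover have "norm (of_real (exp (- v x / 2) - 1 + v x / 2) :: complex) \<le> b ^ 4"
    proof -
      have "\<bar>exp (- (v x / 2)) - 1 + v x / 2\<bar> \<le> (v x / 2)\<^sup>2" using elim by (intro exp_minus_linear_bound) simp
      also have "\<dots> \<le> (b\<^sup>2)\<^sup>2" using elim by (intro power_mono) auto
      finally show ?thesis by (simp only: norm_of_real) (simp flip: power_mult)
    qed
    ultimately have "norm ((iexp (\<xi> x) - 1 - \<i> * \<xi> x + (\<xi> x)\<^sup>2 / 2) - of_real (exp (- v x / 2) - 1 + v x / 2)) \<le> b ^ 3 + b ^ 4"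
      by (intro order_trans[OF norm_triangle_ineq4] add_mono)
    then show ?case unfolding R_def norm_mult using elim B by (intro mult_mono) auto
  qed
  have intR: "integrable M R" by (rule integrable_const_bound[OF R]) simp
  have "(\<integral>x. \<Theta> x * (iexp (\<xi> x) - exp (- of_real (v x) / 2)) \<partial>M)
     = (\<integral>x. R x + \<i> * (\<Theta> x * of_real (\<xi> x)) - (\<Theta> x * of_real ((\<xi> x)\<^sup>2)) / 2 + (\<Theta> x * of_real (v x)) / 2 \<partial>M)"
    by (rule Bochner_Integration.integral_cong) (simp_all add: R_def exp_of_real[symmetric] algebra_simps)
  also have "\<dots> = (\<integral>x. R x \<partial>M) + \<i> * (\<integral>x. \<Theta> x * of_real (\<xi> x) \<partial>M)
      - (\<integral>x. \<Theta> x * of_real ((\<xi> x)\<^sup>2) \<partial>M) / 2 + (\<integral>x. \<Theta> x * of_real (v x) \<partial>M) / 2"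
    using intR int[OF int\<xi>] int[OF int\<xi>2] int[OF intv] by (simp del: of_real_power)
  also have "(\<integral>x. \<Theta> x * of_real (\<xi> x) \<partial>M) = 0"
  proof -
    have "(\<integral>x. \<Theta> x * of_real (\<xi> x) \<partial>M) = (\<integral>x. \<Theta> x * of_real (real_cond_exp M F \<xi> x) \<partial>M)"
      by (rule integral_complex_cond_exp[OF \<Theta> bnd int\<xi>])
    also have "\<dots> = (\<integral>x. 0 \<partial>M)" by (rule integral_cong_AE) (use mds in auto)
    finally show ?thesis by simp
  qed
  also have "(\<integral>x. \<Theta> x * of_real ((\<xi> x)\<^sup>2) \<partial>M) = (\<integral>x. \<Theta> x * of_real (v x) \<partial>M)"
    unfolding v_def by (rule integral_complex_cond_exp[OF \<Theta> bnd int\<xi>2])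
  finally have "(\<integral>x. \<Theta> x * (iexp (\<xi> x) - exp (- of_real (v x) / 2)) \<partial>M) = (\<integral>x. R x \<partial>M)" by simp
  also have "norm \<dots> \<le> (\<integral>x. norm (R x) \<partial>M)" by (rule integral_norm_bound)
  also have "\<dots> \<le> (\<integral>x. B * (b ^ 3 + b ^ 4) \<partial>M)"
    by (rule integral_mono_AE) (use intR R in auto)
  finally show ?thesis by (simp add: prob_space)
qed

section \<open>Filtrations and the sigma-algebra they generate\<close>

locale filtered_prob_space = prob_space M for M :: "'a measure" +
  fixes G :: "nat \<Rightarrow> 'a measure"
  assumes subalgebra: "\<And>k. subalgebra M (G k)"
    and filtration: "\<And>k l. k \<le> l \<Longrightarrow> sets (G k) \<subseteq> sets (G l)"
begin

abbreviation "cexp k \<equiv> real_cond_exp M (G k)"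

lemma fms: "finite_measure_subalgebra M (G k)"
  by unfold_locales (rule subalgebra)

lemma space_G: "space (G k) = space M"
  using subalgebra[of k] by (simp add: subalgebra_def)

lemma measurable_G_mono: "f \<in> measurable (G k) N \<Longrightarrow> k \<le> l \<Longrightarrow> f \<in> measurable (G l) N"
  using filtration[of k l] by (auto simp: measurable_def space_G)

lemma measurable_G: "f \<in> measurable (G k) N \<Longrightarrow> f \<in> measurable M N"
  by (rule measurable_from_subalg[OF subalgebra])

definition G_infty :: "'a measure" where
  "G_infty = sigma (space M) (\<Union>k. sets (G k))"

lemma union_G_Pow: "(\<Union>k. sets (G k)) \<subseteq> Pow (space M)"
proof -
  have "A \<subseteq> space M" if "A \<in> sets (G k)" for A k
    using sets.sets_into_space[OF that] by (simp add: space_G)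
  then show ?thesis by blast
qed

lemma sets_G_infty: "sets G_infty = sigma_sets (space M) (\<Union>k. sets (G k))"
  unfolding G_infty_def using union_G_Pow by simp

lemma space_G_infty: "space G_infty = space M"
  unfolding G_infty_def using union_G_Pow by simp

lemma subalgebra_G_infty: "subalgebra M G_infty"
proof -
  have "(\<Union>k. sets (G k)) \<subseteq> sets M" using subalgebra by (auto simp: subalgebra_def)
  then have "sigma_sets (space M) (\<Union>k. sets (G k)) \<subseteq> sets M" by (rule sets.sigma_sets_subset)
  then show ?thesis by (simp add: subalgebra_def space_G_infty sets_G_infty)
qed

lemma fms_infty: "finite_measure_subalgebra M G_infty"
  by unfold_locales (rule subalgebra_G_infty)

lemma measurable_G_infty: "f \<in> measurable (G k) N \<Longrightarrow> f \<in> measurable G_infty N"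
  by (auto simp: measurable_def space_G space_G_infty sets_G_infty)

text \<open>
  Dynkin's theorem carries the hypothesis over to \<open>G_infty\<close>; a general \<open>g\<close> is then replaced by its
  conditional expectation.
\<close>

lemma weak_null_from_filtration:
  fixes h :: "nat \<Rightarrow> 'a \<Rightarrow> complex"
  assumes h[measurable]: "\<And>n. h n \<in> borel_measurable G_infty"
    and bnd: "\<And>n. AE x in M. norm (h n x) \<le> B"
    and null: "\<And>k A. A \<in> sets (G k) \<Longrightarrow> (\<lambda>n. \<integral>x. of_real (indicator A x) * h n x \<partial>M) \<longlonglongrightarrow> 0"
    and g: "integrable M g"
  shows "(\<lambda>n. \<integral>x. of_real (g x) * h n x \<partial>M) \<longlonglongrightarrow> 0"
proof -
  interpret I: finite_measure_subalgebra M G_infty by (rule fms_infty)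
  have [measurable]: "h n \<in> borel_measurable M" for n by (rule measurable_from_subalg[OF subalgebra_G_infty h])
  have B: "0 \<le> B"
  proof -
    have "AE x in M. 0 \<le> B" using bnd[of 0] by eventually_elim (use norm_ge_zero order_trans in blast)
    then show ?thesis by simp
  qed
  have int: "integrable M (\<lambda>x. of_real (f x) * h n x)" if "integrable M f" for f n
    using I.integrable_bounded_mult[OF _ bnd, of n "\<lambda>x. of_real (f x)"] that by (simp add: mult.commute)
  have est: "norm (\<integral>x. of_real (f x) * h n x \<partial>M) \<le> B * (\<integral>x. \<bar>f x\<bar> \<partial>M)" if f: "integrable M f" for f n
  proof -
    have "norm (\<integral>x. of_real (f x) * h n x \<partial>M) \<le> (\<integral>x. norm (of_real (f x) * h n x) \<partial>M)" by (rule integral_norm_bound)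
    also have "\<dots> \<le> (\<integral>x. B * \<bar>f x\<bar> \<partial>M)"
    proof (rule integral_mono_AE)
      show "AE x in M. norm (of_real (f x) * h n x) \<le> B * \<bar>f x\<bar>"
        using bnd[of n] by eventually_elim (simp add: norm_mult mult.commute[of B] mult_left_mono)
    qed (use int[OF f] f in auto)
    finally show ?thesis by simp
  qed
  \<comment> \<open>By \<open>est\<close> the functionals are uniformly bounded in the L1 norm, so
    the integrands with vanishing limit form an L1-closed set.\<close>
  have approx: "(\<lambda>n. \<integral>x. of_real (f x) * h n x \<partial>M) \<longlonglongrightarrow> 0"
    if f: "integrable M f" and s: "\<And>i. integrable M (s i)"
      and lim: "(\<lambda>i. \<integral>x. \<bar>f x - s i x\<bar> \<partial>M) \<longlonglongrightarrow> 0"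
      and null_s: "\<And>i. (\<lambda>n. \<integral>x. of_real (s i x) * h n x \<partial>M) \<longlonglongrightarrow> 0" for f and s :: "nat \<Rightarrow> 'a \<Rightarrow> real"
  proof (rule LIMSEQ_I)
    fix e :: real assume e: "0 < e"
    have "(\<lambda>i. B * (\<integral>x. \<bar>f x - s i x\<bar> \<partial>M)) \<longlonglongrightarrow> 0" using tendsto_mult_right_zero[OF lim] .
    then have "\<forall>\<^sub>F i in sequentially. B * (\<integral>x. \<bar>f x - s i x\<bar> \<partial>M) < e / 2"
      by (rule order_tendstoD) (use e in simp)
    then obtain i where i: "B * (\<integral>x. \<bar>f x - s i x\<bar> \<partial>M) < e / 2" by (auto simp: eventually_sequentially)
    obtain no where no: "\<And>n. n \<ge> no \<Longrightarrow> norm (\<integral>x. of_real (s i x) * h n x \<partial>M) < e / 2"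
      using LIMSEQ_D[OF null_s[of i], of "e / 2"] e by auto
    have "norm (\<integral>x. of_real (f x) * h n x \<partial>M) < e" if "n \<ge> no" for n
    proof -
      have "(\<integral>x. of_real (f x) * h n x \<partial>M) = (\<integral>x. of_real (s i x) * h n x + of_real (f x - s i x) * h n x \<partial>M)"
        by (simp add: algebra_simps)
      also have "\<dots> = (\<integral>x. of_real (s i x) * h n x \<partial>M) + (\<integral>x. of_real (f x - s i x) * h n x \<partial>M)"
        using int[OF s[of i], of n] int[of "\<lambda>x. f x - s i x" n] f s by (intro Bochner_Integration.integral_add) auto
      finally show ?thesis
        using no[OF that] est[of "\<lambda>x. f x - s i x" n] f s i
          norm_triangle_ineq[of "(\<integral>x. of_real (s i x) * h n x \<partial>M)" "(\<integral>x. of_real (f x - s i x) * h n x \<partial>M)"]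
        by fastforce
    qed
    then show "\<exists>no. \<forall>n\<ge>no. norm ((\<integral>x. of_real (f x) * h n x \<partial>M) - 0) < e" by auto
  qed
  have sets: "(\<lambda>n. \<integral>x. of_real (indicator A x) * h n x \<partial>M) \<longlonglongrightarrow> 0" if A: "A \<in> sets G_infty" for A
  proof -
    have "Int_stable (\<Union>k. sets (G k))"
    proof (rule Int_stableI)
      fix A B assume "A \<in> (\<Union>k. sets (G k))" "B \<in> (\<Union>k. sets (G k))"
      then obtain k l where "A \<in> sets (G k)" "B \<in> sets (G l)" by blast
      then have "A \<in> sets (G (max k l))" "B \<in> sets (G (max k l))"
        using filtration[of k "max k l"] filtration[of l "max k l"] by auto
      then show "A \<inter> B \<in> (\<Union>k. sets (G k))" by blast
    qed
    from this union_G_Pow A[unfolded sets_G_infty] show ?thesis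
    proof (induction rule: sigma_sets_induct_disjoint)
      case (basic A)
      then show ?case using null by blast
    next
      case empty
      show ?case by simp
    next
      case (compl A)
      have [measurable]: "A \<in> sets M" using compl(1) subalgebra_G_infty unfolding subalgebra_def sets_G_infty by blast
      have "(\<integral>x. of_real (indicator (space M - A) x) * h n x \<partial>M)
         = (\<integral>x. of_real (indicator (space M) x) * h n x \<partial>M) - (\<integral>x. of_real (indicator A x) * h n x \<partial>M)" for n
      proof -
        have "(\<integral>x. of_real (indicator (space M - A) x) * h n x \<partial>M)
          = (\<integral>x. of_real (indicator (space M) x) * h n x - of_real (indicator A x) * h n x \<partial>M)"
          by (rule Bochner_Integration.integral_cong) (auto simp: indicator_def)
        also have "\<dots> = (\<integral>x. of_real (indicator (space M) x) * h n x \<partial>M) - (\<integral>x. of_real (indicator A x) * h n x \<partial>M)"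
          by (intro Bochner_Integration.integral_diff int integrable_const_bound[where B=1]) auto
        finally show ?thesis .
      qed
      moreover have "space M \<in> sets (G 0)" using sets.top[of "G 0"] by (simp add: space_G)
      ultimately show ?case using tendsto_diff[OF null[of "space M" 0] compl(2)] by simp
    next
      case (union A)
      have A[measurable]: "A i \<in> sets M" for i
        using union(2) subalgebra_G_infty unfolding subalgebra_def sets_G_infty by blast
      have intA: "integrable M (\<lambda>x. indicator S x :: real)" if [measurable]: "S \<in> sets M" for S
        by (intro integrable_const_bound[where B=1]) auto
      \<comment> \<open>Finite unions, for which the claim follows by adding finitely many terms,
        approximate the countable union in L1.\<close>
      define s where "s i = (\<lambda>x. indicator (\<Union>j<i. A j) x :: real)" for i :: nat
      show ?case
      proof (rule approx[of _ s])
        show "integrable M (\<lambda>x. indicator (\<Union>i. A i) x :: real)" "\<And>i. integrable M (s i)"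
          unfolding s_def by (intro intA; measurable)+
        have "(\<lambda>i. \<integral>x. \<bar>indicator (\<Union>i. A i) x - s i x\<bar> \<partial>M) \<longlonglongrightarrow> (\<integral>x. 0 \<partial>M)"
        proof (rule integral_dominated_convergence[where w = "\<lambda>x. 1"])
          show "AE x in M. (\<lambda>i. \<bar>indicator (\<Union>i. A i) x - s i x\<bar>) \<longlonglongrightarrow> 0"
          proof (rule AE_I2)
            fix x
            show "(\<lambda>i. \<bar>indicator (\<Union>i. A i) x - s i x\<bar>) \<longlonglongrightarrow> 0"
            proof (cases "x \<in> (\<Union>i. A i)")
              case True
              then obtain k where k: "x \<in> A k" by blast
              have "\<forall>\<^sub>F i in sequentially. \<bar>indicator (\<Union>i. A i) x - s i x\<bar> = 0"
                using eventually_gt_at_top[of k] by eventually_elim (use k in \<open>auto simp: s_def indicator_def\<close>)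
              then show ?thesis by (rule tendsto_eventually)
            next
              case False
              then show ?thesis by (simp add: s_def indicator_def)
            qed
          qed
          show "AE x in M. norm \<bar>indicator (\<Union>i. A i) x - s i x\<bar> \<le> 1" for i
            by (rule AE_I2) (auto simp: s_def indicator_def)
        qed (auto simp: s_def)
        then show "(\<lambda>i. \<integral>x. \<bar>indicator (\<Union>i. A i) x - s i x\<bar> \<partial>M) \<longlonglongrightarrow> 0" by simp
        fix i
        have "(\<integral>x. of_real (s i x) * h n x \<partial>M) = (\<Sum>j<i. \<integral>x. of_real (indicator (A j) x) * h n x \<partial>M)" for n
        proof -
          have "of_real (s i x) * h n x = (\<Sum>j<i. of_real (indicator (A j) x) * h n x)" for x
          proof -
            have "disjoint_family_on A {..<i}" using union(1) by (auto simp: disjoint_family_on_def)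
            then have "s i x = (\<Sum>j<i. indicator (A j) x)" unfolding s_def by (subst indicator_UN_disjoint) auto
            then show ?thesis by (simp add: sum_distrib_right)
          qed
          then show ?thesis by (simp add: int intA)
        qed
        moreover have "(\<lambda>n. \<Sum>j<i. \<integral>x. of_real (indicator (A j) x) * h n x \<partial>M) \<longlonglongrightarrow> (\<Sum>j<i. 0)"
          by (intro tendsto_sum union)
        ultimately show "(\<lambda>n. \<integral>x. of_real (s i x) * h n x \<partial>M) \<longlonglongrightarrow> 0" by simp
      qed
    qed
  qed
  have integrables: "(\<lambda>n. \<integral>x. of_real (f x) * h n x \<partial>M) \<longlonglongrightarrow> 0" if f: "integrable (restr_to_subalg M G_infty) f" for f :: "'a \<Rightarrow> real"
    using f
  proof (induction rule: integrable_induct)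
    case (base A c)
    then have "A \<in> sets G_infty" by (simp add: sets_restr_to_subalg[OF subalgebra_G_infty])
    from tendsto_mult_right_zero[OF sets[OF this], of "of_real c"] show ?case
      by (simp add: mult_ac flip: integral_mult_right_zero)
  next
    case (add f g)
    have "integrable M f" "integrable M g"
      using add(1,2) integrable_from_subalg[OF subalgebra_G_infty] by auto
    then show ?case using tendsto_add[OF add(3,4)] int by (simp add: distrib_right)
  next
    case (lim f s)
    have f: "integrable M f" and s: "integrable M (s i)" for i
      using lim(1,4) integrable_from_subalg[OF subalgebra_G_infty] by auto
    have [measurable]: "f \<in> borel_measurable M" "s i \<in> borel_measurable M" for i using f s by auto
    have sp: "space (restr_to_subalg M G_infty) = space M" by (rule space_restr_to_subalg)
    show ?case
    proof (rule approx[OF f s _ lim(5)])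
      have "(\<lambda>i. \<integral>x. \<bar>f x - s i x\<bar> \<partial>M) \<longlonglongrightarrow> (\<integral>x. 0 \<partial>M)"
      proof (rule integral_dominated_convergence[where w = "\<lambda>x. 3 * \<bar>f x\<bar>"])
        show "AE x in M. (\<lambda>i. \<bar>f x - s i x\<bar>) \<longlonglongrightarrow> 0"
        proof (rule AE_I2)
          fix x assume "x \<in> space M"
          then have "(\<lambda>i. s i x) \<longlonglongrightarrow> f x" using lim(2) sp by simp
          from tendsto_rabs[OF tendsto_diff[OF tendsto_const[of "f x"] this]]
          show "(\<lambda>i. \<bar>f x - s i x\<bar>) \<longlonglongrightarrow> 0" by simp
        qed
        show "AE x in M. norm \<bar>f x - s i x\<bar> \<le> 3 * \<bar>f x\<bar>" for i
        proof (rule AE_I2)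
          fix x assume "x \<in> space M"
          then have "\<bar>s i x\<bar> \<le> 2 * \<bar>f x\<bar>" using lim(3)[of x i] sp by simp
          then show "norm \<bar>f x - s i x\<bar> \<le> 3 * \<bar>f x\<bar>" by simp
        qed
      qed (use f in auto)
      then show "(\<lambda>i. \<integral>x. \<bar>f x - s i x\<bar> \<partial>M) \<longlonglongrightarrow> 0" by simp
    qed
  qed
  have "integrable (restr_to_subalg M G_infty) (real_cond_exp M G_infty g)"
    by (intro integrable_in_subalg[OF subalgebra_G_infty] I.real_cond_exp_int(1)[OF g]) simp
  from integrables[OF this]
  have "(\<lambda>n. \<integral>x. h n x * of_real (real_cond_exp M G_infty g x) \<partial>M) \<longlonglongrightarrow> 0" by (simp add: mult.commute)
  then show ?thesis
    by (simp add: I.integral_complex_cond_exp[OF h bnd g, symmetric] mult.commute)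
qed

end

section \<open>Second moments and almost sure limits of martingales\<close>

lemma (in prob_space) AE_summable_of_summable_integral:
  fixes f :: "nat \<Rightarrow> 'a \<Rightarrow> real"
  assumes int: "\<And>i. integrable M (f i)" and nonneg: "\<And>i x. 0 \<le> f i x"
    and sum: "summable (\<lambda>i. \<integral>x. f i x \<partial>M)"
  shows "AE x in M. summable (\<lambda>i. f i x)"
proof -
  have [measurable]: "f i \<in> borel_measurable M" for i using int by simp
  have "(\<integral>\<^sup>+x. (\<Sum>i. ennreal (f i x)) \<partial>M) = (\<Sum>i. \<integral>\<^sup>+x. ennreal (f i x) \<partial>M)"
    by (rule nn_integral_suminf) simp
  also have "\<dots> = (\<Sum>i. ennreal (\<integral>x. f i x \<partial>M))"
    by (simp add: nn_integral_eq_integral int nonneg)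
  also have "\<dots> = ennreal (\<Sum>i. \<integral>x. f i x \<partial>M)"
    by (intro suminf_ennreal_eq summable_sums sum) (simp add: nonneg)
  finally have "(\<integral>\<^sup>+x. (\<Sum>i. ennreal (f i x)) \<partial>M) \<noteq> \<infinity>" by simp
  then have "AE x in M. (\<Sum>i. ennreal (f i x)) \<noteq> \<infinity>"
    by (intro nn_integral_PInf_AE) auto
  then show ?thesis
    by eventually_elim (auto intro!: summable_suminf_not_top nonneg)
qed

lemma (in prob_space) integral_abs_le_sqrt:
  fixes f :: "'a \<Rightarrow> real"
  assumes [measurable]: "f \<in> borel_measurable M" and sq: "integrable M (\<lambda>x. (f x)\<^sup>2)"
  shows "integrable M f" "(\<integral>x. \<bar>f x\<bar> \<partial>M) \<le> sqrt (\<integral>x. (f x)\<^sup>2 \<partial>M)"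
proof -
  show int: "integrable M f" using sq by (rule square_integrable_imp_integrable[rotated]) simp
  have "(\<integral>x. \<bar>f x\<bar> \<partial>M)\<^sup>2 \<le> (\<integral>x. (f x)\<^sup>2 \<partial>M)"
  proof -
    have "0 \<le> variance (\<lambda>x. \<bar>f x\<bar>)" by simp
    then show ?thesis using variance_eq[of "\<lambda>x. \<bar>f x\<bar>"] int sq by simp
  qed
  then show "(\<integral>x. \<bar>f x\<bar> \<partial>M) \<le> sqrt (\<integral>x. (f x)\<^sup>2 \<partial>M)"
    by (rule real_le_rsqrt)
qed

context filtered_prob_space
begin

lemma martingale_difference_sum_AE_bound:
  fixes d :: "nat \<Rightarrow> 'a \<Rightarrow> real"
  assumes "\<And>j. AE x in M. \<bar>d j x\<bar> \<le> \<beta> j" "finite J"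
  shows "AE x in M. \<bar>\<Sum>j\<in>J. d j x\<bar> \<le> (\<Sum>j\<in>J. \<beta> j)"
proof -
  have "AE x in M. \<forall>j. \<bar>d j x\<bar> \<le> \<beta> j" using assms(1) by (simp add: AE_all_countable)
  then show ?thesis by eventually_elim (auto intro!: order_trans[OF sum_abs] sum_mono)
qed

text \<open>Orthogonality: the partial sum before step \<open>q\<close> is
  \<open>G q\<close>-measurable, so its product with \<open>d q\<close> integrates to zero.\<close>

lemma martingale_difference_square_sum:
  fixes d :: "nat \<Rightarrow> 'a \<Rightarrow> real"
  assumes meas: "\<And>j. d j \<in> borel_measurable (G (Suc j))"
    and bnd: "\<And>j. AE x in M. \<bar>d j x\<bar> \<le> \<beta> j"
    and mds: "\<And>j. AE x in M. cexp j (d j) x = 0"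
  shows "integrable M (\<lambda>x. (\<Sum>j=p..<q. d j x)\<^sup>2)"
    and "(\<integral>x. (\<Sum>j=p..<q. d j x)\<^sup>2 \<partial>M) \<le> (\<Sum>j=p..<q. (\<beta> j)\<^sup>2)"
proof -
  have [measurable]: "d j \<in> borel_measurable M" for j by (rule measurable_G[OF meas])
  define S where "S q x = (\<Sum>j=p..<q. d j x)" for q x
  have [measurable]: "S q \<in> borel_measurable M" for q unfolding S_def by measurable
  have S_bnd: "AE x in M. \<bar>S q x\<bar> \<le> (\<Sum>j=p..<q. \<beta> j)" for q
    unfolding S_def using bnd by (rule martingale_difference_sum_AE_bound) simp
  have int2: "integrable M (\<lambda>x. (S q x)\<^sup>2)" for q
  proof (rule integrable_const_bound)
    show "AE x in M. norm ((S q x)\<^sup>2) \<le> (\<Sum>j=p..<q. \<beta> j)\<^sup>2"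
      using S_bnd[of q] by eventually_elim (simp add: square_le_of_abs_le)
  qed simp
  then show "integrable M (\<lambda>x. (\<Sum>j=p..<q. d j x)\<^sup>2)" by (simp add: S_def)
  have "(\<integral>x. (S q x)\<^sup>2 \<partial>M) \<le> (\<Sum>j=p..<q. (\<beta> j)\<^sup>2)"
  proof (induction q)
    case (Suc q)
    show ?case
    proof (cases "p \<le> q")
      case True
      interpret F: finite_measure_subalgebra M "G q" by (rule fms)
      have S_Suc: "S (Suc q) x = S q x + d q x" for x using True by (simp add: S_def)
      have int_d: "integrable M (d q)" by (rule integrable_const_bound[where B="\<beta> q"]) (use bnd in auto)
      have sq_d: "AE x in M. (d q x)\<^sup>2 \<le> (\<beta> q)\<^sup>2" using bnd[of q] by eventually_elim (simp add: square_le_of_abs_le)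
      have int_d2: "integrable M (\<lambda>x. (d q x)\<^sup>2)"
        by (rule integrable_const_bound[where B="(\<beta> q)\<^sup>2"]) (use sq_d in auto)
      have int_Sd: "integrable M (\<lambda>x. S q x * d q x)"
        by (rule F.integrable_bounded_mult[OF _ _ int_d]) (use S_bnd in auto)
      have "S q \<in> borel_measurable (G q)" unfolding S_def
        by (intro borel_measurable_sum measurable_G_mono[OF meas]) auto
      from F.real_cond_exp_intg(2)[OF int_Sd this]
      have "(\<integral>x. S q x * d q x \<partial>M) = (\<integral>x. S q x * cexp q (d q) x \<partial>M)" by simp
      also have "\<dots> = (\<integral>x. 0 \<partial>M)"
      proof (rule integral_cong_AE)
        show "AE x in M. S q x * cexp q (d q) x = 0" using mds[of q] by eventually_elim simp
      qed auto
      finally have cross: "(\<integral>x. S q x * d q x \<partial>M) = 0" by simp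
      have "(\<integral>x. (S (Suc q) x)\<^sup>2 \<partial>M) = (\<integral>x. (S q x)\<^sup>2 + 2 * (S q x * d q x) + (d q x)\<^sup>2 \<partial>M)"
        by (simp add: S_Suc power2_sum algebra_simps)
      also have "\<dots> = (\<integral>x. (S q x)\<^sup>2 \<partial>M) + (\<integral>x. (d q x)\<^sup>2 \<partial>M)"
        using int2 int_Sd int_d2 cross by simp
      also have "(\<integral>x. (d q x)\<^sup>2 \<partial>M) \<le> (\<integral>x. (\<beta> q)\<^sup>2 \<partial>M)"
        by (rule integral_mono_AE) (use int_d2 sq_d in auto)
      finally show ?thesis using Suc.IH True by (simp add: prob_space)
    qed (simp add: S_def)
  qed (simp add: S_def)
  then show "(\<integral>x. (\<Sum>j=p..<q. d j x)\<^sup>2 \<partial>M) \<le> (\<Sum>j=p..<q. (\<beta> j)\<^sup>2)" by (simp add: S_def)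
qed

text \<open>
  Here and in the law of large numbers the steps are uniformly small, so that convergence along the
  squares, which is a Borel-Cantelli matter, is enough.
\<close>

lemma martingale_difference_series_AE_convergent:
  fixes d :: "nat \<Rightarrow> 'a \<Rightarrow> real"
  assumes meas: "\<And>j. d j \<in> borel_measurable (G (Suc j))"
    and bnd: "\<And>j. AE x in M. \<bar>d j x\<bar> \<le> c / real (Suc j)"
    and mds: "\<And>j. AE x in M. cexp j (d j) x = 0"
  shows "AE x in M. convergent (\<lambda>n. \<Sum>j<n. d j x)"
proof -
  have [measurable]: "d j \<in> borel_measurable M" for j by (rule measurable_G[OF meas])
  \<comment> \<open>Blocks between consecutive squares. A block has \<open>2 * k + 1\<close>
    orthogonal terms of size at most \<open>\<bar>c\<bar> / (k\<^sup>2 + 1)\<close>, so its L1 norm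
    is of the summable order k^(-3/2).\<close>
  define D where "D k x = (\<Sum>j=k\<^sup>2..<(Suc k)\<^sup>2. d j x)" for k x
  have [measurable]: "D k \<in> borel_measurable M" for k unfolding D_def by measurable
  have D2: "integrable M (\<lambda>x. (D k x)\<^sup>2)" for k
    unfolding D_def by (rule martingale_difference_square_sum[OF meas bnd mds])
  have intD: "integrable M (D k)" for k by (rule integral_abs_le_sqrt[OF _ D2]) simp
  have ED: "(\<integral>x. \<bar>D k x\<bar> \<partial>M) \<le> \<bar>c\<bar> * (sqrt (real (2 * k + 1)) / real (Suc (k\<^sup>2)))" for k
  proof -
    have "(\<integral>x. (D k x)\<^sup>2 \<partial>M) \<le> (\<Sum>j=k\<^sup>2..<(Suc k)\<^sup>2. (c / real (Suc j))\<^sup>2)"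
      unfolding D_def by (rule martingale_difference_square_sum[OF meas bnd mds])
    also have "\<dots> \<le> (\<Sum>j=k\<^sup>2..<(Suc k)\<^sup>2. (\<bar>c\<bar> / real (Suc (k\<^sup>2)))\<^sup>2)"
    proof (intro sum_mono square_le_of_abs_le)
      fix j assume "j \<in> {k\<^sup>2..<(Suc k)\<^sup>2}"
      then show "\<bar>c / real (Suc j)\<bar> \<le> \<bar>c\<bar> / real (Suc (k\<^sup>2))"
        unfolding abs_divide by (intro frac_le) (auto intro: add_pos_nonneg)
    qed
    also have "\<dots> = real (2 * k + 1) * (\<bar>c\<bar> / real (Suc (k\<^sup>2)))\<^sup>2"
      by (simp add: power2_eq_square)
    finally have "sqrt (\<integral>x. (D k x)\<^sup>2 \<partial>M) \<le> sqrt (real (2 * k + 1) * (\<bar>c\<bar> / real (Suc (k\<^sup>2)))\<^sup>2)"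
      by (rule real_sqrt_le_mono)
    also have "\<dots> = \<bar>c\<bar> * (sqrt (real (2 * k + 1)) / real (Suc (k\<^sup>2)))"
      by (simp add: real_sqrt_mult abs_mult)
    finally show ?thesis using integral_abs_le_sqrt(2)[OF _ D2, of k] by simp
  qed
  have "summable (\<lambda>k. \<integral>x. \<bar>D k x\<bar> \<partial>M)"
  proof (rule summable_comparison_test')
    have "summable (\<lambda>k. sqrt (real (2 * k + 1)) / real (Suc (k\<^sup>2)))"
    proof (rule summable_comparison_test_bigo)
      show "summable (\<lambda>k. norm (real k powr (- 3 / 2)))" by (simp add: summable_real_powr_iff)
      show "(\<lambda>k. sqrt (real (2 * k + 1)) / real (Suc (k\<^sup>2))) \<in> O(\<lambda>k. real k powr (- 3 / 2))"
        by real_asymp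
    qed
    then show "summable (\<lambda>k. \<bar>c\<bar> * (sqrt (real (2 * k + 1)) / real (Suc (k\<^sup>2))))" by (rule summable_mult)
    show "norm (\<integral>x. \<bar>D k x\<bar> \<partial>M) \<le> \<bar>c\<bar> * (sqrt (real (2 * k + 1)) / real (Suc (k\<^sup>2)))" if "k \<ge> 0" for k
      using ED[of k] by simp
  qed
  then have "AE x in M. summable (\<lambda>k. \<bar>D k x\<bar>)"
    by (intro AE_summable_of_summable_integral) (use intD in auto)
  moreover have "AE x in M. \<forall>j. \<bar>d j x\<bar> \<le> c / real (Suc j)" using bnd by (simp add: AE_all_countable)
  ultimately show ?thesis
  proof eventually_elim
    case (elim x)
    have "(\<Sum>k<n. D k x) = (\<Sum>j<n\<^sup>2. d j x)" for n
    proof (induction n)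
      case (Suc n)
      have "(\<Sum>j<(Suc n)\<^sup>2. d j x) = (\<Sum>j<n\<^sup>2. d j x) + D n x"
        unfolding D_def lessThan_atLeast0 by (rule sum.atLeastLessThan_concat[symmetric]) (auto simp: power2_eq_square)
      then show ?case using Suc by simp
    qed simp
    moreover have "summable (\<lambda>k. D k x)" using elim(1) by (rule summable_rabs_cancel)
    ultimately have "(\<lambda>n. \<Sum>j<n\<^sup>2. d j x) \<longlonglongrightarrow> (\<Sum>k. D k x)"
      using summable_LIMSEQ by fastforce
    then have "(\<lambda>n. \<Sum>j<n. d j x) \<longlonglongrightarrow> (\<Sum>k. D k x)"
      by (rule tendsto_from_squares[where c=c, rotated]) (use elim(2) in simp)
    then show ?case by (rule convergentI)
  qed
qed

lemma martingale_difference_strong_law: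
  fixes d :: "nat \<Rightarrow> 'a \<Rightarrow> real"
  assumes meas: "\<And>j. d j \<in> borel_measurable (G (Suc j))"
    and bnd: "\<And>j. AE x in M. \<bar>d j x\<bar> \<le> c"
    and mds: "\<And>j. AE x in M. cexp j (d j) x = 0"
  shows "AE x in M. (\<lambda>n. (\<Sum>j<n. d j x) / real n) \<longlonglongrightarrow> 0"
proof -
  have [measurable]: "d j \<in> borel_measurable M" for j by (rule measurable_G[OF meas])
  define D where "D k x = (\<Sum>j=0..<k\<^sup>2. d j x)" for k x
  have [measurable]: "D k \<in> borel_measurable M" for k unfolding D_def by measurable
  have D2: "integrable M (\<lambda>x. (D k x)\<^sup>2)" for k
    unfolding D_def by (rule martingale_difference_square_sum[OF meas bnd mds])
  \<comment> \<open>The \<open>k\<^sup>2\<close> orthogonal terms give a second moment of at most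
    \<open>k\<^sup>2 * c\<^sup>2\<close>, which after division by \<open>k ^ 4\<close> is summable.
    At \<open>k = 0\<close> both sides are 0 through division by zero.\<close>
  have ED: "(\<integral>x. (D k x / real (k\<^sup>2))\<^sup>2 \<partial>M) \<le> c\<^sup>2 * (1 / (real k)\<^sup>2)" for k
  proof (cases "k = 0")
    case False
    have "(\<integral>x. (D k x)\<^sup>2 \<partial>M) \<le> (\<Sum>j=0..<k\<^sup>2. c\<^sup>2)"
      unfolding D_def by (rule martingale_difference_square_sum[OF meas bnd mds])
    then have "(\<integral>x. (D k x)\<^sup>2 \<partial>M) / (real (k\<^sup>2))\<^sup>2 \<le> real (k\<^sup>2) * c\<^sup>2 / (real (k\<^sup>2))\<^sup>2"
      by (intro divide_right_mono) auto
    then show ?thesis using False by (simp add: power_divide power2_eq_square[of "real k * real k"] power2_eq_square[of "real k"])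
  qed simp
  have "summable (\<lambda>k. \<integral>x. (D k x / real (k\<^sup>2))\<^sup>2 \<partial>M)"
  proof (rule summable_comparison_test')
    show "summable (\<lambda>k. c\<^sup>2 * (1 / (real k)\<^sup>2))"
      using inverse_power_summable[of 2, where 'a=real] by (intro summable_mult) (simp add: inverse_eq_divide)
    show "norm (\<integral>x. (D k x / real (k\<^sup>2))\<^sup>2 \<partial>M) \<le> c\<^sup>2 * (1 / (real k)\<^sup>2)" if "k \<ge> 0" for k
      using ED[of k] by simp
  qed
  then have "AE x in M. summable (\<lambda>k. (D k x / real (k\<^sup>2))\<^sup>2)"
    by (intro AE_summable_of_summable_integral) (use D2 in \<open>auto simp: power_divide\<close>)
  moreover have "AE x in M. \<forall>j. \<bar>d j x\<bar> \<le> c" using bnd by (simp add: AE_all_countable)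
  ultimately show ?thesis
  proof eventually_elim
    case (elim x)
    define y where "y n = (\<Sum>j<n. d j x) / real n" for n
    have "(\<lambda>k. (D k x / real (k\<^sup>2))\<^sup>2) \<longlonglongrightarrow> 0" by (rule summable_LIMSEQ_zero[OF elim(1)])
    then have "(\<lambda>k. sqrt ((D k x / real (k\<^sup>2))\<^sup>2)) \<longlonglongrightarrow> sqrt 0" by (rule tendsto_real_sqrt)
    then have "(\<lambda>k. y (k\<^sup>2)) \<longlonglongrightarrow> 0"
      by (simp only: real_sqrt_abs real_sqrt_zero tendsto_rabs_zero_iff y_def D_def lessThan_atLeast0)
    \<comment> \<open>The new mean differs from the old one by
      \<open>(d n x - y n) / (n + 1)\<close>, and both \<open>d n x\<close> and \<open>y n\<close>
      are at most \<open>c\<close> in absolute value. For \<open>n = 0\<close> division by zero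
      gives \<open>y 0 = 0\<close>.\<close>
    moreover have "\<bar>y (Suc n) - y n\<bar> \<le> 2 * c / real (Suc n)" for n
    proof -
      define T where "T = (\<Sum>j<n. d j x)"
      have T: "\<bar>T\<bar> \<le> real n * c"
        unfolding T_def using elim(2) sum_bounded_above[of "{..<n}" "\<lambda>j. \<bar>d j x\<bar>" c] by (auto intro!: order_trans[OF sum_abs])
      have "\<bar>T / real n\<bar> \<le> c"
      proof (cases "n = 0")
        case True
        then show ?thesis using elim(2)[rule_format, of 0] by simp
      next
        case False
        then show ?thesis using T by (simp add: abs_divide divide_le_eq mult.commute)
      qed
      moreover have "y (Suc n) - y n = (d n x - T / real n) / real (Suc n)"
        by (cases "n = 0") (simp_all add: y_def T_def[symmetric] field_simps)
      moreover have "\<bar>d n x\<bar> \<le> c" using elim(2) by blast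
      ultimately have "\<bar>d n x - T / real n\<bar> \<le> 2 * c" "\<bar>y (Suc n) - y n\<bar> = \<bar>d n x - T / real n\<bar> / real (Suc n)"
        by (linarith, simp add: abs_divide)
      then show ?thesis by (simp add: divide_right_mono)
    qed
    ultimately have "y \<longlonglongrightarrow> 0" by (rule tendsto_from_squares[rotated])
    then show ?case by (simp add: y_def[abs_def])
  qed
qed


text \<open>
  With \<open>T\<close> and \<open>V\<close> the partial sums of the array and of its conditional variances, \<open>exp (\<i> T + V / 2)\<close>
  has nearly constant integral against every event of a fixed stage of the filtration. Hence it
  converges weakly to \<open>1\<close>, and the factor \<open>exp (V / 2)\<close> can be removed since \<open>V\<close> converges.
\<close>

theorem martingale_array_stable_char:
  fixes \<xi> :: "nat \<Rightarrow> nat \<Rightarrow> 'a \<Rightarrow> real" and \<psi> :: "'a \<Rightarrow> real"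
  assumes meas: "\<And>n j. \<xi> n j \<in> borel_measurable (G (Suc j))"
    and bnd: "\<And>n j. AE x in M. \<bar>\<xi> n j x\<bar> \<le> b n j"
    and mds: "\<And>n j. AE x in M. cexp j (\<xi> n j) x = 0"
    and sq_sum: "\<And>n. (\<Sum>j<r n. (b n j)\<^sup>2) \<le> K"
    and small: "\<And>n j. b n j \<le> c n" "c \<longlonglongrightarrow> 0"
    and r: "filterlim r at_top sequentially"
    and variance: "AE x in M. (\<lambda>n. \<Sum>j<r n. cexp j (\<lambda>y. (\<xi> n j y)\<^sup>2) x) \<longlonglongrightarrow> \<eta> x"
    and \<eta>[measurable]: "\<eta> \<in> borel_measurable M"
    and \<psi>[measurable]: "\<psi> \<in> borel_measurable M" and \<psi>_bnd: "\<And>x. \<bar>\<psi> x\<bar> \<le> B"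
  shows "(\<lambda>n. \<integral>x. of_real (\<psi> x) * iexp (\<Sum>j<r n. \<xi> n j x) \<partial>M)
     \<longlonglongrightarrow> (\<integral>x. of_real (\<psi> x * exp (- \<eta> x / 2)) \<partial>M)"
proof -
  define v where "v n j = cexp j (\<lambda>y. (\<xi> n j y)\<^sup>2)" for n j
  define T where "T n k x = (\<Sum>j<k. \<xi> n j x)" for n k x
  define V where "V n k x = (\<Sum>j<k. v n j x)" for n k x
  define Q where "Q n k x = iexp (T n k x) * of_real (exp (V n k x / 2))" for n k x
  have \<xi>M[measurable]: "\<xi> n j \<in> borel_measurable M" for n j by (rule measurable_G[OF meas])
  have vG: "v n j \<in> borel_measurable (G j)" for n j unfolding v_def by simp
  have TG: "T n k \<in> borel_measurable (G k)" for n k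
    unfolding T_def by (intro borel_measurable_sum measurable_G_mono[OF meas]) auto
  \<comment> \<open>Predictability: \<open>V n (Suc l)\<close> uses only conditional variances known
    at time \<open>l\<close>.\<close>
  have VG: "V n k \<in> borel_measurable (G l)" if "k \<le> Suc l" for n k l
    unfolding V_def using that by (intro borel_measurable_sum measurable_G_mono[OF vG]) auto
  have QG: "Q n k \<in> borel_measurable (G k)" for n k
  proof -
    have [measurable]: "T n k \<in> borel_measurable (G k)" "V n k \<in> borel_measurable (G k)"
      using TG VG by auto
    show ?thesis unfolding Q_def by measurable
  qed
  have [measurable]: "T n k \<in> borel_measurable M" "V n k \<in> borel_measurable M" "Q n k \<in> borel_measurable M"
    "v n j \<in> borel_measurable M" for n k j
    using measurable_G[OF TG] measurable_G[OF VG[of k k n]] measurable_G[OF QG] measurable_G[OF vG] by auto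
  have b0: "0 \<le> b n j" for n j
  proof -
    have "AE x in M. 0 \<le> b n j" using bnd[of n j] by eventually_elim (use abs_ge_zero order_trans in blast)
    then show ?thesis by simp
  qed
  have c0: "0 \<le> c n" for n using small(1)[of n 0] b0[of n 0] by simp
  have B0: "0 \<le> B" using \<psi>_bnd[of undefined] by simp
  have K0: "0 \<le> K" using sq_sum[of 0] sum_nonneg[of "{..<r 0}" "\<lambda>j. (b 0 j)\<^sup>2"] by simp
  have all: "AE x in M. \<forall>n j. \<bar>\<xi> n j x\<bar> \<le> b n j \<and> 0 \<le> v n j x \<and> v n j x \<le> (b n j)\<^sup>2"
    unfolding v_def using bnd finite_measure_subalgebra.cond_square_bounds[OF fms \<xi>M bnd]
    by (simp add: AE_all_countable)
  \<comment> \<open>A deterministic bound, inherited from the bounds on the entries; it keeps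
    \<open>Q\<close> bounded along the whole row.\<close>
  have V_le: "AE x in M. \<forall>n k. k \<le> r n \<longrightarrow> 0 \<le> V n k x \<and> V n k x \<le> K"
    using all
  proof eventually_elim
    case (elim x)
    have "V n k x \<le> K" if "k \<le> r n" for n k
    proof -
      have "V n k x \<le> (\<Sum>j<k. (b n j)\<^sup>2)" unfolding V_def using elim by (intro sum_mono) auto
      also have "\<dots> \<le> (\<Sum>j<r n. (b n j)\<^sup>2)" using that by (intro sum_mono2) auto
      finally show ?thesis using sq_sum[of n] by simp
    qed
    then show ?case using elim unfolding V_def by (auto intro!: sum_nonneg)
  qed
  have normQ: "norm (Q n k x) = exp (V n k x / 2)" for n k x
    unfolding Q_def by (simp add: norm_mult)
  have Q_le: "AE x in M. norm (Q n k x) \<le> exp (K / 2)" if "k \<le> r n" for n k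
    using V_le by eventually_elim (use that in \<open>auto simp: normQ\<close>)
  have intQ: "integrable M (\<lambda>x. of_real (\<phi> x) * Q n k x)"
    if "k \<le> r n" and \<phi>: "integrable M \<phi>" for n k and \<phi> :: "'a \<Rightarrow> real"
    using finite_measure_subalgebra.integrable_bounded_mult[OF fms _ Q_le[OF that(1)], of "\<lambda>x. of_real (\<phi> x)"] \<phi>
    by (simp add: mult.commute)
  have ind: "integrable M (\<lambda>x. indicator A x :: real)" if "A \<in> sets M" for A
    using that by (intro integrable_const_bound[where B=1]) auto
  define J where "J A n k = (\<integral>x. of_real (indicator A x) * Q n k x \<partial>M)" for A n k
  have one_step: "norm (J A n (Suc k) - J A n k)
      \<le> exp (K / 2) * ((c n + (c n)\<^sup>2) * (b n k)\<^sup>2)"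
    if A: "A \<in> sets (G k)" and k: "k < r n" for A n k
  proof -
    interpret F: finite_measure_subalgebra M "G k" by (rule fms)
    have AM: "A \<in> sets M" using A subalgebra[of k] by (auto simp: subalgebra_def)
    \<comment> \<open>The factor \<open>exp (v n k x / 2)\<close> is moved into
      \<open>\<Theta>\<close>, so that the increment of \<open>Q\<close> takes the form treated in
      \<open>char_step_bound\<close>. The bound is not spoiled, as \<open>\<Theta>\<close> has norm
      at most \<open>exp (V n (Suc k) x / 2)\<close>.\<close>
    define \<Theta> where "\<Theta> x = of_real (indicator A x) * (Q n k x * of_real (exp (v n k x / 2)))" for x
    have "J A n (Suc k) - J A n k
       = (\<integral>x. of_real (indicator A x) * Q n (Suc k) x - of_real (indicator A x) * Q n k x \<partial>M)"
      unfolding J_def using k by (intro Bochner_Integration.integral_diff[symmetric] intQ ind AM) auto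
    also have "\<dots> = (\<integral>x. \<Theta> x * (iexp (\<xi> n k x) - exp (- of_real (v n k x) / 2)) \<partial>M)"
    proof (rule Bochner_Integration.integral_cong[OF refl])
      fix x
      have "Q n (Suc k) x = Q n k x * of_real (exp (v n k x / 2)) * iexp (\<xi> n k x)"
        unfolding Q_def T_def V_def by (simp add: distrib_left exp_add add_divide_distrib mult_ac)
      moreover have "Q n k x = Q n k x * of_real (exp (v n k x / 2)) * exp (- of_real (v n k x) / 2)"
        by (simp add: exp_of_real[symmetric] mult.assoc exp_add[symmetric])
      ultimately show "of_real (indicator A x) * Q n (Suc k) x - of_real (indicator A x) * Q n k x
         = \<Theta> x * (iexp (\<xi> n k x) - exp (- of_real (v n k x) / 2))"
        unfolding \<Theta>_def by (metis (no_types, lifting) mult.assoc right_diff_distrib)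
    qed
    also have "norm \<dots> \<le> exp (K / 2) * ((b n k) ^ 3 + (b n k) ^ 4)"
      unfolding v_def
    proof (rule F.char_step_bound[OF prob_space_axioms _ _ _ \<xi>M bnd mds])
      have [measurable]: "Q n k \<in> borel_measurable (G k)" "v n k \<in> borel_measurable (G k)" "A \<in> sets (G k)"
        using QG vG A by auto
      show "\<Theta> \<in> borel_measurable (G k)" unfolding \<Theta>_def by measurable
      show "AE x in M. norm (\<Theta> x) \<le> exp (K / 2)"
        using V_le
      proof eventually_elim
        case (elim x)
        have "norm (\<Theta> x) \<le> exp (V n k x / 2) * exp (v n k x / 2)"
          unfolding \<Theta>_def by (auto simp: norm_mult normQ indicator_def)
        also have "\<dots> = exp (V n (Suc k) x / 2)" by (simp add: V_def exp_add[symmetric] add_divide_distrib)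
        also have "\<dots> \<le> exp (K / 2)" using elim k by simp
        finally show ?case .
      qed
    qed simp
    \<comment> \<open>One square \<open>(b n k)\<^sup>2\<close> is kept for the summation over
      \<open>k\<close>, which \<open>K\<close> controls; the other factor tends to 0 uniformly in
      \<open>k\<close>.\<close>
    also have "(b n k) ^ 3 + (b n k) ^ 4 = (b n k + (b n k)\<^sup>2) * (b n k)\<^sup>2"
      by (simp add: power2_eq_square numeral_eq_Suc algebra_simps)
    also have "exp (K / 2) * \<dots> \<le> exp (K / 2) * ((c n + (c n)\<^sup>2) * (b n k)\<^sup>2)"
      using small(1)[of n k] b0[of n k] by (intro mult_left_mono mult_right_mono add_mono power_mono) auto
    finally show ?thesis .
  qed
  have r_ge: "\<forall>\<^sub>F n in sequentially. k \<le> r n" for k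
    using r by (simp add: filterlim_at_top)
  define h where "h n x = Q n (r n) x - 1" for n x
  have null: "(\<lambda>n. \<integral>x. of_real (indicator A x) * h n x \<partial>M) \<longlonglongrightarrow> 0" if A: "A \<in> sets (G k)" for A k
  proof -
    have AM: "A \<in> sets M" using A subalgebra[of k] by (auto simp: subalgebra_def)
    \<comment> \<open>An event of \<open>G k\<close> belongs to every later stage, so
      \<open>one_step\<close> applies from step \<open>k\<close> on.\<close>
    have tele: "norm (J A n l - J A n k)
      \<le> (\<Sum>j=k..<l. exp (K / 2) * ((c n + (c n)\<^sup>2) * (b n j)\<^sup>2))" if "k \<le> l" "l \<le> r n" for n l
      using that
    proof (induction l rule: dec_induct)
      case (step l)
      have "A \<in> sets (G l)" using A filtration[of k l] step by auto
      from this have "norm (J A n (Suc l) - J A n l)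
        \<le> exp (K / 2) * ((c n + (c n)\<^sup>2) * (b n l)\<^sup>2)" by (rule one_step) (use step in simp)
      from norm_triangle_le[OF add_mono[OF this step.IH]] show ?case using step by simp
    qed simp
    have first: "norm (J A n (r n) - J A n k)
      \<le> exp (K / 2) * ((c n + (c n)\<^sup>2) * K)" if "k \<le> r n" for n
    proof -
      have "(\<Sum>j=k..<r n. exp (K / 2) * ((c n + (c n)\<^sup>2) * (b n j)\<^sup>2))
          = exp (K / 2) * ((c n + (c n)\<^sup>2) * (\<Sum>j=k..<r n. (b n j)\<^sup>2))" by (simp add: sum_distrib_left)
      also have "\<dots> \<le> exp (K / 2) * ((c n + (c n)\<^sup>2) * (\<Sum>j<r n. (b n j)\<^sup>2))"
        using c0[of n] by (intro mult_left_mono sum_mono2) auto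
      also have "\<dots> \<le> exp (K / 2) * ((c n + (c n)\<^sup>2) * K)"
        using c0[of n] sq_sum[of n] by (intro mult_left_mono) auto
      finally show ?thesis using tele[OF that order_refl] by simp
    qed
    \<comment> \<open>The first \<open>k\<close> steps are estimated crudely: \<open>k\<close> is
      fixed while each entry is at most \<open>c n\<close>, so \<open>Q n k\<close> is uniformly
      close to 1.\<close>
    define w where "w n = (real k * c n + real k * (c n)\<^sup>2) * exp (K / 2)" for n
    have second: "norm (\<integral>x. of_real (indicator A x) * (Q n k x - 1) \<partial>M) \<le> w n" if k: "k \<le> r n" for n
    proof -
      have "norm (\<integral>x. of_real (indicator A x) * (Q n k x - 1) \<partial>M)
          \<le> (\<integral>x. norm (of_real (indicator A x) * (Q n k x - 1)) \<partial>M)" by (rule integral_norm_bound)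
      also have "\<dots> \<le> (\<integral>x. w n \<partial>M)"
      proof (rule integral_mono_AE)
        show "AE x in M. norm (of_real (indicator A x) * (Q n k x - 1)) \<le> w n"
          using all V_le
        proof eventually_elim
          case (elim x)
          define z where "z = \<i> * of_real (T n k x) + of_real (V n k x / 2)"
          have "Q n k x = exp z" unfolding Q_def z_def exp_add exp_of_real ..
          then have "norm (of_real (indicator A x) * (Q n k x - 1)) \<le> norm (exp z - 1)"
            by (simp add: norm_mult indicator_def)
          also have "\<dots> \<le> norm z * exp \<bar>Re z\<bar>" by (rule norm_exp_minus_one_le)
          also have "\<dots> \<le> (real k * c n + real k * (c n)\<^sup>2) * exp (K / 2)"
          proof (rule mult_mono)
            have "\<bar>T n k x\<bar> \<le> (\<Sum>j<k. c n)" unfolding T_def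
              by (rule order_trans[OF sum_abs], rule sum_mono) (use elim(1) small(1) order_trans in blast)
            moreover have "V n k x \<le> (\<Sum>j<k. (c n)\<^sup>2)" unfolding V_def
            proof (rule sum_mono)
              fix j
              have "(b n j)\<^sup>2 \<le> (c n)\<^sup>2" using small(1) b0 by (intro power_mono)
              then show "v n j x \<le> (c n)\<^sup>2" using elim(1) order_trans by blast
            qed
            moreover have "norm z \<le> \<bar>T n k x\<bar> + V n k x / 2" unfolding z_def
              using elim(2) k by (intro order_trans[OF norm_triangle_ineq]) (simp add: norm_mult del: of_real_divide)
            moreover have "0 \<le> V n k x" using elim(2) k by simp
            ultimately show "norm z \<le> real k * c n + real k * (c n)\<^sup>2" by simp
            show "exp \<bar>Re z\<bar> \<le> exp (K / 2)" using elim(2) k by (simp add: z_def)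
          qed (use c0[of n] in auto)
          finally show ?case unfolding w_def .
        qed
        have "integrable M (\<lambda>x. Q n k x - 1)"
          using intQ[OF k, of "\<lambda>x. 1"] by simp
        then show "integrable M (\<lambda>x. norm (of_real (indicator A x) * (Q n k x - 1)))"
          using integrable_mult_indicator[OF AM, of "\<lambda>x. Q n k x - 1"] by (simp add: scaleR_conv_of_real)
      qed simp
      finally show ?thesis by (simp add: prob_space)
    qed
    show ?thesis
    proof (rule Lim_null_comparison)
      show "\<forall>\<^sub>F n in sequentially. norm (\<integral>x. of_real (indicator A x) * h n x \<partial>M)
           \<le> exp (K / 2) * ((c n + (c n)\<^sup>2) * K) + w n"
        using r_ge[of k]
      proof eventually_elim
        case (elim n)
        have "(\<integral>x. of_real (indicator A x) * h n x \<partial>M)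
          = (\<integral>x. (of_real (indicator A x) * Q n (r n) x - of_real (indicator A x) * Q n k x)
                + of_real (indicator A x) * (Q n k x - 1) \<partial>M)"
          by (rule Bochner_Integration.integral_cong) (simp_all add: h_def algebra_simps)
        also have "\<dots> = (\<integral>x. of_real (indicator A x) * Q n (r n) x - of_real (indicator A x) * Q n k x \<partial>M)
             + (\<integral>x. of_real (indicator A x) * (Q n k x - 1) \<partial>M)"
          using intQ[OF order_refl ind[OF AM], of n] intQ[OF elim ind[OF AM]] ind[OF AM]
          by (intro Bochner_Integration.integral_add) (auto simp: right_diff_distrib)
        also have "(\<integral>x. of_real (indicator A x) * Q n (r n) x - of_real (indicator A x) * Q n k x \<partial>M)
           = J A n (r n) - J A n k"
          unfolding J_def by (intro Bochner_Integration.integral_diff intQ ind AM elim) auto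
        finally show ?case using norm_triangle_le[OF add_mono[OF first[OF elim] second[OF elim]]] by simp
      qed
      have "(\<lambda>n. exp (K / 2) * ((c n + (c n)\<^sup>2) * K) + w n) \<longlonglongrightarrow>
         exp (K / 2) * ((0 + 0\<^sup>2) * K) + (real k * 0 + real k * 0\<^sup>2) * exp (K / 2)"
        unfolding w_def by (intro tendsto_intros small)
      then show "(\<lambda>n. exp (K / 2) * ((c n + (c n)\<^sup>2) * K) + w n) \<longlonglongrightarrow> 0" by simp
    qed
  qed
  have h_le: "AE x in M. norm (h n x) \<le> exp (K / 2) + 1" for n
    using Q_le[of "r n" n, OF order_refl]
  proof eventually_elim
    case (elim x)
    then show ?case using norm_triangle_ineq4[of "Q n (r n) x" 1] by (simp add: h_def)
  qed
  have hG: "h n \<in> borel_measurable G_infty" for n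
  proof -
    have [measurable]: "Q n (r n) \<in> borel_measurable G_infty" by (rule measurable_G_infty[OF QG])
    show ?thesis unfolding h_def by measurable
  qed
  have \<eta>_le: "AE x in M. 0 \<le> \<eta> x \<and> \<eta> x \<le> K"
    using V_le variance
  proof eventually_elim
    case (elim x)
    then have lim: "(\<lambda>n. V n (r n) x) \<longlonglongrightarrow> \<eta> x" by (simp add: V_def v_def)
    show ?case using elim(1) by (auto intro!: LIMSEQ_le_const[OF lim] LIMSEQ_le_const2[OF lim])
  qed
  \<comment> \<open>Testing against \<open>\<psi>\<close> times \<open>exp (- \<eta> / 2)\<close>
    cancels the correction \<open>exp (V / 2)\<close> in the limit. Since \<open>\<eta>\<close> need
    not be measurable at any finite stage, the weak convergence is required against all integrable
    functions and not only against events of a stage.\<close>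
  define \<psi>' where "\<psi>' x = \<psi> x * exp (- \<eta> x / 2)" for x
  have [measurable]: "\<psi>' \<in> borel_measurable M" unfolding \<psi>'_def by measurable
  have "AE x in M. norm (\<psi>' x) \<le> B"
    using \<eta>_le
  proof eventually_elim
    case (elim x)
    then have "\<bar>\<psi> x\<bar> * exp (- \<eta> x / 2) \<le> B * 1" using \<psi>_bnd[of x] by (intro mult_mono) auto
    then show ?case by (simp add: \<psi>'_def abs_mult)
  qed
  then have int\<psi>': "integrable M \<psi>'" by (rule integrable_const_bound) simp
  have "(\<lambda>n. \<integral>x. of_real (\<psi>' x) * h n x \<partial>M) \<longlonglongrightarrow> 0"
    by (rule weak_null_from_filtration[OF hG h_le null int\<psi>'])
  moreover have "(\<integral>x. of_real (\<psi>' x) * h n x \<partial>M) = (\<integral>x. of_real (\<psi>' x) * Q n (r n) x \<partial>M) - (\<integral>x. of_real (\<psi>' x) \<partial>M)" for n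
  proof -
    have "(\<integral>x. of_real (\<psi>' x) * h n x \<partial>M) = (\<integral>x. of_real (\<psi>' x) * Q n (r n) x - of_real (\<psi>' x) \<partial>M)"
      by (simp add: h_def right_diff_distrib)
    also have "\<dots> = (\<integral>x. of_real (\<psi>' x) * Q n (r n) x \<partial>M) - (\<integral>x. of_real (\<psi>' x) \<partial>M)"
      by (intro Bochner_Integration.integral_diff intQ int\<psi>') (use int\<psi>' in auto)
    finally show ?thesis .
  qed
  ultimately have W1: "(\<lambda>n. (\<integral>x. of_real (\<psi>' x) * Q n (r n) x \<partial>M) - (\<integral>x. of_real (\<psi>' x) \<partial>M)) \<longlonglongrightarrow> 0" by simp
  have "(\<lambda>n. \<integral>x. of_real (\<psi> x) * iexp (T n (r n) x) - of_real (\<psi>' x) * Q n (r n) x \<partial>M) \<longlonglongrightarrow> (\<integral>x. 0 \<partial>M)"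
  proof (rule integral_dominated_convergence[where w = "\<lambda>x. B * (1 + exp (K / 2))"])
    have split: "of_real (\<psi> x) * iexp (T n (r n) x) - of_real (\<psi>' x) * Q n (r n) x
       = of_real (\<psi> x) * iexp (T n (r n) x) * of_real (1 - exp ((V n (r n) x - \<eta> x) / 2))" for n x
    proof -
      have "exp ((V n (r n) x - \<eta> x) / 2) = exp (- \<eta> x / 2) * exp (V n (r n) x / 2)"
        unfolding exp_add[symmetric] by (simp add: diff_divide_distrib)
      moreover have "of_real (\<psi>' x) * Q n (r n) x
         = of_real (\<psi> x) * iexp (T n (r n) x) * of_real (exp (- \<eta> x / 2) * exp (V n (r n) x / 2))"
        unfolding \<psi>'_def Q_def of_real_mult by (simp only: mult_ac)
      ultimately show ?thesis by (simp only: of_real_diff of_real_1 right_diff_distrib mult_1_right)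
    qed
    have norm_eq: "norm (of_real (\<psi> x) * iexp (T n (r n) x) - of_real (\<psi>' x) * Q n (r n) x)
       = \<bar>\<psi> x\<bar> * \<bar>1 - exp ((V n (r n) x - \<eta> x) / 2)\<bar>" for n x
      unfolding split norm_mult norm_of_real norm_exp_i_times by simp
    show "AE x in M. (\<lambda>n. of_real (\<psi> x) * iexp (T n (r n) x) - of_real (\<psi>' x) * Q n (r n) x) \<longlonglongrightarrow> 0"
      using variance
    proof eventually_elim
      case (elim x)
      then have lim: "(\<lambda>n. V n (r n) x) \<longlonglongrightarrow> \<eta> x" by (simp add: V_def v_def)
      have "(\<lambda>n. \<bar>\<psi> x\<bar> * \<bar>1 - exp ((V n (r n) x - \<eta> x) / 2)\<bar>) \<longlonglongrightarrow> \<bar>\<psi> x\<bar> * \<bar>1 - exp ((\<eta> x - \<eta> x) / 2)\<bar>"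
        by (intro tendsto_intros lim) simp
      then have "(\<lambda>n. norm (of_real (\<psi> x) * iexp (T n (r n) x) - of_real (\<psi>' x) * Q n (r n) x)) \<longlonglongrightarrow> 0"
        unfolding norm_eq by simp
      then show ?case by (rule tendsto_norm_zero_cancel)
    qed
    show "AE x in M. norm (of_real (\<psi> x) * iexp (T n (r n) x) - of_real (\<psi>' x) * Q n (r n) x) \<le> B * (1 + exp (K / 2))" for n
      using V_le \<eta>_le
    proof eventually_elim
      case (elim x)
      have "V n (r n) x \<le> K" using elim(1) by blast
      then have "exp ((V n (r n) x - \<eta> x) / 2) \<le> exp (K / 2)" using elim(2) by simp
      moreover have "\<bar>1 - exp u\<bar> \<le> 1 + exp u" for u :: real using exp_gt_zero[of u] by linarith
      ultimately have "\<bar>1 - exp ((V n (r n) x - \<eta> x) / 2)\<bar> \<le> 1 + exp (K / 2)"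
        by (smt (verit))
      then show ?case unfolding norm_eq using \<psi>_bnd[of x] B0 by (intro mult_mono) auto
    qed
  qed auto
  moreover have "(\<integral>x. of_real (\<psi> x) * iexp (T n (r n) x) - of_real (\<psi>' x) * Q n (r n) x \<partial>M)
     = (\<integral>x. of_real (\<psi> x) * iexp (T n (r n) x) \<partial>M) - (\<integral>x. of_real (\<psi>' x) * Q n (r n) x \<partial>M)" for n
  proof (intro Bochner_Integration.integral_diff intQ int\<psi>')
    show "integrable M (\<lambda>x. of_real (\<psi> x) * iexp (T n (r n) x))"
      by (rule integrable_const_bound[where B=B]) (auto simp: norm_mult \<psi>_bnd)
  qed simp
  ultimately have W2: "(\<lambda>n. (\<integral>x. of_real (\<psi> x) * iexp (T n (r n) x) \<partial>M) - (\<integral>x. of_real (\<psi>' x) * Q n (r n) x \<partial>M)) \<longlonglongrightarrow> 0"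
    by simp
  from tendsto_add[OF tendsto_add[OF W1 W2] tendsto_const[of "\<integral>x. of_real (\<psi>' x) \<partial>M"]]
  show ?thesis by (simp add: T_def \<psi>'_def)
qed

end

section \<open>Stable convergence to a pair of normal kernels\<close>

text \<open>As the image of the standard normal law under a scaling, the kernel has one formula for
  all \<open>v\<close>, with \<open>max 0 v\<close> covering the degenerate and the negative values.
  Measurability in \<open>v\<close> and the characteristic function are read off from it.\<close>

lemma centred_normal_distr:
  "centred_normal v = distr std_normal_distribution borel (\<lambda>x. sqrt (max 0 v) * x)"
proof (cases "v > 0")
  case True
  interpret prob_space std_normal_distribution by (rule prob_space_normal_density) simp
  have "distributed std_normal_distribution lborel (\<lambda>x. x) (normal_density 0 1)"
    by (auto simp: distributed_def distr_id2 intro!: measure_eqI)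
  from normal_density_affine[OF this, of "sqrt v" 0] True
  have "distributed std_normal_distribution lborel (\<lambda>x. sqrt v * x) (normal_density 0 (sqrt v))" by simp
  then have "distr std_normal_distribution lborel (\<lambda>x. sqrt v * x) = density lborel (normal_density 0 (sqrt v))"
    by (simp add: distributed_def)
  moreover have "distr std_normal_distribution lborel (\<lambda>x. sqrt v * x) = distr std_normal_distribution borel (\<lambda>x. sqrt v * x)"
    by (rule distr_cong) auto
  ultimately show ?thesis using True by (simp add: centred_normal_def max_def)
next
  case False
  interpret prob_space std_normal_distribution by (rule prob_space_normal_density) simp
  have "distr std_normal_distribution borel (\<lambda>x. 0 :: real) = return borel 0"
    by (rule distr_const) simp
  moreover have "(\<lambda>x. sqrt (max 0 v) * x) = (\<lambda>x. 0)" using False by (auto simp: max_def)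
  ultimately show ?thesis using False by (simp only: centred_normal_def if_False)
qed

lemma measurable_centred_normal[measurable]: "centred_normal \<in> borel \<rightarrow>\<^sub>M prob_algebra borel"
proof -
  have "prob_space std_normal_distribution" by (rule prob_space_normal_density) simp
  then have [measurable]: "(\<lambda>v::real. std_normal_distribution) \<in> borel \<rightarrow>\<^sub>M prob_algebra borel"
    by (intro measurable_const) (simp add: space_prob_algebra)
  have "(\<lambda>v. distr std_normal_distribution borel (\<lambda>x. sqrt (max 0 v) * x)) \<in> borel \<rightarrow>\<^sub>M prob_algebra borel"
    by measurable
  then show ?thesis by (simp add: centred_normal_distr[abs_def])
qed

lemma prob_space_centred_normal: "prob_space (centred_normal v)"
  using measurable_space[OF measurable_centred_normal, of v] by (simp add: space_prob_algebra)

lemma sets_centred_normal[measurable_cong, simp]: "sets (centred_normal v) = sets borel"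
  using measurable_space[OF measurable_centred_normal, of v] by (simp add: space_prob_algebra)

lemma char_centred_normal:
  "(\<integral>x. iexp (t * x) \<partial>centred_normal v) = of_real (exp (- (t\<^sup>2 * max 0 v) / 2))"
proof -
  have "(\<integral>x. iexp (t * x) \<partial>centred_normal v) = char std_normal_distribution (t * sqrt (max 0 v))"
    unfolding centred_normal_distr char_def by (subst integral_distr) (simp_all add: mult.assoc)
  then show ?thesis by (simp add: char_std_normal_distribution power_mult_distrib)
qed

lemma char_centred_normal_pair:
  "(\<integral>z. iexp (s * fst z + t * snd z) \<partial>(centred_normal u \<Otimes>\<^sub>M centred_normal v))
     = of_real (exp (- (s\<^sup>2 * max 0 u + t\<^sup>2 * max 0 v) / 2))"
proof -
  interpret U: prob_space "centred_normal u" by (rule prob_space_centred_normal)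
  interpret V: prob_space "centred_normal v" by (rule prob_space_centred_normal)
  interpret UV: pair_prob_space "centred_normal u" "centred_normal v" ..
  have "integrable (centred_normal u \<Otimes>\<^sub>M centred_normal v) (\<lambda>z. iexp (s * fst z + t * snd z))"
    by (rule UV.P.integrable_const_bound[where B=1]) auto
  from UV.integral_fst'[OF this, symmetric]
  have "(\<integral>z. iexp (s * fst z + t * snd z) \<partial>(centred_normal u \<Otimes>\<^sub>M centred_normal v))
     = (\<integral>x. \<integral>y. iexp (s * x) * iexp (t * y) \<partial>centred_normal v \<partial>centred_normal u)"
    by (simp add: distrib_left exp_add)
  also have "\<dots> = (\<integral>x. iexp (s * x) \<partial>centred_normal u) * (\<integral>y. iexp (t * y) \<partial>centred_normal v)"
    by simp
  also have "\<dots> = of_real (exp (- (s\<^sup>2 * max 0 u) / 2) * exp (- (t\<^sup>2 * max 0 v) / 2))"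
    by (simp only: char_centred_normal) (simp only: of_real_mult)
  also have "exp (- (s\<^sup>2 * max 0 u) / 2) * exp (- (t\<^sup>2 * max 0 v) / 2) = exp (- (s\<^sup>2 * max 0 u + t\<^sup>2 * max 0 v) / 2)"
    by (simp add: exp_add[symmetric] add_divide_distrib diff_divide_distrib)
  finally show ?thesis .
qed

lemma measurable_centred_normal_pair:
  assumes [measurable]: "U \<in> borel_measurable M" "V \<in> borel_measurable M"
  shows "(\<lambda>\<omega>. centred_normal (U \<omega>) \<Otimes>\<^sub>M centred_normal (V \<omega>)) \<in> M \<rightarrow>\<^sub>M prob_algebra borel"
proof -
  have "(\<lambda>\<omega>. centred_normal (U \<omega>) \<Otimes>\<^sub>M centred_normal (V \<omega>)) \<in> M \<rightarrow>\<^sub>M prob_algebra (borel \<Otimes>\<^sub>M borel)"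
    by measurable
  then show ?thesis by (simp add: borel_prod)
qed

lemma (in prob_space) integral_uniform_measure:
  fixes f :: "'a \<Rightarrow> real"
  assumes F[measurable]: "F \<in> sets M" and "prob F > 0" and [measurable]: "f \<in> borel_measurable M"
  shows "(\<integral>x. f x \<partial>uniform_measure M F) = (\<integral>x. indicator F x * f x \<partial>M) / prob F"
proof -
  have "(\<lambda>x. indicator F x / emeasure M F) = (\<lambda>x. ennreal (indicator F x / prob F))"
    using assms(2) by (auto simp: emeasure_eq_measure divide_ennreal indicator_def ennreal_1[symmetric] simp del: ennreal_1)
  then have "(\<integral>x. f x \<partial>uniform_measure M F) = (\<integral>x. indicator F x / prob F * f x \<partial>M)"
    unfolding uniform_measure_def by (simp add: integral_real_density)
  also have "\<dots> = (\<integral>x. indicator F x * f x \<partial>M) / prob F"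
    by (simp flip: integral_divide_zero)
  finally show ?thesis .
qed

text \<open>Characteristic functions restricted to each event suffice: under the conditional measure
  given \<open>F\<close>, Markov's inequality turns the uniform first moment bound into tightness,
  at the price of a factor \<open>1 / prob F\<close>.\<close>

theorem (in prob_space) converges_stably_normal_pair:
  fixes Y :: "nat \<Rightarrow> 'a \<Rightarrow> real \<times> real"
  assumes Y[measurable]: "\<And>n. Y n \<in> borel_measurable M"
    and UV[measurable]: "U \<in> borel_measurable M" "V \<in> borel_measurable M"
    and nonneg: "AE x in M. 0 \<le> U x \<and> 0 \<le> V x"
    and int: "\<And>n. integrable M (Y n)" and bnd: "\<And>n. (\<integral>x. norm (Y n x) \<partial>M) \<le> C"
    and char: "\<And>F s t. F \<in> sets M \<Longrightarrow>
       (\<lambda>n. \<integral>x. of_real (indicator F x) * iexp (s * fst (Y n x) + t * snd (Y n x)) \<partial>M)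
         \<longlonglongrightarrow> (\<integral>x. of_real (indicator F x * exp (- (s\<^sup>2 * U x + t\<^sup>2 * V x) / 2)) \<partial>M)"
  shows "converges_stably M Y (\<lambda>\<omega>. centred_normal (U \<omega>) \<Otimes>\<^sub>M centred_normal (V \<omega>))"
  unfolding converges_stably_def
proof (intro conjI ballI impI allI)
  define K where "K = (\<lambda>\<omega>. centred_normal (U \<omega>) \<Otimes>\<^sub>M centred_normal (V \<omega>))"
  show KM: "(\<lambda>\<omega>. centred_normal (U \<omega>) \<Otimes>\<^sub>M centred_normal (V \<omega>)) \<in> M \<rightarrow>\<^sub>M prob_algebra borel"
    by (rule measurable_centred_normal_pair) measurable
  show "Y n \<in> borel_measurable M" for n by (rule Y)
  fix F assume F[measurable]: "F \<in> sets M" and pos: "0 < prob F"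
  define MF where "MF = uniform_measure M F"
  have setsMF[measurable_cong, simp]: "sets MF = sets M" and spaceMF[simp]: "space MF = space M" by (simp_all add: MF_def)
  have eF: "emeasure M F \<noteq> 0" "emeasure M F \<noteq> \<infinity>" using pos by (simp_all add: emeasure_eq_measure)
  interpret MF: prob_space MF unfolding MF_def using eF by (intro prob_space_uniform_measure) auto
  have K[measurable]: "K \<in> MF \<rightarrow>\<^sub>M prob_algebra borel"
    using KM unfolding K_def by (simp cong: measurable_cong_sets)
  have [measurable]: "(\<lambda>x. fst (Y n x)) \<in> borel_measurable M" "(\<lambda>x. snd (Y n x)) \<in> borel_measurable M" for n
    by (rule measurable_compose[OF Y], rule borel_measurable_continuous_onI, intro continuous_intros)+
  have [measurable]: "(\<lambda>z :: real \<times> real. cos (s * fst z + t * snd z + d)) \<in> borel_measurable borel" for s t d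
    by (intro borel_measurable_continuous_onI continuous_intros)
  have "0 \<le> (\<integral>x. norm (Y 0 x) \<partial>M)" by simp
  then have C0: "0 \<le> C" using bnd[of 0] by linarith
  have bind: "prob_space (MF \<bind> K)" "sets (MF \<bind> K) = sets borel"
    using MF.prob_space_bind[OF AE_I2 measurable_prob_algebraD[OF K]]
      sets_bind[OF _ MF.not_empty, of K borel] measurable_space[OF K]
    by (auto simp: space_prob_algebra)
  have "weakly_converges (\<lambda>n. distr MF borel (Y n)) (MF \<bind> K)"
  proof (rule weakly_converges_plane_I)
    show "prob_space (distr MF borel (Y n))" for n by (rule MF.prob_space_distr) simp
    show "prob_space (MF \<bind> K)" "sets (MF \<bind> K) = sets borel" by (fact bind)+
    show "\<exists>R. \<forall>n. measure (distr MF borel (Y n)) {z. norm z > R} \<le> e" if e: "0 < e" for e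
    proof (intro exI allI)
      fix n
      \<comment> \<open>Chosen so that the Markov bound \<open>C / R\<close>, divided by
        \<open>prob F\<close>, is \<open>e * (C / (C + 1))\<close>; the added 1 keeps
        \<open>R\<close> positive when \<open>C = 0\<close>.\<close>
      define R where "R = (C + 1) / (e * prob F)"
      have R: "0 < R" unfolding R_def using C0 e pos by simp
      have open_R: "{z :: real \<times> real. norm z > R} \<in> sets borel"
        by (intro borel_open open_Collect_less continuous_intros)
      have "measure (distr MF borel (Y n)) {z. norm z > R} = measure MF (Y n -` {z. norm z > R} \<inter> space M)"
        using open_R by (subst measure_distr) auto
      also have "\<dots> = prob (F \<inter> (Y n -` {z. norm z > R} \<inter> space M)) / prob F"
        unfolding MF_def using open_R by (intro measure_uniform_measure eF measurable_sets[OF Y])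
      also have "\<dots> \<le> prob {x \<in> space M. norm (Y n x) \<ge> R} / prob F"
        using pos by (intro divide_right_mono finite_measure_mono) auto
      also have "\<dots> \<le> (C / R) / prob F"
      proof (rule divide_right_mono)
        have "prob {x \<in> space M. norm (Y n x) \<ge> R} \<le> (\<integral>x. norm (Y n x) \<partial>M) / R"
          by (rule integral_Markov_inequality_measure[where A="{}", OF _ _ _ R]) (use int in auto)
        also have "\<dots> \<le> C / R" using bnd R by (intro divide_right_mono) auto
        finally show "prob {x \<in> space M. norm (Y n x) \<ge> R} \<le> C / R" .
      qed (use pos in simp)
      also have "\<dots> = e * (C / (C + 1))" 
      proof -
        have "C + 1 \<noteq> 0" using C0 by simp
        then show ?thesis unfolding R_def using pos e by (simp add: divide_simps)
      qed
      also have "\<dots> \<le> e * 1" using C0 e by (intro mult_left_mono) auto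
      finally show "measure (distr MF borel (Y n)) {z. norm z > (C + 1) / (e * prob F)} \<le> e" by (simp add: R_def)
    qed
    fix s t d :: real
    \<comment> \<open>The phase \<open>d\<close> becomes the constant factor \<open>iexp d\<close>,
      so the hypothesis on characteristic functions, stated without a phase, applies.\<close>
    have int_cos: "(\<integral>x. cos (s * fst (Y n x) + t * snd (Y n x) + d) \<partial>MF)
      = Re (iexp d * (\<integral>x. of_real (indicator F x) * iexp (s * fst (Y n x) + t * snd (Y n x)) \<partial>M)) / prob F" for n
    proof -
      have "(\<integral>x. cos (s * fst (Y n x) + t * snd (Y n x) + d) \<partial>MF)
        = (\<integral>x. indicator F x * cos (s * fst (Y n x) + t * snd (Y n x) + d) \<partial>M) / prob F"
        unfolding MF_def by (rule integral_uniform_measure[OF F pos]) measurable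
      also have "(\<integral>x. indicator F x * cos (s * fst (Y n x) + t * snd (Y n x) + d) \<partial>M)
        = (\<integral>x. Re (iexp d * (of_real (indicator F x) * iexp (s * fst (Y n x) + t * snd (Y n x)))) \<partial>M)"
        by (rule Bochner_Integration.integral_cong) (auto simp: indicator_def exp_add[symmetric] Re_exp algebra_simps)
      also have "\<dots> = Re (\<integral>x. iexp d * (of_real (indicator F x) * iexp (s * fst (Y n x) + t * snd (Y n x))) \<partial>M)"
        by (rule integral_Re, rule integrable_const_bound[where B=1]) (auto simp: norm_mult indicator_def)
      finally show ?thesis by simp
    qed
    have "(\<lambda>n. Re (iexp d * (\<integral>x. of_real (indicator F x) * iexp (s * fst (Y n x) + t * snd (Y n x)) \<partial>M)) / prob F)
      \<longlonglongrightarrow> Re (iexp d * (\<integral>x. of_real (indicator F x * exp (- (s\<^sup>2 * U x + t\<^sup>2 * V x) / 2)) \<partial>M)) / prob F"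
      using pos by (intro tendsto_intros char F) auto
    also have "Re (iexp d * (\<integral>x. of_real (indicator F x * exp (- (s\<^sup>2 * U x + t\<^sup>2 * V x) / 2)) \<partial>M)) / prob F
      = (\<integral>z. cos (s * fst z + t * snd z + d) \<partial>(MF \<bind> K))"
    proof -
      have inner: "(\<integral>z. cos (s * fst z + t * snd z + d) \<partial>K x) = cos d * exp (- (s\<^sup>2 * max 0 (U x) + t\<^sup>2 * max 0 (V x)) / 2)" for x
      proof -
        interpret U: prob_space "centred_normal (U x)" by (rule prob_space_centred_normal)
        interpret V: prob_space "centred_normal (V x)" by (rule prob_space_centred_normal)
        interpret UV: pair_prob_space "centred_normal (U x)" "centred_normal (V x)" ..
        have "(\<integral>z. cos (s * fst z + t * snd z + d) \<partial>K x) = (\<integral>z. Re (iexp d * iexp (s * fst z + t * snd z)) \<partial>K x)"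
          by (rule Bochner_Integration.integral_cong) (auto simp: exp_add[symmetric] Re_exp algebra_simps)
        also have "\<dots> = Re (\<integral>z. iexp d * iexp (s * fst z + t * snd z) \<partial>K x)"
          unfolding K_def by (rule integral_Re, rule UV.P.integrable_const_bound[where B=1]) (auto simp: norm_mult)
        also have "\<dots> = Re (iexp d * of_real (exp (- (s\<^sup>2 * max 0 (U x) + t\<^sup>2 * max 0 (V x)) / 2)))"
          unfolding K_def by (simp only: integral_mult_right_zero char_centred_normal_pair)
        finally show ?thesis by (simp add: Re_exp)
      qed
      have "(\<integral>z. cos (s * fst z + t * snd z + d) \<partial>(MF \<bind> K)) = (\<integral>x. \<integral>z. cos (s * fst z + t * snd z + d) \<partial>K x \<partial>MF)"
      proof (rule integral_bind[where B=1 and B'=1 and K=borel])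
        show "K \<in> MF \<rightarrow>\<^sub>M subprob_algebra borel" by (rule measurable_prob_algebraD[OF K])
        show "AE x in MF. emeasure (K x) (space (K x)) \<le> ennreal 1"
          using measurable_space[OF K] by (intro AE_I2) (auto simp: space_prob_algebra prob_space.emeasure_space_1)
      qed (auto intro: MF.finite_measure_axioms)
      also have "\<dots> = (\<integral>x. indicator F x * (cos d * exp (- (s\<^sup>2 * max 0 (U x) + t\<^sup>2 * max 0 (V x)) / 2)) \<partial>M) / prob F"
        unfolding inner MF_def by (rule integral_uniform_measure[OF F pos]) measurable
      also have "(\<integral>x. indicator F x * (cos d * exp (- (s\<^sup>2 * max 0 (U x) + t\<^sup>2 * max 0 (V x)) / 2)) \<partial>M)
        = (\<integral>x. cos d * (indicator F x * exp (- (s\<^sup>2 * U x + t\<^sup>2 * V x) / 2)) \<partial>M)"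
      proof (rule integral_cong_AE)
        show "AE x in M. indicator F x * (cos d * exp (- (s\<^sup>2 * max 0 (U x) + t\<^sup>2 * max 0 (V x)) / 2))
           = cos d * (indicator F x * exp (- (s\<^sup>2 * U x + t\<^sup>2 * V x) / 2))"
          using nonneg by eventually_elim (simp add: max_def)
      qed measurable
      also have "\<dots> = Re (iexp d * (\<integral>x. of_real (indicator F x * exp (- (s\<^sup>2 * U x + t\<^sup>2 * V x) / 2)) \<partial>M))"
        by (simp only: integral_complex_of_real) (simp add: Re_exp)
      finally show ?thesis by simp
    qed
    finally show "(\<lambda>n. \<integral>z. cos (s * fst z + t * snd z + d) \<partial>distr MF borel (Y n))
       \<longlonglongrightarrow> (\<integral>z. cos (s * fst z + t * snd z + d) \<partial>(MF \<bind> K))"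
      by (simp add: integral_distr int_cos)
  qed simp
  then show "weakly_converges (\<lambda>n. distr (uniform_measure M F) borel (Y n))
     (uniform_measure M F \<bind> (\<lambda>\<omega>. centred_normal (U \<omega>) \<Otimes>\<^sub>M centred_normal (V \<omega>)))"
    unfolding MF_def K_def .
qed

section \<open>The draws of the urn\<close>

context filtered_prob_space
begin

text \<open>Integrability is bundled in because the rules for conditional expectations ask for it;
  the conditional moments of the urn can then be obtained by composing such statements. The value
  \<open>g\<close> is fixed only up to null sets.\<close>

definition has_cond_mean :: "nat \<Rightarrow> ('a \<Rightarrow> real) \<Rightarrow> ('a \<Rightarrow> real) \<Rightarrow> bool" where
  "has_cond_mean k f g \<longleftrightarrow> integrable M f \<and> (AE x in M. cexp k f x = g x)"

lemma has_cond_meanI: "integrable M f \<Longrightarrow> has_cond_mean k f (cexp k f)"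
  by (simp add: has_cond_mean_def)

lemma has_cond_mean_AE: "has_cond_mean k f g \<Longrightarrow> AE x in M. cexp k f x = g x"
  by (simp add: has_cond_mean_def)

lemma has_cond_mean_cong:
  assumes "has_cond_mean k f g" "AE x in M. f x = f' x" "f' \<in> borel_measurable M" "AE x in M. g x = g' x"
  shows "has_cond_mean k f' g'"
proof -
  interpret F: finite_measure_subalgebra M "G k" by (rule fms)
  have f: "integrable M f" "f \<in> borel_measurable M" using assms(1) by (auto simp: has_cond_mean_def)
  have "integrable M f'" using f(1) assms(3,2) by (rule Bochner_Integration.integrable_cong_AE_imp)
  moreover have "AE x in M. cexp k f x = cexp k f' x"
    by (rule F.real_cond_exp_cong[OF assms(2) f(2) assms(3)])
  then have "AE x in M. cexp k f' x = g' x"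
    using has_cond_mean_AE[OF assms(1)] assms(4) by eventually_elim simp
  ultimately show ?thesis by (simp add: has_cond_mean_def)
qed

lemma has_cond_mean_add:
  assumes "has_cond_mean k f g" "has_cond_mean k f' g'"
  shows "has_cond_mean k (\<lambda>x. f x + f' x) (\<lambda>x. g x + g' x)"
proof -
  interpret F: finite_measure_subalgebra M "G k" by (rule fms)
  have i: "integrable M f" "integrable M f'" using assms by (auto simp: has_cond_mean_def)
  have "AE x in M. cexp k (\<lambda>x. f x + f' x) x = g x + g' x"
    using F.real_cond_exp_add[OF i] has_cond_mean_AE[OF assms(1)] has_cond_mean_AE[OF assms(2)]
    by eventually_elim simp
  then show ?thesis using i by (simp add: has_cond_mean_def)
qed

lemma has_cond_mean_mult:
  assumes c: "c \<in> borel_measurable (G k)" and B: "AE x in M. \<bar>c x\<bar> \<le> B" and f: "has_cond_mean k f g"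
  shows "has_cond_mean k (\<lambda>x. c x * f x) (\<lambda>x. c x * g x)"
proof -
  interpret F: finite_measure_subalgebra M "G k" by (rule fms)
  have i: "integrable M f" using f by (auto simp: has_cond_mean_def)
  have cM: "c \<in> borel_measurable M" by (rule measurable_G[OF c])
  have ci: "integrable M (\<lambda>x. c x * f x)" using F.integrable_bounded_mult[OF cM _ i] B by simp
  have "AE x in M. cexp k (\<lambda>x. c x * f x) x = c x * g x"
    using F.real_cond_exp_mult[OF c _ ci] i has_cond_mean_AE[OF f] by (auto elim: AE_mp)
  then show ?thesis using ci by (simp add: has_cond_mean_def)
qed

lemma has_cond_mean_cmult: "has_cond_mean k f g \<Longrightarrow> has_cond_mean k (\<lambda>x. c * f x) (\<lambda>x. c * g x)"
  by (rule has_cond_mean_mult[where B="\<bar>c\<bar>"]) auto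

lemma has_cond_mean_diff:
  assumes "has_cond_mean k f g" "has_cond_mean k f' g'"
  shows "has_cond_mean k (\<lambda>x. f x - f' x) (\<lambda>x. g x - g' x)"
  using has_cond_mean_add[OF assms(1) has_cond_mean_cmult[OF assms(2), of "-1"]] by simp

lemma has_cond_mean_adapted:
  assumes "c \<in> borel_measurable (G k)" "AE x in M. \<bar>c x\<bar> \<le> B"
  shows "has_cond_mean k c c"
proof -
  interpret F: finite_measure_subalgebra M "G k" by (rule fms)
  have "integrable M c" by (rule integrable_const_bound[where B=B]) (use assms measurable_G in auto)
  then show ?thesis using F.real_cond_exp_F_meas[OF _ assms(1)] by (simp add: has_cond_mean_def)
qed

end

section \<open>Generated sigma-algebras and the range of the draws\<close>

lemma space_gen_sigma[simp]: "space (gen_sigma M Ys) = space M"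
  unfolding gen_sigma_def by (subst space_measure_of) auto

lemma sets_gen_sigma: "sets (gen_sigma M Ys) = sigma_sets (space M) {Y -` T \<inter> space M | Y T. Y \<in> Ys}"
  unfolding gen_sigma_def by (subst sets_measure_of) auto

lemma measurable_gen_sigma: "Y \<in> Ys \<Longrightarrow> Y \<in> gen_sigma M Ys \<rightarrow>\<^sub>M count_space UNIV"
  by (auto simp: measurable_def sets_gen_sigma)

lemma sets_gen_sigma_subset:
  assumes "\<And>Y. Y \<in> Ys \<Longrightarrow> Y \<in> F \<rightarrow>\<^sub>M count_space UNIV" "space F = space M"
  shows "sets (gen_sigma M Ys) \<subseteq> sets F"
  unfolding sets_gen_sigma assms(2)[symmetric]
  by (rule sets.sigma_sets_subset) (use measurable_sets[OF assms(1)] in auto)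

lemma subalgebra_gen_sigma:
  assumes "\<And>Y. Y \<in> Ys \<Longrightarrow> Y \<in> F \<rightarrow>\<^sub>M count_space UNIV" "space F = space M"
  shows "subalgebra F (gen_sigma M Ys)"
  using sets_gen_sigma_subset[OF assms] assms(2) by (simp add: subalgebra_def)

lemma borel_measurable_real_of_nat_valued:
  assumes "Y \<in> M \<rightarrow>\<^sub>M count_space UNIV"
  shows "(\<lambda>x. real (Y x)) \<in> borel_measurable M"
  by (rule measurable_compose[OF assms]) simp

text \<open>Integrating the conditional mass over \<open>D\<close>, an event of the conditioning
  sigma-algebra, gives the probability that \<open>D\<close> occurs and \<open>Y = k\<close>. This
  turns the conditional laws of the urn into pathwise constraints.\<close>

lemma (in prob_space) AE_not_mass:
  assumes "finite_measure_subalgebra M F" and Y: "Y \<in> M \<rightarrow>\<^sub>M count_space UNIV"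
    and D: "D \<in> sets F" and zero: "AE x in M. x \<in> D \<longrightarrow> cond_mass M F Y k x = 0"
  shows "AE x in M. x \<in> D \<longrightarrow> Y x \<noteq> k"
proof -
  interpret F: finite_measure_subalgebra M F by fact
  have DM[measurable]: "D \<in> sets M" using D F.subalg by (auto simp: subalgebra_def)
  have E[measurable]: "Y -` {k} \<inter> space M \<in> sets M" using Y by measurable
  define I where "I x = (indicator D x * indicator (Y -` {k} \<inter> space M) x :: real)" for x
  have int: "integrable M I" unfolding I_def
  proof (rule integrable_const_bound[where B=1])
    show "(\<lambda>x. indicator D x * indicator (Y -` {k} \<inter> space M) x :: real) \<in> borel_measurable M" by measurable
  qed (auto simp: indicator_def)
  have "(\<integral>x. I x \<partial>M) = (\<integral>x. indicator D x * cond_mass M F Y k x \<partial>M)"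
    unfolding I_def cond_mass_def using D E int by (intro F.real_cond_exp_intg(2)[symmetric]) (auto simp: I_def[abs_def])
  also have "\<dots> = (\<integral>x. 0 \<partial>M)"
  proof (rule integral_cong_AE)
    show "AE x in M. indicator D x * cond_mass M F Y k x = 0"
      using zero by eventually_elim (simp add: indicator_def)
  qed (simp_all add: cond_mass_def)
  finally have "(\<integral>x. I x \<partial>M) = 0" by simp
  moreover have "AE x in M. 0 \<le> I x" by (rule AE_I2) (simp add: I_def)
  ultimately have "AE x in M. I x = 0"
    using integral_nonneg_eq_0_iff_AE[OF int] by blast
  then show ?thesis by (rule AE_mp) (auto simp: I_def indicator_def)
qed

locale bounded_urn = urn_model M a b N X A B
  for M :: "'w measure" and a b and N X A B :: "nat \<Rightarrow> 'w \<Rightarrow> nat" +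
  fixes C :: nat
  assumes bounded: "\<And>n. n \<ge> 1 \<Longrightarrow> AE w in M. A n w \<le> C \<and> B n w \<le> C \<and> N n w \<le> C"
begin

abbreviation "Hist j \<equiv> urn_F M N X A B j"
text \<open>\<open>Hist_N\<close> is the conditioning in the hypergeometric law of the sample,
  \<open>Hist_NX\<close> the sigma-algebra from which the reinforcement is independent. Both refer
  to draw \<open>Suc j\<close>, the one that follows the history \<open>Hist j\<close>; the
  abbreviations \<open>num\<close>, \<open>smp\<close>, \<open>addA\<close> and \<open>addB\<close>
  share this shift.\<close>

definition "Hist_N j = gen_sigma M (insert (N (Suc j)) (urn_history N X A B j))"
definition "Hist_NX j = gen_sigma M (insert (N (Suc j)) (insert (X (Suc j)) (urn_history N X A B j)))"
abbreviation "num j w \<equiv> real (N (Suc j) w)"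
abbreviation "smp j w \<equiv> real (X (Suc j) w)"
abbreviation "addA j w \<equiv> real (A (Suc j) w)"
abbreviation "addB j w \<equiv> real (B (Suc j) w)"
abbreviation "balls j w \<equiv> urn_S a b N X A B j w"
abbreviation "ballsA j w \<equiv> urn_H a X A j w"
abbreviation "prop j w \<equiv> urn_Z a b N X A B j w"
text \<open>
  \<open>prop2 j\<close> is the probability that two balls drawn without replacement both have color A. In terms of
  it the conditional second moments of a draw are exact.
\<close>

definition "prop2 j w = real (ballsA j w) * (real (ballsA j w) - 1) / (real (balls j w) * (real (balls j w) - 1))"

lemma rv[measurable]:
  "N (Suc j) \<in> M \<rightarrow>\<^sub>M count_space UNIV" "X (Suc j) \<in> M \<rightarrow>\<^sub>M count_space UNIV"
  "A (Suc j) \<in> M \<rightarrow>\<^sub>M count_space UNIV" "B (Suc j) \<in> M \<rightarrow>\<^sub>M count_space UNIV"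
  using random_variables[of "Suc j"] by auto

lemma history_rv: "Y \<in> urn_history N X A B j \<Longrightarrow> Y \<in> M \<rightarrow>\<^sub>M count_space UNIV"
  using random_variables by (auto simp: urn_history_def)

lemma history_mono: "j \<le> k \<Longrightarrow> urn_history N X A B j \<subseteq> urn_history N X A B k"
  unfolding urn_history_def by (rule UN_mono) auto

lemma history_Suc: "{N (Suc j), X (Suc j), A (Suc j), B (Suc j)} \<subseteq> urn_history N X A B (Suc j)"
  unfolding urn_history_def by (rule UN_upper) simp

sublocale filtered_prob_space M Hist
proof unfold_locales
  show "subalgebra M (Hist k)" for k
    unfolding urn_F_def by (rule subalgebra_gen_sigma) (auto intro: history_rv)
  show "sets (Hist k) \<subseteq> sets (Hist l)" if "k \<le> l" for k l
    unfolding urn_F_def using history_mono[OF that]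
    by (intro sets_gen_sigma_subset) (auto intro: measurable_gen_sigma)
qed

lemma subalgebra_Hist_N: "subalgebra M (Hist_N j)" "subalgebra (Hist_N j) (Hist j)"
  unfolding Hist_N_def urn_F_def by (rule subalgebra_gen_sigma; auto intro: history_rv measurable_gen_sigma)+

lemma subalgebra_Hist_NX: "subalgebra M (Hist_NX j)" "subalgebra (Hist_NX j) (Hist j)"
  unfolding Hist_NX_def urn_F_def by (rule subalgebra_gen_sigma; auto intro: history_rv measurable_gen_sigma)+

lemma fms_N: "finite_measure_subalgebra M (Hist_N j)"
  by unfold_locales (rule subalgebra_Hist_N)

lemma Hist_measurable:
  assumes "i < j"
  shows "N (Suc i) \<in> Hist j \<rightarrow>\<^sub>M count_space UNIV" "X (Suc i) \<in> Hist j \<rightarrow>\<^sub>M count_space UNIV"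
    "A (Suc i) \<in> Hist j \<rightarrow>\<^sub>M count_space UNIV" "B (Suc i) \<in> Hist j \<rightarrow>\<^sub>M count_space UNIV"
proof -
  have "{N (Suc i), X (Suc i), A (Suc i), B (Suc i)} \<subseteq> urn_history N X A B j"
    using history_Suc[of i] history_mono[of "Suc i" j] assms by auto
  then show "N (Suc i) \<in> Hist j \<rightarrow>\<^sub>M count_space UNIV" "X (Suc i) \<in> Hist j \<rightarrow>\<^sub>M count_space UNIV"
    "A (Suc i) \<in> Hist j \<rightarrow>\<^sub>M count_space UNIV" "B (Suc i) \<in> Hist j \<rightarrow>\<^sub>M count_space UNIV"
    unfolding urn_F_def by (auto intro: measurable_gen_sigma)
qed

lemma ballsA_eq: "real (ballsA j w) = real a + (\<Sum>i<j. addA i w * smp i w)"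
proof -
  have "(\<Sum>i=1..j. A i w * X i w) = (\<Sum>i<j. A (Suc i) w * X (Suc i) w)"
    by (rule sum.reindex_bij_witness[of _ Suc "\<lambda>i. i - 1"]) auto
  then show ?thesis by (simp add: urn_H_def)
qed

text \<open>Truncated subtraction is written as \<open>max 0\<close> of a real difference. The
  identity then holds for every outcome, not only where \<open>X \<le> N\<close>, and measurability
  with respect to \<open>Hist j\<close> involves no exceptional null set.\<close>

lemma balls_eq: "real (balls j w) = real (ballsA j w) + real b + (\<Sum>i<j. addB i w * max 0 (num i w - smp i w))"
proof -
  have "(\<Sum>i=1..j. B i w * (N i w - X i w)) = (\<Sum>i<j. B (Suc i) w * (N (Suc i) w - X (Suc i) w))"
    by (rule sum.reindex_bij_witness[of _ Suc "\<lambda>i. i - 1"]) auto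
  moreover have "real (k - l) = max 0 (real k - real l)" for k l :: nat by auto
  ultimately show ?thesis by (simp add: urn_S_def urn_K_def)
qed

lemma ballsA_Hist[measurable]: "(\<lambda>w. real (ballsA j w)) \<in> borel_measurable (Hist j)"
  unfolding ballsA_eq by (intro borel_measurable_add borel_measurable_const borel_measurable_sum borel_measurable_times
      borel_measurable_real_of_nat_valued Hist_measurable) auto

lemma balls_Hist[measurable]: "(\<lambda>w. real (balls j w)) \<in> borel_measurable (Hist j)"
  unfolding balls_eq by (intro borel_measurable_add borel_measurable_const borel_measurable_sum borel_measurable_times
      borel_measurable_max borel_measurable_diff ballsA_Hist borel_measurable_real_of_nat_valued Hist_measurable) auto

lemma prop_Hist[measurable]: "prop j \<in> borel_measurable (Hist j)"
  unfolding urn_Z_def[abs_def] by measurable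

lemma prop2_Hist[measurable]: "prop2 j \<in> borel_measurable (Hist j)"
  unfolding prop2_def[abs_def] by measurable

lemma prop_M[measurable]: "prop j \<in> borel_measurable M" by (rule measurable_G[OF prop_Hist])
lemma prop2_M[measurable]: "prop2 j \<in> borel_measurable M" by (rule measurable_G[OF prop2_Hist])
lemma balls_M[measurable]: "(\<lambda>w. real (balls j w)) \<in> borel_measurable M" by (rule measurable_G[OF balls_Hist])

lemma ballsA_ge: "1 \<le> ballsA j w" using a_ge_1 by (simp add: urn_H_def)
lemma ballsA_le: "ballsA j w \<le> balls j w" by (simp add: urn_S_def)
lemma balls_ge_2: "2 \<le> balls j w" using a_ge_1 b_ge_1 by (simp add: urn_S_def urn_H_def urn_K_def)

lemma prop_bounds: "0 \<le> prop j w" "prop j w \<le> 1"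
proof -
  have "real (ballsA j w) \<le> real (balls j w)" "0 < real (balls j w)"
    using ballsA_le[of j w] balls_ge_2[of j w] by simp_all
  then show "0 \<le> prop j w" "prop j w \<le> 1" unfolding urn_Z_def by simp_all
qed

lemma prop2_bounds: "0 \<le> prop2 j w" "prop2 j w \<le> 1"
proof -
  have h: "1 \<le> real (ballsA j w)" "real (ballsA j w) \<le> real (balls j w)" "2 \<le> real (balls j w)"
    using ballsA_ge[of j w] ballsA_le[of j w] balls_ge_2[of j w] by auto
  then show "0 \<le> prop2 j w" unfolding prop2_def by simp
  have "real (ballsA j w) * (real (ballsA j w) - 1) \<le> real (balls j w) * (real (balls j w) - 1)"
    using h by (intro mult_mono) auto
  moreover have "0 < real (balls j w) * (real (balls j w) - 1)" using h by simp
  ultimately show "prop2 j w \<le> 1" unfolding prop2_def by simp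
qed

lemma N_range: "AE w in M. 1 \<le> N (Suc j) w \<and> N (Suc j) w \<le> balls j w \<and> N (Suc j) w \<le> C"
proof -
  have "AE w in M. \<not> (1 \<le> k \<and> k \<le> balls j w) \<longrightarrow> N (Suc j) w \<noteq> k" for k
  proof -
    define D where "D = {w \<in> space M. \<not> (1 \<le> real k \<and> real k \<le> real (balls j w))}"
    have "D = {w \<in> space (Hist j). \<not> (1 \<le> real k \<and> real k \<le> real (balls j w))}" by (simp add: D_def space_G)
    also have "\<dots> \<in> sets (Hist j)" by measurable
    finally have D: "D \<in> sets (Hist j)" .
    have "AE w in M. w \<in> D \<longrightarrow> cond_mass M (Hist j) (N (Suc j)) k w = 0"
      using sample_size[of "Suc j", simplified] by eventually_elim (simp add: D_def)
    from AE_not_mass[OF fms rv(1) D this] show ?thesis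
      by (rule AE_mp) (auto simp: D_def intro!: AE_I2)
  qed
  then have "AE w in M. \<forall>k. \<not> (1 \<le> k \<and> k \<le> balls j w) \<longrightarrow> N (Suc j) w \<noteq> k"
    by (simp add: AE_all_countable)
  moreover have "AE w in M. A (Suc j) w \<le> C \<and> B (Suc j) w \<le> C \<and> N (Suc j) w \<le> C" by (rule bounded) simp
  ultimately show ?thesis by eventually_elim blast
qed

text \<open>Masses above the sample size vanish through the guard in
  \<open>hypergeometric_mass\<close>, and the event that \<open>N (Suc j)\<close> is below
  \<open>k\<close> belongs to \<open>Hist_N j\<close>, so \<open>AE_not_mass\<close>
  applies.\<close>

lemma X_range: "AE w in M. X (Suc j) w \<le> N (Suc j) w"
proof -
  have "AE w in M. N (Suc j) w < k \<longrightarrow> X (Suc j) w \<noteq> k" for k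
  proof -
    define D where "D = {w \<in> space M. num j w < real k}"
    have NN: "N (Suc j) \<in> Hist_N j \<rightarrow>\<^sub>M count_space UNIV" unfolding Hist_N_def by (rule measurable_gen_sigma) simp
    have "D = (N (Suc j)) -` {..<k} \<inter> space (Hist_N j)" by (auto simp: D_def Hist_N_def)
    also have "\<dots> \<in> sets (Hist_N j)" by (rule measurable_sets[OF NN]) simp
    finally have D: "D \<in> sets (Hist_N j)" .
    have "AE w in M. w \<in> D \<longrightarrow> cond_mass M (Hist_N j) (X (Suc j)) k w = 0"
      using sample[of "Suc j", simplified]
      by eventually_elim (simp add: D_def Hist_N_def[symmetric] hypergeometric_mass_def)
    from AE_not_mass[OF fms_N rv(2) D this] show ?thesis
      by (rule AE_mp) (auto simp: D_def intro!: AE_I2)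
  qed
  then have "AE w in M. \<forall>k. N (Suc j) w < k \<longrightarrow> X (Suc j) w \<noteq> k"
    by (simp add: AE_all_countable)
  then show ?thesis by eventually_elim (metis not_le)
qed

lemma increment_AE:
  "AE w in M. \<forall>j. 1 \<le> N (Suc j) w \<and> N (Suc j) w \<le> balls j w \<and> N (Suc j) w \<le> C \<and> X (Suc j) w \<le> N (Suc j) w
     \<and> 1 \<le> A (Suc j) w \<and> A (Suc j) w \<le> C \<and> 1 \<le> B (Suc j) w \<and> B (Suc j) w \<le> C"
proof (subst AE_all_countable, rule allI)
  fix j
  have "AE w in M. A (Suc j) w \<noteq> 0 \<and> B (Suc j) w \<noteq> 0" by (rule reinforcement_pos) simp
  moreover have "AE w in M. A (Suc j) w \<le> C \<and> B (Suc j) w \<le> C \<and> N (Suc j) w \<le> C" by (rule bounded) simp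
  ultimately show "AE w in M. 1 \<le> N (Suc j) w \<and> N (Suc j) w \<le> balls j w \<and> N (Suc j) w \<le> C \<and> X (Suc j) w \<le> N (Suc j) w
     \<and> 1 \<le> A (Suc j) w \<and> A (Suc j) w \<le> C \<and> 1 \<le> B (Suc j) w \<and> B (Suc j) w \<le> C"
    using N_range[of j] X_range[of j] by eventually_elim auto
qed

text \<open>Almost surely the four variables are at most \<open>C\<close>, so only finitely many
  values of \<open>f\<close> occur and the sum of their absolute values is a bound.\<close>

lemma integrable_draw:
  "integrable M (\<lambda>w. f (N (Suc j) w) (X (Suc j) w) (A (Suc j) w) (B (Suc j) w))"
  for f :: "nat \<Rightarrow> nat \<Rightarrow> nat \<Rightarrow> nat \<Rightarrow> real"
proof (rule integrable_const_bound)
  define B0 where "B0 = (\<Sum>(n, x, \<alpha>, \<beta>) \<in> {..C} \<times> {..C} \<times> {..C} \<times> {..C}. \<bar>f n x \<alpha> \<beta>\<bar>)"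
  show "AE w in M. norm (f (N (Suc j) w) (X (Suc j) w) (A (Suc j) w) (B (Suc j) w)) \<le> B0"
    using increment_AE
  proof eventually_elim
    case (elim w)
    let ?v = "(N (Suc j) w, X (Suc j) w, A (Suc j) w, B (Suc j) w)"
    have "?v \<in> {..C} \<times> {..C} \<times> {..C} \<times> {..C}"
      using elim[rule_format, of j] by auto
    then have "(case ?v of (n, x, \<alpha>, \<beta>) \<Rightarrow> \<bar>f n x \<alpha> \<beta>\<bar>) \<le> B0"
      unfolding B0_def by (intro member_le_sum) auto
    then show ?case by simp
  qed
  show "(\<lambda>w. f (N (Suc j) w) (X (Suc j) w) (A (Suc j) w) (B (Suc j) w)) \<in> borel_measurable M"
    by measurable
qed

end

lemma (in prob_space) indep_var_of_indep_set:
  assumes ind: "indep_set (sets F1) (sets F2)" and F: "subalgebra M F1" "subalgebra M F2"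
    and f: "f \<in> F1 \<rightarrow>\<^sub>M S" and g: "g \<in> F2 \<rightarrow>\<^sub>M T"
  shows "indep_var S f T g"
  unfolding indep_var_eq
proof (intro conjI)
  show "random_variable S f" "random_variable T g" using measurable_from_subalg F f g by auto
  have space: "space F1 = space M" "space F2 = space M" using F by (auto simp: subalgebra_def)
  have sub: "sigma_sets (space M) {h -` A \<inter> space M | A. A \<in> sets R} \<subseteq> sets F"
    if "h \<in> F \<rightarrow>\<^sub>M R" "space F = space M" for h F and R :: "'z measure"
    unfolding that(2)[symmetric] by (rule sets.sigma_sets_subset) (use measurable_sets[OF that(1)] in auto)
  show "indep_set (sigma_sets (space M) {f -` A \<inter> space M | A. A \<in> sets S})
      (sigma_sets (space M) {g -` A \<inter> space M | A. A \<in> sets T})"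
    using ind sub[OF f space(1)] sub[OF g space(2)] unfolding indep_set_def
    by (elim indep_sets_mono_sets) (auto split: bool.split)
qed

section \<open>Conditional moments of a draw\<close>

context bounded_urn
begin

lemma Hist_NX_measurable:
  "N (Suc j) \<in> Hist_NX j \<rightarrow>\<^sub>M count_space UNIV" "X (Suc j) \<in> Hist_NX j \<rightarrow>\<^sub>M count_space UNIV"
  unfolding Hist_NX_def by (rule measurable_gen_sigma; simp)+

lemma Hist_N_measurable: "N (Suc j) \<in> Hist_N j \<rightarrow>\<^sub>M count_space UNIV"
  unfolding Hist_N_def by (rule measurable_gen_sigma) simp

text \<open>For an event \<open>D\<close> of the history, \<open>indicator D * f\<close> is
  measurable with respect to \<open>Hist_NX j\<close> and so independent of the reinforcement. The
  integral over \<open>D\<close> factorises, and only the unconditional mean \<open>e\<close>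
  enters. Since \<open>\<phi>\<close> takes both reinforcements, \<open>A\<close> and
  \<open>B\<close> may be correlated.\<close>

lemma has_cond_mean_reinforcement:
  fixes \<phi> f :: "nat \<Rightarrow> nat \<Rightarrow> real"
  assumes f: "has_cond_mean j (\<lambda>w. f (N (Suc j) w) (X (Suc j) w)) r"
    and E: "(\<integral>w. \<phi> (A (Suc j) w) (B (Suc j) w) \<partial>M) = e"
  shows "has_cond_mean j (\<lambda>w. \<phi> (A (Suc j) w) (B (Suc j) w) * f (N (Suc j) w) (X (Suc j) w)) (\<lambda>w. e * r w)"
proof -
  interpret F: finite_measure_subalgebra M "Hist j" by (rule fms)
  let ?\<phi> = "\<lambda>w. \<phi> (A (Suc j) w) (B (Suc j) w)" and ?f = "\<lambda>w. f (N (Suc j) w) (X (Suc j) w)"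
  have int: "integrable M ?\<phi>" "integrable M ?f" "integrable M (\<lambda>w. ?\<phi> w * ?f w)"
    using integrable_draw[of "\<lambda>n x \<alpha> \<beta>. \<phi> \<alpha> \<beta>" j] integrable_draw[of "\<lambda>n x \<alpha> \<beta>. f n x" j]
      integrable_draw[of "\<lambda>n x \<alpha> \<beta>. \<phi> \<alpha> \<beta> * f n x" j] by auto
  have AB: "subalgebra M (gen_sigma M {A (Suc j), B (Suc j)})"
    by (rule subalgebra_gen_sigma) (auto intro: rv)
  have \<phi>_meas: "?\<phi> \<in> borel_measurable (gen_sigma M {A (Suc j), B (Suc j)})"
  proof -
    have [measurable]: "A (Suc j) \<in> gen_sigma M {A (Suc j), B (Suc j)} \<rightarrow>\<^sub>M count_space UNIV"
      "B (Suc j) \<in> gen_sigma M {A (Suc j), B (Suc j)} \<rightarrow>\<^sub>M count_space UNIV"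
      by (rule measurable_gen_sigma; simp)+
    show ?thesis by measurable
  qed
  have "AE w in M. cexp j (\<lambda>w. ?\<phi> w * ?f w) w = e * cexp j ?f w"
  proof (rule F.real_cond_exp_charact[OF _ int(3)])
    show "integrable M (\<lambda>w. e * cexp j ?f w)"
      using F.real_cond_exp_int(1)[OF int(2)] by simp
    fix D assume D: "D \<in> sets (Hist j)"
    have DM[measurable]: "D \<in> sets M" using D subalgebra[of j] by (auto simp: subalgebra_def)
    have [measurable]: "N (Suc j) \<in> Hist_NX j \<rightarrow>\<^sub>M count_space UNIV" "X (Suc j) \<in> Hist_NX j \<rightarrow>\<^sub>M count_space UNIV"
      "D \<in> sets (Hist_NX j)"
      using Hist_NX_measurable D subalgebra_Hist_NX(2)[of j] by (auto simp: subalgebra_def)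
    have g: "(\<lambda>w. indicator D w * ?f w) \<in> borel_measurable (Hist_NX j)" by measurable
    have "indep_set (sets (gen_sigma M {A (Suc j), B (Suc j)})) (sets (Hist_NX j))"
      using reinforcement_indep[of "Suc j"] by (simp add: Hist_NX_def)
    from indep_var_of_indep_set[OF this AB subalgebra_Hist_NX(1) \<phi>_meas g]
    have ind: "indep_var borel ?\<phi> borel (\<lambda>w. indicator D w * ?f w)" .
    have Df: "integrable M (\<lambda>w. indicator D w * ?f w)"
      using integrable_mult_indicator[OF DM int(2)] by simp
    have "(\<integral>w. ?\<phi> w * (indicator D w * ?f w) \<partial>M) = e * (\<integral>w. indicator D w * ?f w \<partial>M)"
      using indep_var_lebesgue_integral[OF ind int(1) Df] E by simp
    also have "(\<integral>w. indicator D w * ?f w \<partial>M) = (\<integral>w. indicator D w * cexp j ?f w \<partial>M)"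
      using F.real_cond_exp_intA[OF int(2) D] by (simp add: set_lebesgue_integral_def)
    finally show "(\<integral>w\<in>D. ?\<phi> w * ?f w \<partial>M) = (\<integral>w\<in>D. e * cexp j ?f w \<partial>M)"
      by (simp add: set_lebesgue_integral_def mult_ac)
  qed simp
  then have "AE w in M. cexp j (\<lambda>w. ?\<phi> w * ?f w) w = e * r w"
    using has_cond_mean_AE[OF f] by eventually_elim simp
  then show ?thesis using int(3) by (simp add: has_cond_mean_def)
qed

text \<open>The sample count is bounded by \<open>C\<close>, so \<open>f (X (Suc j))\<close> is a
  finite combination of indicators whose conditional expectations are the hypergeometric masses.
  Masses beyond the sample size vanish, which trades the range \<open>C\<close> for the random range
  \<open>N (Suc j) w\<close>.\<close>

lemma cond_exp_draw_given_size:
  "AE w in M. real_cond_exp M (Hist_N j) (\<lambda>w. f (X (Suc j) w)) w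
     = (\<Sum>k\<le>N (Suc j) w. f k * hypergeometric_mass (N (Suc j) w) (balls j w) (ballsA j w) k)"
  for f :: "nat \<Rightarrow> real"
proof -
  interpret F: finite_measure_subalgebra M "Hist_N j" by (rule fms_N)
  define I where "I k = (indicator (X (Suc j) -` {k} \<inter> space M) :: 'w \<Rightarrow> real)" for k
  have [measurable]: "I k \<in> borel_measurable M" for k
    unfolding I_def by (intro borel_measurable_indicator measurable_sets[OF rv(2)]) simp
  have int: "integrable M (I k)" for k
  proof (rule integrable_const_bound[where B=1])
    show "AE w in M. norm (I k w) \<le> 1" by (simp add: I_def indicator_def)
  qed simp
  have "AE w in M. f (X (Suc j) w) = (\<Sum>k\<le>C. f k * I k w)"
  proof -
    have "AE w in M. w \<in> space M" by simp
    then show ?thesis using increment_AE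
    proof eventually_elim
      case (elim w)
      have "X (Suc j) w \<le> C" using elim(2) order_trans by blast
      then have "(\<Sum>k\<le>C. if k = X (Suc j) w then f k else 0) = f (X (Suc j) w)" by simp
      moreover have "f k * I k w = (if k = X (Suc j) w then f k else 0)" for k
        using elim(1) by (auto simp: I_def indicator_def)
      ultimately show ?case by simp
    qed
  qed
  then have "AE w in M. real_cond_exp M (Hist_N j) (\<lambda>w. f (X (Suc j) w)) w
      = real_cond_exp M (Hist_N j) (\<lambda>w. \<Sum>k\<le>C. f k * I k w) w"
    by (rule F.real_cond_exp_cong) measurable
  moreover have "AE w in M. real_cond_exp M (Hist_N j) (\<lambda>w. \<Sum>k\<le>C. f k * I k w) w
      = (\<Sum>k\<le>C. real_cond_exp M (Hist_N j) (\<lambda>w. f k * I k w) w)"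
    by (rule F.real_cond_exp_sum) (use int in simp)
  moreover have "AE w in M. \<forall>k. real_cond_exp M (Hist_N j) (\<lambda>w. f k * I k w) w = f k * real_cond_exp M (Hist_N j) (I k) w"
    unfolding AE_all_countable using F.real_cond_exp_cmult[OF int] by blast
  moreover have "AE w in M. \<forall>k. real_cond_exp M (Hist_N j) (I k) w
      = hypergeometric_mass (N (Suc j) w) (balls j w) (ballsA j w) k"
    using sample[of "Suc j"] by (simp add: cond_mass_def I_def Hist_N_def)
  ultimately show ?thesis using increment_AE
  proof eventually_elim
    case (elim w)
    have "N (Suc j) w \<le> C" using elim(5) by blast
    then have "(\<Sum>k\<le>N (Suc j) w. f k * hypergeometric_mass (N (Suc j) w) (balls j w) (ballsA j w) k)
       = (\<Sum>k\<le>C. f k * hypergeometric_mass (N (Suc j) w) (balls j w) (ballsA j w) k)"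
      by (intro sum.mono_neutral_left) (auto simp: hypergeometric_mass_def)
    then show ?case using elim by simp
  qed
qed

lemma has_cond_mean_tower:
  assumes f: "integrable M f" and g: "AE w in M. real_cond_exp M (Hist_N j) f w = g w"
    and gr: "has_cond_mean j g r"
  shows "has_cond_mean j f r"
proof -
  interpret F: finite_measure_subalgebra M "Hist j" by (rule fms)
  have gM: "g \<in> borel_measurable M" using gr by (auto simp: has_cond_mean_def)
  have "AE w in M. cexp j (real_cond_exp M (Hist_N j) f) w = cexp j f w"
    by (rule F.real_cond_exp_nested_subalg[OF subalgebra_Hist_N f])
  moreover have "AE w in M. cexp j (real_cond_exp M (Hist_N j) f) w = cexp j g w"
    by (rule F.real_cond_exp_cong[OF g _ gM]) simp
  ultimately have "AE w in M. cexp j f w = r w"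
    using has_cond_mean_AE[OF gr] by eventually_elim simp
  then show ?thesis using f by (simp add: has_cond_mean_def)
qed

abbreviation "cond_size j \<psi> \<equiv> cexp j (\<lambda>w. \<psi> (N (Suc j) w) :: real)"

lemma cond_size: "has_cond_mean j (\<lambda>w. \<psi> (N (Suc j) w)) (cond_size j \<psi>)"
  using integrable_draw[of "\<lambda>n x \<alpha> \<beta>. \<psi> n" j] by (intro has_cond_meanI) simp

lemma prop_le[simp]: "AE w in M. \<bar>prop j w\<bar> \<le> 1" "AE w in M. \<bar>prop2 j w\<bar> \<le> 1"
  using prop_bounds prop2_bounds by (auto intro!: AE_I2)

text \<open>Conditioning in two stages: given \<open>Hist_N\<close> the weight \<open>\<psi>\<close>
  of the sample size comes out and the hypergeometric moments remain; given \<open>Hist\<close> then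
  \<open>prop\<close> and \<open>prop2\<close> come out. The weights needed later are 1, the sample
  size, its inverse and its inverse square.\<close>

lemma has_cond_mean_draw:
  fixes \<psi> :: "nat \<Rightarrow> real"
  shows "has_cond_mean j (\<lambda>w. \<psi> (N (Suc j) w) * smp j w)
     (\<lambda>w. prop j w * cond_size j (\<lambda>n. \<psi> n * real n) w)"
    and "has_cond_mean j (\<lambda>w. \<psi> (N (Suc j) w) * (smp j w)\<^sup>2)
     (\<lambda>w. prop j w * cond_size j (\<lambda>n. \<psi> n * real n) w + prop2 j w * cond_size j (\<lambda>n. \<psi> n * (real n * (real n - 1))) w)"
proof -
  interpret F: finite_measure_subalgebra M "Hist_N j" by (rule fms_N)
  have \<psi>: "(\<lambda>w. \<psi> (N (Suc j) w)) \<in> borel_measurable (Hist_N j)"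
    by (rule measurable_compose[OF Hist_N_measurable]) simp
  have pull: "AE w in M. real_cond_exp M (Hist_N j) (\<lambda>w. \<psi> (N (Suc j) w) * f (X (Suc j) w)) w
     = \<psi> (N (Suc j) w) * (\<Sum>k\<le>N (Suc j) w. f k * hypergeometric_mass (N (Suc j) w) (balls j w) (ballsA j w) k)" for f :: "nat \<Rightarrow> real"
  proof -
    have "AE w in M. real_cond_exp M (Hist_N j) (\<lambda>w. \<psi> (N (Suc j) w) * f (X (Suc j) w)) w
      = \<psi> (N (Suc j) w) * real_cond_exp M (Hist_N j) (\<lambda>w. f (X (Suc j) w)) w"
      by (rule F.real_cond_exp_mult[OF \<psi>])
        (use integrable_draw[of "\<lambda>n x \<alpha> \<beta>. \<psi> n * f x" j] in auto)
    then show ?thesis using cond_exp_draw_given_size[of j f] by eventually_elim simp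
  qed
  have size: "1 \<le> n \<and> n \<le> balls j w \<Longrightarrow> (\<Sum>k\<le>n. real k * hypergeometric_mass n (balls j w) (ballsA j w) k) = real n * prop j w"
    and size2: "1 \<le> n \<and> n \<le> balls j w \<Longrightarrow> (\<Sum>k\<le>n. (real k)\<^sup>2 * hypergeometric_mass n (balls j w) (ballsA j w) k)
       = real n * prop j w + real n * (real n - 1) * prop2 j w" for n w
  proof -
    assume n: "1 \<le> n \<and> n \<le> balls j w"
    show m1: "(\<Sum>k\<le>n. real k * hypergeometric_mass n (balls j w) (ballsA j w) k) = real n * prop j w"
      using hypergeometric_mean[OF ballsA_ge ballsA_le, of n j w] n by (simp add: urn_Z_def)
    have "(real k)\<^sup>2 = real k * (real k - 1) + real k" for k by (simp add: power2_eq_square algebra_simps)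
    then have "(\<Sum>k\<le>n. (real k)\<^sup>2 * hypergeometric_mass n (balls j w) (ballsA j w) k)
       = (\<Sum>k\<le>n. real k * (real k - 1) * hypergeometric_mass n (balls j w) (ballsA j w) k)
         + (\<Sum>k\<le>n. real k * hypergeometric_mass n (balls j w) (ballsA j w) k)"
      by (simp only: distrib_right sum.distrib)
    then show "(\<Sum>k\<le>n. (real k)\<^sup>2 * hypergeometric_mass n (balls j w) (ballsA j w) k)
       = real n * prop j w + real n * (real n - 1) * prop2 j w"
      using hypergeometric_factorial_moment[OF ballsA_ge ballsA_le _ _ balls_ge_2, of n j w] n m1
      by (simp add: prop2_def)
  qed
  have c1: "has_cond_mean j (\<lambda>w. prop j w * (\<psi> (N (Suc j) w) * num j w)) (\<lambda>w. prop j w * cond_size j (\<lambda>n. \<psi> n * real n) w)"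
    by (rule has_cond_mean_mult[OF prop_Hist prop_le(1) cond_size])
  have c2: "has_cond_mean j (\<lambda>w. prop2 j w * (\<psi> (N (Suc j) w) * (num j w * (num j w - 1))))
      (\<lambda>w. prop2 j w * cond_size j (\<lambda>n. \<psi> n * (real n * (real n - 1))) w)"
    by (rule has_cond_mean_mult[OF prop2_Hist prop_le(2) cond_size])
  show "has_cond_mean j (\<lambda>w. \<psi> (N (Suc j) w) * smp j w)
     (\<lambda>w. prop j w * cond_size j (\<lambda>n. \<psi> n * real n) w)"
  proof (rule has_cond_mean_tower[OF _ _ c1])
    show "integrable M (\<lambda>w. \<psi> (N (Suc j) w) * smp j w)"
      using integrable_draw[of "\<lambda>n x \<alpha> \<beta>. \<psi> n * real x" j] by simp
    show "AE w in M. real_cond_exp M (Hist_N j) (\<lambda>w. \<psi> (N (Suc j) w) * smp j w) w = prop j w * (\<psi> (N (Suc j) w) * num j w)"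
      using pull[of real] N_range[of j] by eventually_elim (simp add: size mult_ac)
  qed
  show "has_cond_mean j (\<lambda>w. \<psi> (N (Suc j) w) * (smp j w)\<^sup>2)
     (\<lambda>w. prop j w * cond_size j (\<lambda>n. \<psi> n * real n) w + prop2 j w * cond_size j (\<lambda>n. \<psi> n * (real n * (real n - 1))) w)"
  proof (rule has_cond_mean_tower[OF _ _ has_cond_mean_add[OF c1 c2]])
    show "integrable M (\<lambda>w. \<psi> (N (Suc j) w) * (smp j w)\<^sup>2)"
      using integrable_draw[of "\<lambda>n x \<alpha> \<beta>. \<psi> n * (real x)\<^sup>2" j] by simp
    show "AE w in M. real_cond_exp M (Hist_N j) (\<lambda>w. \<psi> (N (Suc j) w) * (smp j w)\<^sup>2) w
       = prop j w * (\<psi> (N (Suc j) w) * num j w) + prop2 j w * (\<psi> (N (Suc j) w) * (num j w * (num j w - 1)))"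
      using pull[of "\<lambda>x. (real x)\<^sup>2"] N_range[of j] by eventually_elim (simp add: size2 algebra_simps)
  qed
qed

abbreviation "N_mean j \<equiv> cexp j (\<lambda>w. num j w)"
abbreviation "N_sq_mean j \<equiv> cexp j (\<lambda>w. (num j w)\<^sup>2)"
abbreviation "N_inv_mean j \<equiv> cexp j (\<lambda>w. inverse (num j w))"
text \<open>The conditional second moment of the sample count, split into its mean and its second
  factorial moment.\<close>

definition "draw2 j w = prop j w * N_mean j w + prop2 j w * (N_sq_mean j w - N_mean j w)"

text \<open>Sample sizes are almost surely at least 1, so cancellations such as
  \<open>inverse (real n) * real n = 1\<close>, which fail at 0, may be used under the conditional
  expectation.\<close>

lemma cond_size_eq:
  assumes "\<And>n. 1 \<le> n \<Longrightarrow> \<psi> n = \<phi> n"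
  shows "AE w in M. cond_size j \<psi> w = cond_size j \<phi> w"
proof -
  interpret F: finite_measure_subalgebra M "Hist j" by (rule fms)
  show ?thesis using N_range[of j] by (intro F.real_cond_exp_cong) (auto elim!: eventually_mono simp: assms)
qed

lemma cond_size_linear:
  "AE w in M. cond_size j (\<lambda>n. real n * (real n - 1)) w = N_sq_mean j w - N_mean j w"
  "AE w in M. cond_size j (\<lambda>n. inverse (real n) * real n) w = 1"
  "AE w in M. cond_size j (\<lambda>n. inverse (real n) * (real n * (real n - 1))) w = N_mean j w - 1"
  "AE w in M. cond_size j (\<lambda>n. (inverse (real n))\<^sup>2 * real n) w = N_inv_mean j w"
  "AE w in M. cond_size j (\<lambda>n. (inverse (real n))\<^sup>2 * (real n * (real n - 1))) w = 1 - N_inv_mean j w"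
proof -
  interpret F: finite_measure_subalgebra M "Hist j" by (rule fms)
  have one: "has_cond_mean j (\<lambda>w. 1) (\<lambda>w. 1)" by (rule has_cond_mean_adapted[where B=1]) auto
  have n1: "has_cond_mean j (\<lambda>w. num j w) (N_mean j)" by (rule cond_size)
  have n2: "has_cond_mean j (\<lambda>w. (num j w)\<^sup>2) (N_sq_mean j)" by (rule cond_size)
  have ni: "has_cond_mean j (\<lambda>w. inverse (num j w)) (N_inv_mean j)" by (rule cond_size)
  show "AE w in M. cond_size j (\<lambda>n. real n * (real n - 1)) w = N_sq_mean j w - N_mean j w"
    using has_cond_mean_AE[OF has_cond_mean_diff[OF n2 n1]] by (simp add: power2_eq_square algebra_simps)
  show "AE w in M. cond_size j (\<lambda>n. inverse (real n) * real n) w = 1"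
  proof -
    have "AE w in M. cond_size j (\<lambda>n. inverse (real n) * real n) w = cond_size j (\<lambda>n. 1) w"
      by (rule cond_size_eq) simp
    then show ?thesis using has_cond_mean_AE[OF one] by eventually_elim simp
  qed
  show "AE w in M. cond_size j (\<lambda>n. inverse (real n) * (real n * (real n - 1))) w = N_mean j w - 1"
  proof -
    have "AE w in M. cond_size j (\<lambda>n. inverse (real n) * (real n * (real n - 1))) w = cond_size j (\<lambda>n. real n - 1) w"
      by (rule cond_size_eq) simp
    then show ?thesis using has_cond_mean_AE[OF has_cond_mean_diff[OF n1 one]] by eventually_elim simp
  qed
  show "AE w in M. cond_size j (\<lambda>n. (inverse (real n))\<^sup>2 * real n) w = N_inv_mean j w"
    by (rule cond_size_eq) (simp add: power2_eq_square field_simps)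
  show "AE w in M. cond_size j (\<lambda>n. (inverse (real n))\<^sup>2 * (real n * (real n - 1))) w = 1 - N_inv_mean j w"
  proof -
    have "AE w in M. cond_size j (\<lambda>n. (inverse (real n))\<^sup>2 * (real n * (real n - 1))) w = cond_size j (\<lambda>n. 1 - inverse (real n)) w"
      by (rule cond_size_eq) (simp add: power2_eq_square field_simps)
    then show ?thesis using has_cond_mean_AE[OF has_cond_mean_diff[OF one ni]] by eventually_elim simp
  qed
qed

lemma draw_moments:
  "has_cond_mean j (\<lambda>w. smp j w) (\<lambda>w. prop j w * N_mean j w)"
  "has_cond_mean j (\<lambda>w. num j w * smp j w) (\<lambda>w. prop j w * N_sq_mean j w)"
  "has_cond_mean j (\<lambda>w. (smp j w)\<^sup>2) (draw2 j)"
  "has_cond_mean j (\<lambda>w. inverse (num j w) * smp j w) (prop j)"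
  "has_cond_mean j (\<lambda>w. inverse (num j w) * (smp j w)\<^sup>2) (\<lambda>w. prop j w + prop2 j w * (N_mean j w - 1))"
  "has_cond_mean j (\<lambda>w. (inverse (num j w))\<^sup>2 * (smp j w)\<^sup>2)
     (\<lambda>w. prop j w * N_inv_mean j w + prop2 j w * (1 - N_inv_mean j w))"
proof -
  show "has_cond_mean j (\<lambda>w. smp j w) (\<lambda>w. prop j w * N_mean j w)"
    using has_cond_mean_draw(1)[of j "\<lambda>n. 1"] by simp
  show "has_cond_mean j (\<lambda>w. num j w * smp j w) (\<lambda>w. prop j w * N_sq_mean j w)"
    using has_cond_mean_draw(1)[of j real] by (simp add: power2_eq_square)
  show "has_cond_mean j (\<lambda>w. (smp j w)\<^sup>2) (draw2 j)"
  proof (rule has_cond_mean_cong[OF has_cond_mean_draw(2)[of j "\<lambda>n. 1"]])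
    show "AE w in M. prop j w * cond_size j (\<lambda>n. 1 * real n) w + prop2 j w * cond_size j (\<lambda>n. 1 * (real n * (real n - 1))) w = draw2 j w"
      using cond_size_linear(1)[of j] by eventually_elim (simp add: draw2_def)
  qed auto
  show "has_cond_mean j (\<lambda>w. inverse (num j w) * smp j w) (prop j)"
  proof (rule has_cond_mean_cong[OF has_cond_mean_draw(1)[of j "\<lambda>n. inverse (real n)"]])
    show "AE w in M. prop j w * cond_size j (\<lambda>n. inverse (real n) * real n) w = prop j w"
      using cond_size_linear(2)[of j] by eventually_elim simp
  qed auto
  show "has_cond_mean j (\<lambda>w. inverse (num j w) * (smp j w)\<^sup>2) (\<lambda>w. prop j w + prop2 j w * (N_mean j w - 1))"
  proof (rule has_cond_mean_cong[OF has_cond_mean_draw(2)[of j "\<lambda>n. inverse (real n)"]])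
    show "AE w in M. prop j w * cond_size j (\<lambda>n. inverse (real n) * real n) w
      + prop2 j w * cond_size j (\<lambda>n. inverse (real n) * (real n * (real n - 1))) w = prop j w + prop2 j w * (N_mean j w - 1)"
      using cond_size_linear(2)[of j] cond_size_linear(3)[of j] by eventually_elim simp
  qed auto
  show "has_cond_mean j (\<lambda>w. (inverse (num j w))\<^sup>2 * (smp j w)\<^sup>2)
     (\<lambda>w. prop j w * N_inv_mean j w + prop2 j w * (1 - N_inv_mean j w))"
  proof (rule has_cond_mean_cong[OF has_cond_mean_draw(2)[of j "\<lambda>n. (inverse (real n))\<^sup>2"]])
    show "AE w in M. prop j w * cond_size j (\<lambda>n. (inverse (real n))\<^sup>2 * real n) w
      + prop2 j w * cond_size j (\<lambda>n. (inverse (real n))\<^sup>2 * (real n * (real n - 1))) w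
      = prop j w * N_inv_mean j w + prop2 j w * (1 - N_inv_mean j w)"
      using cond_size_linear(4)[of j] cond_size_linear(5)[of j] by eventually_elim simp
  qed auto
qed

end

section \<open>Increments of the proportion\<close>

locale balanced_urn = bounded_urn M a b N X A B C
  for M :: "'w measure" and a b and N X A B :: "nat \<Rightarrow> 'w \<Rightarrow> nat" and C +
  fixes \<mu> :: "nat \<Rightarrow> real"
  assumes mean_A: "\<And>n. n \<ge> 1 \<Longrightarrow> (\<integral>w. real (A n w) \<partial>M) = \<mu> n"
    and mean_B: "\<And>n. n \<ge> 1 \<Longrightarrow> (\<integral>w. real (B n w) \<partial>M) = \<mu> n"
begin

definition "qA j = (\<integral>w. (addA j w)\<^sup>2 \<partial>M)"
definition "qB j = (\<integral>w. (addB j w)\<^sup>2 \<partial>M)"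
definition "qAB j = (\<integral>w. addA j w * addB j w \<partial>M)"

text \<open>
  Up to a correction of second order in the inverse number of balls, the proportion moves by
  \<open>drift j = noise j / balls j\<close>, which is conditionally centred. The variable \<open>fluct j\<close> is the
  corresponding increment of \<open>n (M\<^sub>n - Z\<^sub>n)\<close>.
\<close>

definition "noise j w = (1 - prop j w) * (addA j w * smp j w) - prop j w * (addB j w * (num j w - smp j w))"
definition "drift j w = noise j w / real (balls j w)"
definition "fluct j w = (inverse (num j w) * smp j w - prop j w) - real (Suc j) * drift j w"

definition "noise_var j w = (1 - prop j w)\<^sup>2 * (qA j * draw2 j w)
  + (prop j w)\<^sup>2 * (qB j * (N_sq_mean j w - 2 * (prop j w * N_sq_mean j w) + draw2 j w))
  - (2 * (prop j w * (1 - prop j w))) * (qAB j * (prop j w * N_sq_mean j w - draw2 j w))"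
definition "frac_var j w = prop j w * N_inv_mean j w + prop2 j w * (1 - N_inv_mean j w) - (prop j w)\<^sup>2"
definition "frac_noise_cov j w = \<mu> (Suc j) * (prop j w + prop2 j w * (N_mean j w - 1) - (prop j w)\<^sup>2 * N_mean j w)"

definition "drift_var j w = noise_var j w / (real (balls j w))\<^sup>2"
definition "fluct_var j w = frac_var j w - 2 * (real (Suc j) / real (balls j w)) * frac_noise_cov j w
        + (real (Suc j) / real (balls j w))\<^sup>2 * noise_var j w"

lemma noise_M[measurable]: "noise j \<in> borel_measurable M"
proof -
  have [measurable]: "(\<lambda>w. addA j w * smp j w) \<in> borel_measurable M" "(\<lambda>w. addB j w * (num j w - smp j w)) \<in> borel_measurable M"
    by measurable
  show ?thesis unfolding noise_def[abs_def] by measurable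
qed

lemma noise_Hist: "noise j \<in> borel_measurable (Hist (Suc j))"
proof -
  have [measurable]: "prop j \<in> borel_measurable (Hist (Suc j))" by (rule measurable_G_mono[OF prop_Hist]) simp
  have [measurable]: "N (Suc j) \<in> Hist (Suc j) \<rightarrow>\<^sub>M count_space UNIV" "X (Suc j) \<in> Hist (Suc j) \<rightarrow>\<^sub>M count_space UNIV"
    "A (Suc j) \<in> Hist (Suc j) \<rightarrow>\<^sub>M count_space UNIV" "B (Suc j) \<in> Hist (Suc j) \<rightarrow>\<^sub>M count_space UNIV"
    using Hist_measurable[of j "Suc j"] by auto
  have [measurable]: "(\<lambda>w. addA j w * smp j w) \<in> borel_measurable (Hist (Suc j))"
    "(\<lambda>w. addB j w * (num j w - smp j w)) \<in> borel_measurable (Hist (Suc j))"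
    by measurable
  show ?thesis unfolding noise_def[abs_def] by measurable
qed

lemma drift_Hist: "drift j \<in> borel_measurable (Hist (Suc j))"
proof -
  have [measurable]: "(\<lambda>w. real (balls j w)) \<in> borel_measurable (Hist (Suc j))"
    by (rule measurable_G_mono[OF balls_Hist]) simp
  show ?thesis unfolding drift_def[abs_def] using noise_Hist[of j] by measurable
qed

lemma fluct_Hist: "fluct j \<in> borel_measurable (Hist (Suc j))"
proof -
  have [measurable]: "prop j \<in> borel_measurable (Hist (Suc j))" by (rule measurable_G_mono[OF prop_Hist]) simp
  have [measurable]: "N (Suc j) \<in> Hist (Suc j) \<rightarrow>\<^sub>M count_space UNIV" "X (Suc j) \<in> Hist (Suc j) \<rightarrow>\<^sub>M count_space UNIV"
    using Hist_measurable[of j "Suc j"] by auto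
  have [measurable]: "(\<lambda>w. inverse (num j w) * smp j w) \<in> borel_measurable (Hist (Suc j))"
    by measurable
  show ?thesis unfolding fluct_def[abs_def] using drift_Hist[of j] by measurable
qed

lemma drift_M[measurable]: "drift j \<in> borel_measurable M" by (rule measurable_G[OF drift_Hist])
lemma fluct_M[measurable]: "fluct j \<in> borel_measurable M" by (rule measurable_G[OF fluct_Hist])

lemma has_cond_mean_coeff:
  assumes "c \<in> borel_measurable (Hist j)" "\<And>w. \<bar>c w\<bar> \<le> K" "has_cond_mean j f g"
  shows "has_cond_mean j (\<lambda>x. c x * f x) (\<lambda>x. c x * g x)"
  by (rule has_cond_mean_mult[OF assms(1) _ assms(3), of K]) (simp add: assms(2))

lemma prop_coeff:
  assumes f: "has_cond_mean j f g"
  shows "has_cond_mean j (\<lambda>x. prop j x * f x) (\<lambda>x. prop j x * g x)"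
    and "has_cond_mean j (\<lambda>x. (1 - prop j x) * f x) (\<lambda>x. (1 - prop j x) * g x)"
    and "has_cond_mean j (\<lambda>x. (prop j x)\<^sup>2 * f x) (\<lambda>x. (prop j x)\<^sup>2 * g x)"
    and "has_cond_mean j (\<lambda>x. (1 - prop j x)\<^sup>2 * f x) (\<lambda>x. (1 - prop j x)\<^sup>2 * g x)"
    and "has_cond_mean j (\<lambda>x. (prop j x * (1 - prop j x)) * f x) (\<lambda>x. (prop j x * (1 - prop j x)) * g x)"
proof -
  have p: "\<bar>prop j x\<bar> \<le> 1" "\<bar>1 - prop j x\<bar> \<le> 1" for x using prop_bounds[of j x] by auto
  have p1: "has_cond_mean j (\<lambda>x. prop j x * f x) (\<lambda>x. prop j x * g x)" if "has_cond_mean j f g" for f g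
    by (rule has_cond_mean_coeff[OF _ p(1) that]) measurable
  have p2: "has_cond_mean j (\<lambda>x. (1 - prop j x) * f x) (\<lambda>x. (1 - prop j x) * g x)" if "has_cond_mean j f g" for f g
    by (rule has_cond_mean_coeff[OF _ p(2) that]) measurable
  show "has_cond_mean j (\<lambda>x. (prop j x)\<^sup>2 * f x) (\<lambda>x. (prop j x)\<^sup>2 * g x)"
    using p1[OF p1[OF f]] by (simp add: power2_eq_square mult.assoc)
  show "has_cond_mean j (\<lambda>x. (1 - prop j x)\<^sup>2 * f x) (\<lambda>x. (1 - prop j x)\<^sup>2 * g x)"
    using p2[OF p2[OF f]] by (simp add: power2_eq_square mult.assoc)
  show "has_cond_mean j (\<lambda>x. (prop j x * (1 - prop j x)) * f x) (\<lambda>x. (prop j x * (1 - prop j x)) * g x)"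
    using p1[OF p2[OF f]] by (simp add: mult.assoc)
  show "has_cond_mean j (\<lambda>x. prop j x * f x) (\<lambda>x. prop j x * g x)"
    and "has_cond_mean j (\<lambda>x. (1 - prop j x) * f x) (\<lambda>x. (1 - prop j x) * g x)"
    by (rule p1[OF f], rule p2[OF f])
qed

lemma complement_moments:
  "has_cond_mean j (\<lambda>w. num j w - smp j w) (\<lambda>w. N_mean j w - prop j w * N_mean j w)"
  "has_cond_mean j (\<lambda>w. (num j w - smp j w)\<^sup>2) (\<lambda>w. N_sq_mean j w - 2 * (prop j w * N_sq_mean j w) + draw2 j w)"
  "has_cond_mean j (\<lambda>w. smp j w * (num j w - smp j w)) (\<lambda>w. prop j w * N_sq_mean j w - draw2 j w)"
  "has_cond_mean j (\<lambda>w. inverse (num j w) * smp j w * (num j w - smp j w))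
     (\<lambda>w. prop j w * N_mean j w - (prop j w + prop2 j w * (N_mean j w - 1)))"
proof -
  show "has_cond_mean j (\<lambda>w. num j w - smp j w) (\<lambda>w. N_mean j w - prop j w * N_mean j w)"
    by (intro has_cond_mean_diff draw_moments cond_size)
  show "has_cond_mean j (\<lambda>w. (num j w - smp j w)\<^sup>2) (\<lambda>w. N_sq_mean j w - 2 * (prop j w * N_sq_mean j w) + draw2 j w)"
    using has_cond_mean_add[OF has_cond_mean_diff[OF cond_size[of j "\<lambda>n. (real n)\<^sup>2"] has_cond_mean_cmult[OF draw_moments(2)[of j], of 2]] draw_moments(3)[of j]]
    by (simp add: power2_diff algebra_simps)
  show "has_cond_mean j (\<lambda>w. smp j w * (num j w - smp j w)) (\<lambda>w. prop j w * N_sq_mean j w - draw2 j w)"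
    using has_cond_mean_diff[OF draw_moments(2,3)[of j]] by (simp add: power2_eq_square algebra_simps)
  show "has_cond_mean j (\<lambda>w. inverse (num j w) * smp j w * (num j w - smp j w))
     (\<lambda>w. prop j w * N_mean j w - (prop j w + prop2 j w * (N_mean j w - 1)))"
  proof (rule has_cond_mean_cong[OF has_cond_mean_diff[OF draw_moments(1)[of j] draw_moments(5)[of j]]])
    show "AE w in M. smp j w - inverse (num j w) * (smp j w)\<^sup>2 = inverse (num j w) * smp j w * (num j w - smp j w)"
      using N_range[of j] by eventually_elim (simp add: power2_eq_square field_simps)
    show "(\<lambda>w. inverse (num j w) * smp j w * (num j w - smp j w)) \<in> borel_measurable M" by measurable
  qed simp
qed

lemmas reinforced = has_cond_mean_reinforcement

lemma reinforced_moments: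
  "has_cond_mean j (\<lambda>w. addA j w * smp j w) (\<lambda>w. \<mu> (Suc j) * (prop j w * N_mean j w))"
  "has_cond_mean j (\<lambda>w. addB j w * (num j w - smp j w)) (\<lambda>w. \<mu> (Suc j) * (N_mean j w - prop j w * N_mean j w))"
  using reinforced[of j "\<lambda>n x. real x" _ "\<lambda>\<alpha> \<beta>. real \<alpha>", OF draw_moments(1) mean_A]
    reinforced[of j "\<lambda>n x. real n - real x" _ "\<lambda>\<alpha> \<beta>. real \<beta>", OF complement_moments(1) mean_B] by simp_all

text \<open>Both reinforcements have the same mean \<open>\<mu> (Suc j)\<close>, so the expected
  gains of the two colors, weighted by the opposite proportions, are equal and cancel.\<close>

lemma noise_mean: "has_cond_mean j (noise j) (\<lambda>w. 0)"
proof -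
  have "has_cond_mean j (noise j)
     (\<lambda>w. (1 - prop j w) * (\<mu> (Suc j) * (prop j w * N_mean j w)) - prop j w * (\<mu> (Suc j) * (N_mean j w - prop j w * N_mean j w)))"
    unfolding noise_def[abs_def] by (intro has_cond_mean_diff prop_coeff reinforced_moments)
  then show ?thesis by (simp add: algebra_simps)
qed

text \<open>After expanding the square, independence lets the reinforcement enter only through
  \<open>qA\<close>, \<open>qB\<close> and \<open>qAB\<close>, while the sample contributes its
  explicit second moments.\<close>

lemma noise_square_mean: "has_cond_mean j (\<lambda>w. (noise j w)\<^sup>2) (noise_var j)"
proof -
  have 1: "has_cond_mean j (\<lambda>w. (addA j w)\<^sup>2 * (smp j w)\<^sup>2) (\<lambda>w. qA j * draw2 j w)"
    using reinforced[of j "\<lambda>n x. (real x)\<^sup>2" _ "\<lambda>\<alpha> \<beta>. (real \<alpha>)\<^sup>2", OF draw_moments(3) refl] by (simp add: qA_def)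
  have 2: "has_cond_mean j (\<lambda>w. (addB j w)\<^sup>2 * (num j w - smp j w)\<^sup>2)
     (\<lambda>w. qB j * (N_sq_mean j w - 2 * (prop j w * N_sq_mean j w) + draw2 j w))"
    using reinforced[of j "\<lambda>n x. (real n - real x)\<^sup>2" _ "\<lambda>\<alpha> \<beta>. (real \<beta>)\<^sup>2", OF complement_moments(2) refl] by (simp add: qB_def)
  have 3: "has_cond_mean j (\<lambda>w. (addA j w * addB j w) * (smp j w * (num j w - smp j w)))
     (\<lambda>w. qAB j * (prop j w * N_sq_mean j w - draw2 j w))"
    using reinforced[of j "\<lambda>n x. real x * (real n - real x)" _ "\<lambda>\<alpha> \<beta>. real \<alpha> * real \<beta>", OF complement_moments(3) refl] by (simp add: qAB_def)
  have "has_cond_mean j (\<lambda>w. (1 - prop j w)\<^sup>2 * ((addA j w)\<^sup>2 * (smp j w)\<^sup>2)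
      + (prop j w)\<^sup>2 * ((addB j w)\<^sup>2 * (num j w - smp j w)\<^sup>2)
      - 2 * ((prop j w * (1 - prop j w)) * ((addA j w * addB j w) * (smp j w * (num j w - smp j w)))))
      (\<lambda>w. (1 - prop j w)\<^sup>2 * (qA j * draw2 j w)
      + (prop j w)\<^sup>2 * (qB j * (N_sq_mean j w - 2 * (prop j w * N_sq_mean j w) + draw2 j w))
      - 2 * ((prop j w * (1 - prop j w)) * (qAB j * (prop j w * N_sq_mean j w - draw2 j w))))"
    by (intro has_cond_mean_diff has_cond_mean_add has_cond_mean_cmult prop_coeff 1 2 3)
  moreover have "(1 - prop j w)\<^sup>2 * ((addA j w)\<^sup>2 * (smp j w)\<^sup>2)
      + (prop j w)\<^sup>2 * ((addB j w)\<^sup>2 * (num j w - smp j w)\<^sup>2)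
      - 2 * ((prop j w * (1 - prop j w)) * ((addA j w * addB j w) * (smp j w * (num j w - smp j w)))) = (noise j w)\<^sup>2" for w
    unfolding noise_def power2_diff power_mult_distrib by (simp add: mult_ac)
  ultimately show ?thesis by (simp add: noise_var_def[abs_def] mult.assoc)
qed

text \<open>Multiplying the noise by the sampled fraction leaves it linear in the reinforcement, so
  only the common mean enters; the subtracted product of \<open>prop j\<close> and
  \<open>noise j\<close> is conditionally centred.\<close>

lemma frac_noise_mean:
  "has_cond_mean j (\<lambda>w. (inverse (num j w) * smp j w - prop j w) * noise j w) (frac_noise_cov j)"
proof -
  let ?e = "\<lambda>w. prop j w + prop2 j w * (N_mean j w - 1)"
  have 1: "has_cond_mean j (\<lambda>w. addA j w * (inverse (num j w) * (smp j w)\<^sup>2)) (\<lambda>w. \<mu> (Suc j) * ?e w)"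
    using reinforced[of j "\<lambda>n x. inverse (real n) * (real x)\<^sup>2" _ "\<lambda>\<alpha> \<beta>. real \<alpha>", OF draw_moments(5) mean_A] by simp
  have 2: "has_cond_mean j (\<lambda>w. addB j w * (inverse (num j w) * smp j w * (num j w - smp j w)))
      (\<lambda>w. \<mu> (Suc j) * (prop j w * N_mean j w - ?e w))"
    using reinforced[of j "\<lambda>n x. inverse (real n) * real x * (real n - real x)" _ "\<lambda>\<alpha> \<beta>. real \<beta>", OF complement_moments(4) mean_B] by simp
  have "has_cond_mean j (\<lambda>w. (1 - prop j w) * (addA j w * (inverse (num j w) * (smp j w)\<^sup>2))
       - prop j w * (addB j w * (inverse (num j w) * smp j w * (num j w - smp j w)))
       - prop j w * noise j w)
     (\<lambda>w. (1 - prop j w) * (\<mu> (Suc j) * ?e w) - prop j w * (\<mu> (Suc j) * (prop j w * N_mean j w - ?e w)) - prop j w * 0)"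
    by (intro has_cond_mean_diff prop_coeff noise_mean 1 2)
  moreover have "(1 - prop j w) * (addA j w * (inverse (num j w) * (smp j w)\<^sup>2))
       - prop j w * (addB j w * (inverse (num j w) * smp j w * (num j w - smp j w)))
       - prop j w * noise j w = (inverse (num j w) * smp j w - prop j w) * noise j w" for w
    unfolding noise_def by (simp add: power2_eq_square algebra_simps)
  moreover have "(1 - prop j w) * (\<mu> (Suc j) * ?e w) - prop j w * (\<mu> (Suc j) * (prop j w * N_mean j w - ?e w)) - prop j w * 0
       = frac_noise_cov j w" for w
    unfolding frac_noise_cov_def by (simp add: power2_eq_square algebra_simps)
  ultimately show ?thesis by simp
qed

lemma frac_square_mean:
  "has_cond_mean j (\<lambda>w. (inverse (num j w) * smp j w - prop j w)\<^sup>2) (frac_var j)"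
proof -
  have p: "has_cond_mean j (\<lambda>w. (prop j w)\<^sup>2) (\<lambda>w. (prop j w)\<^sup>2)"
    by (rule has_cond_mean_adapted[where B=1]) (auto simp: prop_bounds power_le_one)
  have "has_cond_mean j (\<lambda>w. (inverse (num j w))\<^sup>2 * (smp j w)\<^sup>2 - 2 * (prop j w * (inverse (num j w) * smp j w)) + (prop j w)\<^sup>2)
     (\<lambda>w. (prop j w * N_inv_mean j w + prop2 j w * (1 - N_inv_mean j w)) - 2 * (prop j w * prop j w) + (prop j w)\<^sup>2)"
    by (intro has_cond_mean_diff has_cond_mean_add has_cond_mean_cmult prop_coeff draw_moments p)
  then show ?thesis by (simp add: frac_var_def[abs_def] power2_diff power2_eq_square algebra_simps)
qed

lemma balls_coeff:
  assumes f: "has_cond_mean j f g"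
  shows "has_cond_mean j (\<lambda>w. f w / real (balls j w)) (\<lambda>w. g w / real (balls j w))"
proof -
  have "has_cond_mean j (\<lambda>x. (1 / real (balls j x)) * f x) (\<lambda>x. (1 / real (balls j x)) * g x)"
  proof (rule has_cond_mean_coeff[OF _ _ f])
    show "\<bar>1 / real (balls j x)\<bar> \<le> 1" for x using balls_ge_2[of j x] by simp
  qed measurable
  then show ?thesis by simp
qed

lemma frac_mean: "has_cond_mean j (\<lambda>w. inverse (num j w) * smp j w - prop j w) (\<lambda>w. 0)"
  using has_cond_mean_diff[OF draw_moments(4)[of j] has_cond_mean_adapted[OF prop_Hist prop_le(1), of j]] by simp

lemma drift_mean: "has_cond_mean j (drift j) (\<lambda>w. 0)"
  using balls_coeff[OF noise_mean] by (simp add: drift_def[abs_def])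

lemma drift_square_mean: "has_cond_mean j (\<lambda>w. (drift j w)\<^sup>2) (drift_var j)"
  using balls_coeff[OF balls_coeff[OF noise_square_mean[of j]]] by (simp add: drift_def[abs_def] drift_var_def[abs_def] power_divide power2_eq_square[of "real _"])

lemma fluct_mean: "has_cond_mean j (fluct j) (\<lambda>w. 0)"
  using has_cond_mean_diff[OF frac_mean[of j] has_cond_mean_cmult[OF drift_mean[of j], of "real (Suc j)"]]
  by (simp add: fluct_def[abs_def])

lemma fluct_square_mean: "has_cond_mean j (\<lambda>w. (fluct j w)\<^sup>2) (fluct_var j)"
proof -
  have "has_cond_mean j
     (\<lambda>w. (inverse (num j w) * smp j w - prop j w)\<^sup>2
        - (2 * real (Suc j)) * ((inverse (num j w) * smp j w - prop j w) * noise j w / real (balls j w))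
        + (real (Suc j))\<^sup>2 * (drift j w)\<^sup>2)
     (\<lambda>w. frac_var j w - (2 * real (Suc j)) * (frac_noise_cov j w / real (balls j w))
        + (real (Suc j))\<^sup>2 * drift_var j w)"
    by (intro has_cond_mean_diff has_cond_mean_add has_cond_mean_cmult balls_coeff
        frac_square_mean frac_noise_mean drift_square_mean)
  moreover have "(inverse (num j w) * smp j w - prop j w)\<^sup>2
        - (2 * real (Suc j)) * ((inverse (num j w) * smp j w - prop j w) * noise j w / real (balls j w))
        + (real (Suc j))\<^sup>2 * (drift j w)\<^sup>2 = (fluct j w)\<^sup>2" for w
    unfolding fluct_def[of j w] power2_diff[of "inverse (num j w) * smp j w - prop j w"] power_mult_distrib
    by (simp add: drift_def) (simp add: algebra_simps)
  moreover have "frac_var j w - (2 * real (Suc j)) * (frac_noise_cov j w / real (balls j w))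
        + (real (Suc j))\<^sup>2 * drift_var j w = fluct_var j w" for w
    by (simp add: fluct_var_def drift_var_def power_divide)
  ultimately show ?thesis by simp
qed

end

section \<open>Pathwise bounds, convergence of the proportion and growth of the urn\<close>

context balanced_urn
begin

abbreviation "added j w \<equiv> addA j w * smp j w + addB j w * (num j w - smp j w)"

text \<open>At most \<open>C\<close> sampled balls of a color, each bringing at most
  \<open>C\<close> new ones: the largest gain of one color in one step.\<close>

definition "K = (real C)\<^sup>2"

lemma K_nonneg: "0 \<le> K" by (simp add: K_def)

lemma step_AE:
  "AE w in M. \<forall>j. \<bar>noise j w\<bar> \<le> K \<and> 1 \<le> added j w \<and> added j w \<le> 2 * K
     \<and> real (balls (Suc j) w) = real (balls j w) + added j w
     \<and> real (ballsA (Suc j) w) = real (ballsA j w) + addA j w * smp j w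
     \<and> \<bar>inverse (num j w) * smp j w - prop j w\<bar> \<le> 1 \<and> 0 < num j w"
  using increment_AE
proof eventually_elim
  case (elim w)
  show ?case
  proof
    fix j
    have r: "1 \<le> num j w" "num j w \<le> real C" "smp j w \<le> num j w" "1 \<le> addA j w" "addA j w \<le> real C"
      "1 \<le> addB j w" "addB j w \<le> real C" "0 \<le> smp j w"
      using elim[rule_format, of j] by auto
    define p q where "p = addA j w * smp j w" and "q = addB j w * (num j w - smp j w)"
    have p: "smp j w \<le> p" "p \<le> K" unfolding p_def K_def power2_eq_square
      using r mult_right_mono[of 1 "addA j w" "smp j w"] by (simp, intro mult_mono) auto
    have q: "num j w - smp j w \<le> q" "q \<le> K" unfolding q_def K_def power2_eq_square
      using r mult_right_mono[of 1 "addB j w" "num j w - smp j w"] by (simp, intro mult_mono) auto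
    have z: "0 \<le> prop j w" "prop j w \<le> 1" by (rule prop_bounds)+
    have pq: "0 \<le> p" "0 \<le> q" using p q r by linarith+
    have "(1 - prop j w) * p \<le> p" "prop j w * q \<le> q"
      using z pq by (intro mult_left_le_one_le; simp)+
    moreover have "0 \<le> (1 - prop j w) * p" "0 \<le> prop j w * q"
      using z pq by simp_all
    \<comment> \<open>The noise is a difference of two numbers between 0 and \<open>K\<close>, hence
      no factor 2.\<close>
    ultimately have "\<bar>noise j w\<bar> \<le> K" unfolding noise_def p_def[symmetric] q_def[symmetric] using p q by linarith
    \<comment> \<open>At least one ball is sampled, and every sampled ball brings at least one new
      ball.\<close>
    moreover have "1 \<le> added j w" "added j w \<le> 2 * K" using p q r unfolding p_def q_def by linarith+
    moreover have A: "real (ballsA (Suc j) w) = real (ballsA j w) + addA j w * smp j w"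
      unfolding ballsA_eq by simp
    moreover have "real (balls (Suc j) w) = real (balls j w) + added j w"
      unfolding balls_eq[of "Suc j"] balls_eq[of j] A using r by simp
    moreover have "\<bar>inverse (num j w) * smp j w - prop j w\<bar> \<le> 1"
    proof -
      have "0 \<le> inverse (num j w) * smp j w" "inverse (num j w) * smp j w \<le> 1"
        using r by (simp_all add: field_simps)
      then show ?thesis using z by linarith
    qed
    ultimately show "\<bar>noise j w\<bar> \<le> K \<and> 1 \<le> added j w \<and> added j w \<le> 2 * K
     \<and> real (balls (Suc j) w) = real (balls j w) + added j w
     \<and> real (ballsA (Suc j) w) = real (ballsA j w) + addA j w * smp j w
     \<and> \<bar>inverse (num j w) * smp j w - prop j w\<bar> \<le> 1 \<and> 0 < num j w" using r by auto
  qed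
qed

text \<open>At least one ball is added per step. This crude linear bound holds for every
  \<open>j\<close>, unlike the asymptotic rate, and gives the deterministic sizes of
  \<open>drift\<close> and \<open>remainder\<close>.\<close>

lemma balls_growth: "AE w in M. \<forall>j. real (Suc j) \<le> real (balls j w)"
  using step_AE
proof eventually_elim
  case (elim w)
  show ?case
  proof
    fix j
    show "real (Suc j) \<le> real (balls j w)"
    proof (induction j)
      case 0
      show ?case using balls_ge_2[of 0 w] by simp
    next
      case (Suc j)
      have "real (balls (Suc j) w) = real (balls j w) + added j w" "1 \<le> added j w" using elim by blast+
      then show ?case using Suc by (simp del: of_nat_add)
    qed
  qed
qed

definition "remainder j w = prop (Suc j) w - prop j w - drift j w"

lemma remainder_M[measurable]: "remainder j \<in> borel_measurable M"
  unfolding remainder_def[abs_def] by measurable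

text \<open>The exact increment is \<open>noise j\<close> divided by the new number of balls,
  whereas \<open>drift j\<close> divides by the old one. Exchanging the denominators costs
  \<open>noise * T / (s * (s + T))\<close>, with \<open>noise\<close> bounded by \<open>K\<close>
  and the number \<open>T\<close> of added balls by \<open>2 * K\<close>.\<close>

lemma remainder_AE: "AE w in M. \<forall>j. \<bar>remainder j w\<bar> \<le> 2 * K\<^sup>2 / (real (Suc j))\<^sup>2"
  using step_AE balls_growth
proof eventually_elim
  case (elim w)
  show ?case
  proof
    fix j
    define s h T where "s = real (balls j w)" and "h = real (ballsA j w)" and "T = added j w"
    have s: "real (Suc j) \<le> s" "0 < s" using elim(2)[rule_format, of j] unfolding s_def by linarith+
    have T: "1 \<le> T" "T \<le> 2 * K" and n: "\<bar>noise j w\<bar> \<le> K" using elim(1) unfolding T_def by blast+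
    have next_eq: "prop (Suc j) w = (h + addA j w * smp j w) / (s + T)"
      unfolding urn_Z_def using elim(1) by (simp add: s_def h_def T_def)
    have prop_eq: "prop j w = h / s" by (simp add: urn_Z_def s_def h_def)
    have "s * noise j w = s * (addA j w * smp j w) - h * T"
      unfolding noise_def prop_eq T_def using s by (simp add: field_simps)
    then have "prop (Suc j) w - prop j w = noise j w / (s + T)"
      unfolding next_eq prop_eq using s T by (simp add: divide_simps) (simp add: algebra_simps)
    then have "remainder j w = noise j w / (s + T) - noise j w / s"
      unfolding remainder_def drift_def s_def[symmetric] by simp
    also have "\<dots> = - (noise j w * T / (s * (s + T)))"
      using s T by (simp add: divide_simps) (simp add: algebra_simps)
    finally have "\<bar>remainder j w\<bar> = \<bar>noise j w\<bar> * T / (s * (s + T))"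
      using s T by (simp add: abs_mult)
    also have "\<dots> \<le> (K * (2 * K)) / (real (Suc j) * real (Suc j))"
      using s T n by (intro frac_le mult_mono) auto
    also have "\<dots> = 2 * K\<^sup>2 / (real (Suc j))\<^sup>2" by (simp add: power2_eq_square)
    finally show "\<bar>remainder j w\<bar> \<le> 2 * K\<^sup>2 / (real (Suc j))\<^sup>2" .
  qed
qed

lemma drift_AE: "AE w in M. \<forall>j. \<bar>drift j w\<bar> \<le> K / real (Suc j)"
  using step_AE balls_growth
proof eventually_elim
  case (elim w)
  show ?case unfolding drift_def abs_divide using elim by (auto intro!: frac_le simp del: of_nat_Suc simp: K_nonneg)
qed

lemma drift_bound: "AE w in M. \<bar>drift j w\<bar> \<le> K / real (Suc j)"
  using drift_AE by eventually_elim blast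

lemma fluct_AE: "AE w in M. \<forall>j. \<bar>fluct j w\<bar> \<le> 1 + K"
  using step_AE drift_AE
proof eventually_elim
  case (elim w)
  show ?case
  proof
    fix j
    have "real (Suc j) * \<bar>drift j w\<bar> \<le> real (Suc j) * (K / real (Suc j))"
      using elim(2) by (intro mult_left_mono) auto
    then have "\<bar>real (Suc j) * drift j w\<bar> \<le> K" by (simp add: abs_mult)
    moreover have "\<bar>inverse (num j w) * smp j w - prop j w\<bar> \<le> 1" using elim(1) by blast
    ultimately show "\<bar>fluct j w\<bar> \<le> 1 + K" unfolding fluct_def by linarith
  qed
qed

lemma prop_telescope: "prop q w - prop p w = (\<Sum>j=p..<q. drift j w) + (\<Sum>j=p..<q. remainder j w)" if "p \<le> q"
  using sum_Suc_diff'[OF that, of "\<lambda>j. prop j w"] by (simp add: remainder_def sum.distrib sum_subtractf)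

lemma drift_square_sum:
  "integrable M (\<lambda>w. (\<Sum>j=p..<q. drift j w)\<^sup>2)"
  "(\<integral>w. (\<Sum>j=p..<q. drift j w)\<^sup>2 \<partial>M) \<le> (\<Sum>j=p..<q. (K / real (Suc j))\<^sup>2)"
  by (rule martingale_difference_square_sum[OF drift_Hist drift_bound has_cond_mean_AE[OF drift_mean]])+

theorem prop_convergent: "AE w in M. convergent (\<lambda>n. prop n w)"
proof -
  have "AE w in M. convergent (\<lambda>n. \<Sum>j<n. drift j w)"
    by (rule martingale_difference_series_AE_convergent[OF drift_Hist drift_bound has_cond_mean_AE[OF drift_mean]])
  then show ?thesis using remainder_AE
  proof eventually_elim
    case (elim w)
    have "summable (\<lambda>j. 2 * K\<^sup>2 / (real (Suc j))\<^sup>2)"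
    proof -
      have "summable (\<lambda>n. inverse ((real n)\<^sup>2))" by (rule inverse_power_summable) simp
      from summable_mult[OF summable_ignore_initial_segment[OF this, of 1], of "2 * K\<^sup>2"]
      show ?thesis by (simp add: divide_inverse)
    qed
    then have "summable (\<lambda>j. remainder j w)"
      by (rule summable_comparison_test'[of _ 0]) (use elim(2) in \<open>simp only: real_norm_def\<close>)
    then have "convergent (\<lambda>n. \<Sum>j<n. remainder j w)" by (simp add: summable_iff_convergent)
    from convergent_add[OF convergent_const[of "prop 0 w"] convergent_add[OF elim(1) this]]
    have conv: "convergent (\<lambda>n. prop 0 w + ((\<Sum>j<n. drift j w) + (\<Sum>j<n. remainder j w)))" .
    have "(\<lambda>n. prop n w) = (\<lambda>n. prop 0 w + ((\<Sum>j<n. drift j w) + (\<Sum>j<n. remainder j w)))"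
    proof
      fix n
      show "prop n w = prop 0 w + ((\<Sum>j<n. drift j w) + (\<Sum>j<n. remainder j w))"
        using prop_telescope[OF le0[of n], of w] unfolding lessThan_atLeast0 by linarith
    qed
    then show ?case by (rule ssubst) (rule conv)
  qed
qed

lemma added_mean: "has_cond_mean j (added j) (\<lambda>w. \<mu> (Suc j) * N_mean j w)"
  using has_cond_mean_add[OF reinforced_moments] by (simp add: algebra_simps)

text \<open>The added balls are centred by their conditional means
  \<open>\<mu> (Suc j) * N_mean j\<close>. The centred part is negligible by the strong law for
  martingale differences, and the means converge, so their averages do.\<close>

lemma balls_strong_law:
  assumes \<mu>: "\<mu> \<longlonglongrightarrow> m" and N: "AE w in M. (\<lambda>j. N_mean j w) \<longlonglongrightarrow> Nl w"
  shows "AE w in M. (\<lambda>n. real (balls n w) / real n) \<longlonglongrightarrow> m * Nl w"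
proof -
  define d where "d j w = added j w - \<mu> (Suc j) * N_mean j w" for j w
  have added_M: "added j \<in> borel_measurable M" for j by measurable
  have added_int: "integrable M (added j)" for j using added_mean by (auto simp: has_cond_mean_def)
  \<comment> \<open>The compensator inherits the bounds of \<open>added j\<close> through the
    conditional expectation.\<close>
  have mean_bound: "AE w in M. 0 \<le> \<mu> (Suc j) * N_mean j w \<and> \<mu> (Suc j) * N_mean j w \<le> 2 * K" for j
  proof -
    interpret F: finite_measure_subalgebra M "Hist j" by (rule fms)
    have ge: "AE w in M. 0 \<le> added j w" using step_AE
    proof eventually_elim
      case (elim w)
      then have "1 \<le> added j w" by blast
      then show ?case by linarith
    qed
    have le: "AE w in M. added j w \<le> 2 * K" using step_AE by eventually_elim blast
    from F.real_cond_exp_ge_c[OF added_int ge] F.real_cond_exp_le_c[OF added_int le]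
    show ?thesis using has_cond_mean_AE[OF added_mean[of j]] by eventually_elim simp
  qed
  have d_mean: "has_cond_mean j (d j) (\<lambda>w. 0)" for j
  proof -
    have "has_cond_mean j (\<lambda>w. \<mu> (Suc j) * N_mean j w) (\<lambda>w. \<mu> (Suc j) * N_mean j w)"
    proof (rule has_cond_mean_adapted)
      show "AE w in M. \<bar>\<mu> (Suc j) * N_mean j w\<bar> \<le> 2 * K" using mean_bound[of j] by eventually_elim simp
    qed measurable
    from has_cond_mean_diff[OF added_mean this] show ?thesis by (simp add: d_def[abs_def])
  qed
  have "AE w in M. (\<lambda>n. (\<Sum>j<n. d j w) / real n) \<longlonglongrightarrow> 0"
  proof (rule martingale_difference_strong_law[OF _ _ has_cond_mean_AE[OF d_mean]])
    fix j
    have [measurable]: "N (Suc j) \<in> Hist (Suc j) \<rightarrow>\<^sub>M count_space UNIV" "X (Suc j) \<in> Hist (Suc j) \<rightarrow>\<^sub>M count_space UNIV"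
      "A (Suc j) \<in> Hist (Suc j) \<rightarrow>\<^sub>M count_space UNIV" "B (Suc j) \<in> Hist (Suc j) \<rightarrow>\<^sub>M count_space UNIV"
      using Hist_measurable[of j "Suc j"] by auto
    have [measurable]: "N_mean j \<in> borel_measurable (Hist (Suc j))"
      by (rule measurable_G_mono[of _ j]) auto
    have [measurable]: "added j \<in> borel_measurable (Hist (Suc j))" by measurable
    show "d j \<in> borel_measurable (Hist (Suc j))" unfolding d_def[abs_def] by measurable
    show "AE w in M. \<bar>d j w\<bar> \<le> 2 * K"
      using step_AE mean_bound[of j]
    proof eventually_elim
      case (elim w)
      have "1 \<le> added j w" "added j w \<le> 2 * K" using elim(1) by blast+
      then show ?case using elim(2) unfolding d_def by linarith
    qed
  qed
  then show ?thesis using N step_AE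
  proof eventually_elim
    case (elim w)
    have sum: "real (balls n w) = real (balls 0 w) + (\<Sum>j<n. d j w) + (\<Sum>j<n. \<mu> (Suc j) * N_mean j w)" for n
    proof (induction n)
      case (Suc n)
      have "real (balls (Suc n) w) = real (balls n w) + added n w" using elim(3) by blast
      then show ?case using Suc by (simp add: d_def)
    qed simp
    have "(\<lambda>j. \<mu> (Suc j) * N_mean j w) \<longlonglongrightarrow> m * Nl w"
      by (intro tendsto_mult LIMSEQ_Suc \<mu> elim(2))
    from cesaro_mean_tendsto[OF this]
    have "(\<lambda>n. real (balls 0 w) / real n + (\<Sum>j<n. d j w) / real n + (\<Sum>j<n. \<mu> (Suc j) * N_mean j w) / real n) \<longlonglongrightarrow> 0 + 0 + m * Nl w"
      by (intro tendsto_add elim(1) lim_const_over_n)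
    moreover have "real (balls 0 w) / real n + (\<Sum>j<n. d j w) / real n + (\<Sum>j<n. \<mu> (Suc j) * N_mean j w) / real n = real (balls n w) / real n" for n
      by (subst sum[of n]) (simp add: add_divide_distrib)
    ultimately show ?case by simp
  qed
qed

end

section \<open>Limits of the conditional variances\<close>

locale urn_clt = balanced_urn M a b N X A B C \<mu>
  for M :: "'w measure" and a b and N X A B :: "nat \<Rightarrow> 'w \<Rightarrow> nat" and C and \<mu> +
  fixes m qa qb qab :: real and Nl Q L :: "'w \<Rightarrow> real"
  assumes \<mu>_lim: "\<mu> \<longlonglongrightarrow> m" and m_pos: "m > 0"
    and Nl_M[measurable]: "Nl \<in> borel_measurable M" and Nl_pos: "AE w in M. Nl w > 0"
    and Q_M[measurable]: "Q \<in> borel_measurable M" and L_M[measurable]: "L \<in> borel_measurable M"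
    and N_mean_lim: "AE w in M. (\<lambda>j. N_mean j w) \<longlonglongrightarrow> Nl w"
    and N_sq_mean_lim: "AE w in M. (\<lambda>j. N_sq_mean j w) \<longlonglongrightarrow> Q w"
    and N_inv_mean_lim: "AE w in M. (\<lambda>j. N_inv_mean j w) \<longlonglongrightarrow> L w"
    and q_lim: "qA \<longlonglongrightarrow> qa" "qB \<longlonglongrightarrow> qb" "qAB \<longlonglongrightarrow> qab"
begin

definition "Z w = lim (\<lambda>n. prop n w)"
definition "V w = Z w * (1 - Z w) *
  (Nl w * ((1 - Z w)\<^sup>2 * qa + (Z w)\<^sup>2 * qb + 2 * Z w * (1 - Z w) * qab)
    + Z w * (1 - Z w) * Q w * (qa + qb - 2 * qab)) / (m * Nl w)\<^sup>2"
definition "U w = V w + Z w * (1 - Z w) * (L w - 2 * inverse (Nl w))"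

lemma prop_lim: "AE w in M. (\<lambda>n. prop n w) \<longlonglongrightarrow> Z w"
  using prop_convergent unfolding Z_def by eventually_elim (simp add: convergent_LIMSEQ_iff)

lemma Z_M[measurable]: "Z \<in> borel_measurable M"
  unfolding Z_def[abs_def] by (rule borel_measurable_lim_metric) measurable

lemma V_M[measurable]: "V \<in> borel_measurable M"
  unfolding V_def[abs_def] by measurable

lemma U_M[measurable]: "U \<in> borel_measurable M"
  unfolding U_def[abs_def] by measurable

text \<open>The conditional variances are explicit expressions in quantities with known limits: the
  proportion, the conditional moments of the sample size, the moments of the reinforcement and the
  ratio of time to number of balls. What remains is to recognise the limits as \<open>V\<close> and
  \<open>U\<close>.\<close>

lemma variance_limits:
  "AE w in M. (\<lambda>j. (real (Suc j))\<^sup>2 * drift_var j w) \<longlonglongrightarrow> V w \<and> (\<lambda>j. fluct_var j w) \<longlonglongrightarrow> U w"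
  using prop_lim N_mean_lim N_sq_mean_lim N_inv_mean_lim Nl_pos balls_strong_law[OF \<mu>_lim N_mean_lim] balls_growth
proof eventually_elim
  case (elim w)
  define z n1 n2 l where "z = Z w" and "n1 = Nl w" and "n2 = Q w" and "l = L w"
  have n1: "0 < n1" using elim by (simp add: n1_def)
  have lim: "(\<lambda>n. prop n w) \<longlonglongrightarrow> z" "(\<lambda>j. N_mean j w) \<longlonglongrightarrow> n1" "(\<lambda>j. N_sq_mean j w) \<longlonglongrightarrow> n2" "(\<lambda>j. N_inv_mean j w) \<longlonglongrightarrow> l"
    using elim by (simp_all add: z_def n1_def n2_def l_def)
  \<comment> \<open>The strong law has \<open>j\<close> in the denominator while the increments
    carry \<open>Suc j\<close>; the quotient of the two tends to 1.\<close>
  have ratio: "(\<lambda>j. real (Suc j) / real (balls j w)) \<longlonglongrightarrow> 1 / (m * n1)"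
  proof -
    have "(\<lambda>j. real (balls j w) / real j * (real j / real (Suc j))) \<longlonglongrightarrow> m * n1 * 1"
    proof (rule tendsto_mult)
      show "(\<lambda>j. real (balls j w) / real j) \<longlonglongrightarrow> m * n1" using elim by (simp add: n1_def)
      show "(\<lambda>j. real j / real (Suc j)) \<longlonglongrightarrow> 1" by (rule LIMSEQ_n_over_Suc_n)
    qed
    from tendsto_divide[OF tendsto_const[of 1] this]
    have "(\<lambda>j. 1 / (real (balls j w) / real j * (real j / real (Suc j)))) \<longlonglongrightarrow> 1 / (m * n1)"
      using n1 m_pos by simp
    moreover have "\<forall>\<^sub>F j in sequentially. 1 / (real (balls j w) / real j * (real j / real (Suc j))) = real (Suc j) / real (balls j w)"
      using eventually_gt_at_top[of 0] by eventually_elim simp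
    ultimately show ?thesis by (rule Lim_transform_eventually)
  qed
  have inv: "(\<lambda>j. 1 / real (balls j w)) \<longlonglongrightarrow> 0"
  proof (rule Lim_null_comparison)
    show "\<forall>\<^sub>F j in sequentially. norm (1 / real (balls j w)) \<le> 1 / real (Suc j)"
    proof (intro always_eventually allI)
      fix j
      have "real (Suc j) \<le> real (balls j w)" using elim(7) by blast
      then show "norm (1 / real (balls j w)) \<le> 1 / real (Suc j)" by (simp add: frac_le del: of_nat_Suc)
    qed
    show "(\<lambda>j. 1 / real (Suc j)) \<longlonglongrightarrow> 0" using LIMSEQ_Suc[OF lim_const_over_n[of 1]] .
  qed
  \<comment> \<open>In a growing urn, drawing without replacement becomes drawing with replacement.
    Numerator and denominator are divided by the square of the number of balls.\<close>
  have prop2: "(\<lambda>j. prop2 j w) \<longlonglongrightarrow> z\<^sup>2"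
  proof -
    have "prop2 j w = prop j w * ((prop j w - 1 / real (balls j w)) / (1 - 1 / real (balls j w)))" for j
    proof -
      have "2 \<le> real (balls j w)" using balls_ge_2[of j w] by simp
      then show ?thesis unfolding prop2_def urn_Z_def by (simp add: divide_simps)
    qed
    moreover have "(\<lambda>j. prop j w * ((prop j w - 1 / real (balls j w)) / (1 - 1 / real (balls j w)))) \<longlonglongrightarrow> z * ((z - 0) / (1 - 0))"
      by (intro tendsto_intros lim inv) simp
    ultimately show ?thesis by (simp add: power2_eq_square)
  qed
  have draw2: "(\<lambda>j. draw2 j w) \<longlonglongrightarrow> z * n1 + z\<^sup>2 * (n2 - n1)"
    unfolding draw2_def by (intro tendsto_intros lim prop2)
  have noise: "(\<lambda>j. noise_var j w) \<longlonglongrightarrow> V w * (m * n1)\<^sup>2"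
  proof -
    have "(\<lambda>j. noise_var j w) \<longlonglongrightarrow> (1 - z)\<^sup>2 * (qa * (z * n1 + z\<^sup>2 * (n2 - n1)))
      + z\<^sup>2 * (qb * (n2 - 2 * (z * n2) + (z * n1 + z\<^sup>2 * (n2 - n1))))
      - (2 * (z * (1 - z))) * (qab * (z * n2 - (z * n1 + z\<^sup>2 * (n2 - n1))))"
      unfolding noise_var_def by (intro tendsto_intros lim prop2 draw2 q_lim)
    also have "(1 - z)\<^sup>2 * (qa * (z * n1 + z\<^sup>2 * (n2 - n1)))
      + z\<^sup>2 * (qb * (n2 - 2 * (z * n2) + (z * n1 + z\<^sup>2 * (n2 - n1))))
      - (2 * (z * (1 - z))) * (qab * (z * n2 - (z * n1 + z\<^sup>2 * (n2 - n1))))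
      = z * (1 - z) * (n1 * ((1 - z)\<^sup>2 * qa + z\<^sup>2 * qb + 2 * z * (1 - z) * qab) + z * (1 - z) * n2 * (qa + qb - 2 * qab))"
      by algebra
    also have "\<dots> = V w * (m * n1)\<^sup>2"
      using n1 m_pos unfolding V_def z_def[symmetric] n1_def[symmetric] n2_def[symmetric] by simp
    finally show ?thesis .
  qed
  have scaled: "(\<lambda>j. (real (Suc j) / real (balls j w))\<^sup>2 * noise_var j w) \<longlonglongrightarrow> V w"
  proof -
    have "(\<lambda>j. (real (Suc j) / real (balls j w))\<^sup>2 * noise_var j w) \<longlonglongrightarrow> (1 / (m * n1))\<^sup>2 * (V w * (m * n1)\<^sup>2)"
      by (intro tendsto_intros ratio noise)
    then show ?thesis using n1 m_pos by (simp add: power_divide)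
  qed
  have "(\<lambda>j. fluct_var j w) \<longlonglongrightarrow> (z * l + z\<^sup>2 * (1 - l) - z\<^sup>2) - 2 * (1 / (m * n1)) * (m * (z + z\<^sup>2 * (n1 - 1) - z\<^sup>2 * n1)) + V w"
    unfolding fluct_var_def frac_var_def frac_noise_cov_def
    by (intro tendsto_intros lim prop2 ratio scaled LIMSEQ_Suc[OF \<mu>_lim])
  \<comment> \<open>The variance of the sampled fraction tends to \<open>z * (1 - z) * l\<close>.
    The covariance tends to \<open>m * z * (1 - z)\<close> and meets the ratio
    \<open>1 / (m * n1)\<close>, which leaves \<open>2 / n1\<close> without
    \<open>m\<close>.\<close>
  also have "(z * l + z\<^sup>2 * (1 - l) - z\<^sup>2) - 2 * (1 / (m * n1)) * (m * (z + z\<^sup>2 * (n1 - 1) - z\<^sup>2 * n1)) + V w = U w"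
  proof -
    have "2 * (1 / (m * n1)) * (m * (z + z\<^sup>2 * (n1 - 1) - z\<^sup>2 * n1)) = 2 * inverse n1 * (z * (1 - z))"
    proof -
      have "z + z\<^sup>2 * (n1 - 1) - z\<^sup>2 * n1 = z * (1 - z)" by algebra
      moreover have "2 * (1 / (m * n1)) * (m * w) = 2 * inverse n1 * w" for w
        using m_pos by (simp add: inverse_eq_divide)
      ultimately show ?thesis by (simp only:)
    qed
    moreover have "z * l + z\<^sup>2 * (1 - l) - z\<^sup>2 = z * (1 - z) * l" by algebra
    ultimately show ?thesis unfolding U_def z_def[symmetric] n1_def[symmetric] l_def[symmetric]
      by (simp add: algebra_simps)
  qed
  finally show ?case using scaled by (simp add: drift_var_def power_divide)
qed

lemma drift_var_AE: "AE w in M. \<forall>j. cexp j (\<lambda>w. (drift j w)\<^sup>2) w = drift_var j w"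
  using has_cond_mean_AE[OF drift_square_mean] by (simp add: AE_all_countable)

lemma fluct_var_AE: "AE w in M. \<forall>j. cexp j (\<lambda>w. (fluct j w)\<^sup>2) w = fluct_var j w"
  using has_cond_mean_AE[OF fluct_square_mean] by (simp add: AE_all_countable)

text \<open>The formula for \<open>U\<close> does not show its sign; it is nonnegative as an almost
  sure limit of conditional second moments.\<close>

lemma variances_nonneg: "AE w in M. 0 \<le> U w \<and> 0 \<le> V w"
proof -
  have "AE w in M. 0 \<le> cexp j (\<lambda>w. (drift j w)\<^sup>2) w" for j
    by (rule sigma_finite_subalgebra.real_cond_exp_pos[OF finite_measure_subalgebra_is_sigma_finite[OF fms]]) auto
  then have 1: "AE w in M. \<forall>j. 0 \<le> cexp j (\<lambda>w. (drift j w)\<^sup>2) w"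
    by (simp add: AE_all_countable)
  have "AE w in M. 0 \<le> cexp j (\<lambda>w. (fluct j w)\<^sup>2) w" for j
    by (rule sigma_finite_subalgebra.real_cond_exp_pos[OF finite_measure_subalgebra_is_sigma_finite[OF fms]]) auto
  then have 2: "AE w in M. \<forall>j. 0 \<le> cexp j (\<lambda>w. (fluct j w)\<^sup>2) w"
    by (simp add: AE_all_countable)
  show ?thesis using variance_limits drift_var_AE fluct_var_AE 1 2
  proof eventually_elim
    case (elim w)
    have lim: "(\<lambda>j. (real (Suc j))\<^sup>2 * drift_var j w) \<longlonglongrightarrow> V w" "(\<lambda>j. fluct_var j w) \<longlonglongrightarrow> U w"
      using elim(1) by blast+
    have "\<forall>j. 0 \<le> drift_var j w" "\<forall>j. 0 \<le> fluct_var j w" using elim(2-5) by metis+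
    then show ?case
      by (auto intro!: LIMSEQ_le_const[OF lim(1)] LIMSEQ_le_const[OF lim(2)] simp del: of_nat_Suc)
  qed
qed

end

section \<open>Assembling the array\<close>

lemma iexp_diff_le: "norm (iexp x - iexp y) \<le> \<bar>x - y\<bar>"
proof -
  have "iexp x - iexp y = iexp y * (iexp (x - y) - 1)"
    by (simp add: right_diff_distrib exp_add[symmetric] algebra_simps)
  then have "norm (iexp x - iexp y) = norm (iexp (x - y) - 1)" by (simp add: norm_mult)
  also have "\<dots> = 2 * \<bar>sin ((x - y) / 2)\<bar>" by (rule dist_exp_i_1)
  also have "\<dots> \<le> 2 * \<bar>(x - y) / 2\<bar>" using abs_sin_x_le_abs_x[of "(x - y) / 2"] by simp
  finally show ?thesis by simp
qed

context urn_clt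
begin

abbreviation "mean_gap n w \<equiv> sqrt (real n) * (urn_mean N X n w - prop n w)"
abbreviation "limit_gap n w \<equiv> sqrt (real n) * (prop n w - Z w)"

abbreviation "gap s t n w \<equiv> s * mean_gap n w + t * limit_gap n w"

text \<open>
  The array for the functional \<open>s\<close> times the first plus \<open>t\<close> times the second gap. The tail is cut at
  \<open>n\<^sup>2\<close>, where the distance of \<open>Z\<^sub>k\<close> to its limit is of order \<open>1 / n\<close>.
\<close>

definition "array s t n j w =
  (if j < n then s / sqrt (real n) * fluct j w else - (t * sqrt (real n)) * drift j w)"
definition "array_bound s t n j =
  (if j < n then \<bar>s\<bar> / sqrt (real n) * (1 + K) else \<bar>t\<bar> * sqrt (real n) * (K / real (Suc j)))"
text \<open>Three sources of error: the remainders of the first block, weighted by time, of order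
  log n / sqrt n; the remainders of the second block, of order 1 / sqrt n; and the cut at
  \<open>n\<^sup>2\<close>, of order 1 / sqrt n in mean.\<close>

definition "err s t n w =
  - (s / sqrt (real n)) * (\<Sum>j<n. real (Suc j) * remainder j w)
  - t * sqrt (real n) * (\<Sum>j=n..<n\<^sup>2. remainder j w) + t * sqrt (real n) * (prop (n\<^sup>2) w - Z w)"

lemma sum_split_square: "(\<Sum>j<n\<^sup>2. f j) = (\<Sum>j<n. f j) + (\<Sum>j=n..<n\<^sup>2. f j)" for f :: "nat \<Rightarrow> 'z::comm_monoid_add"
  unfolding lessThan_atLeast0 by (rule sum.atLeastLessThan_concat[symmetric]) (auto simp: power2_eq_square)

lemma array_sum: "(\<Sum>j<n\<^sup>2. array s t n j w)
   = s / sqrt (real n) * (\<Sum>j<n. fluct j w) - t * sqrt (real n) * (\<Sum>j=n..<n\<^sup>2. drift j w)"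
proof -
  have "(\<Sum>j<n. array s t n j w) = s / sqrt (real n) * (\<Sum>j<n. fluct j w)"
    by (simp add: array_def sum_distrib_left)
  moreover have "(\<Sum>j=n..<n\<^sup>2. array s t n j w) = (\<Sum>j=n..<n\<^sup>2. - (t * sqrt (real n)) * drift j w)"
    by (rule sum.cong) (auto simp: array_def)
  then have "(\<Sum>j=n..<n\<^sup>2. array s t n j w) = - (t * sqrt (real n)) * (\<Sum>j=n..<n\<^sup>2. drift j w)"
    by (simp only: sum_distrib_left)
  ultimately show ?thesis unfolding sum_split_square by simp
qed

lemma urn_mean_eq: "urn_mean N X n w = (\<Sum>j<n. inverse (num j w) * smp j w) / real n"
proof -
  have "(\<Sum>j=1..n. real (X j w) / real (N j w)) = (\<Sum>j<n. real (X (Suc j) w) / real (N (Suc j) w))"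
    by (rule sum.reindex_bij_witness[of _ Suc "\<lambda>i. i - 1"]) auto
  then show ?thesis by (simp add: urn_mean_def divide_inverse mult.commute)
qed

text \<open>Summation by parts: the sampled fraction at step \<open>j\<close> is
  \<open>fluct j\<close> plus the increment of \<open>j * prop j\<close> minus
  \<open>(j + 1) * remainder j\<close>. The middle terms telescope to \<open>n * prop n\<close>,
  exactly what is subtracted in the first gap.\<close>

lemma gap_decomposition:
  "gap s t n w = (\<Sum>j<n\<^sup>2. array s t n j w) + err s t n w"
proof (cases "n = 0")
  case True
  then show ?thesis by (simp add: err_def)
next
  case False
  have "inverse (num j w) * smp j w = fluct j w + (real (Suc j) * prop (Suc j) w - real j * prop j w) - real (Suc j) * remainder j w" for j
    unfolding fluct_def remainder_def by (simp add: algebra_simps)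
  then have "(\<Sum>j<n. inverse (num j w) * smp j w)
      = (\<Sum>j<n. fluct j w) + (\<Sum>j<n. real (Suc j) * prop (Suc j) w - real j * prop j w) - (\<Sum>j<n. real (Suc j) * remainder j w)"
    by (simp only: sum.distrib sum_subtractf)
  also have "(\<Sum>j<n. real (Suc j) * prop (Suc j) w - real j * prop j w) = real n * prop n w"
    by (subst sum_lessThan_telescope) simp
  finally have "urn_mean N X n w - prop n w = ((\<Sum>j<n. fluct j w) - (\<Sum>j<n. real (Suc j) * remainder j w)) / real n"
    unfolding urn_mean_eq using False by (simp add: field_simps)
  moreover have "sqrt (real n) * (y / real n) = 1 / sqrt (real n) * y" for y
    using False real_sqrt_mult_self[of "real n"] by (simp add: field_simps)
  ultimately have 1: "mean_gap n w = 1 / sqrt (real n) * ((\<Sum>j<n. fluct j w) - (\<Sum>j<n. real (Suc j) * remainder j w))"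
    by (simp only:)
  have "n \<le> n\<^sup>2" by (simp add: power2_eq_square)
  from prop_telescope[OF this, of w]
  have 2: "prop n w - Z w = - (\<Sum>j=n..<n\<^sup>2. drift j w) - (\<Sum>j=n..<n\<^sup>2. remainder j w) + (prop (n\<^sup>2) w - Z w)" by linarith
  show ?thesis unfolding 1 2 array_sum err_def by (simp add: algebra_simps)
qed

lemma array_Hist: "array s t n j \<in> borel_measurable (Hist (Suc j))"
  using fluct_Hist[of j] drift_Hist[of j] unfolding array_def[abs_def] by (cases "j < n") simp_all

lemma array_AE: "AE w in M. \<bar>array s t n j w\<bar> \<le> array_bound s t n j"
  using drift_AE fluct_AE
proof eventually_elim
  case (elim w)
  have "\<bar>drift j w\<bar> \<le> K / real (Suc j)" "\<bar>fluct j w\<bar> \<le> 1 + K" using elim by blast+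
  then have "\<bar>t\<bar> * sqrt (real n) * \<bar>drift j w\<bar> \<le> \<bar>t\<bar> * sqrt (real n) * (K / real (Suc j))"
    "\<bar>s\<bar> / sqrt (real n) * \<bar>fluct j w\<bar> \<le> \<bar>s\<bar> / sqrt (real n) * (1 + K)"
    by (intro mult_left_mono; simp)+
  then show ?case by (auto simp: array_def array_bound_def abs_mult simp del: of_nat_Suc)
qed

lemma array_mean: "AE w in M. cexp j (array s t n j) w = 0"
proof -
  have "has_cond_mean j (array s t n j) (\<lambda>w. 0)"
    using has_cond_mean_cmult[OF fluct_mean[of j], of "s / sqrt (real n)"] has_cond_mean_cmult[OF drift_mean[of j], of "- (t * sqrt (real n))"]
    unfolding array_def[abs_def] by (cases "j < n") simp_all
  then show ?thesis by (rule has_cond_mean_AE)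
qed

lemma array_square: "AE w in M. \<forall>n j. cexp j (\<lambda>w. (array s t n j w)\<^sup>2) w
   = (if j < n then s\<^sup>2 * (1 / real n) * fluct_var j w else t\<^sup>2 * (real n * drift_var j w))"
proof -
  have "AE w in M. cexp j (\<lambda>w. (array s t n j w)\<^sup>2) w
   = (if j < n then s\<^sup>2 * (1 / real n) * fluct_var j w else t\<^sup>2 * (real n * drift_var j w))" for n j
  proof -
    have "has_cond_mean j (\<lambda>w. (array s t n j w)\<^sup>2)
       (\<lambda>w. if j < n then s\<^sup>2 * (1 / real n) * fluct_var j w else t\<^sup>2 * (real n * drift_var j w))"
    proof (cases "j < n")
      case True
      then show ?thesis using has_cond_mean_cmult[OF fluct_square_mean[of j], of "s\<^sup>2 * (1 / real n)"]
        by (simp add: array_def power_mult_distrib power_divide)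
    next
      case False
      then show ?thesis using has_cond_mean_cmult[OF drift_square_mean[of j], of "t\<^sup>2 * real n"]
        by (simp add: array_def power_mult_distrib mult.assoc)
    qed
    then show ?thesis by (rule has_cond_mean_AE)
  qed
  then show ?thesis by (simp only: AE_all_countable simp_thms)
qed

text \<open>Both blocks have total square of order 1: the first has \<open>n\<close> terms of order
  \<open>1 / n\<close>, the second the terms \<open>n / (j + 1)\<^sup>2\<close> from
  \<open>j = n\<close> on.\<close>

lemma array_bound_square_sum: "(\<Sum>j<n\<^sup>2. (array_bound s t n j)\<^sup>2) \<le> (s\<^sup>2 + t\<^sup>2) * (1 + K)\<^sup>2"
proof (cases "n = 0")
  case False
  have "(\<Sum>j<n. (array_bound s t n j)\<^sup>2) = s\<^sup>2 * (1 + K)\<^sup>2"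
    using False by (simp add: array_bound_def power_mult_distrib power_divide)
  moreover have "(\<Sum>j=n..<n\<^sup>2. (array_bound s t n j)\<^sup>2) \<le> t\<^sup>2 * (1 + K)\<^sup>2"
  proof -
    have "(\<Sum>j=n..<n\<^sup>2. (array_bound s t n j)\<^sup>2) = (\<Sum>j=n..<n\<^sup>2. t\<^sup>2 * K\<^sup>2 * real n * (1 / (real (Suc j))\<^sup>2))"
      by (rule sum.cong) (auto simp: array_bound_def power_mult_distrib power_divide)
    also have "\<dots> = t\<^sup>2 * K\<^sup>2 * real n * (\<Sum>j=n..<n\<^sup>2. 1 / (real (Suc j))\<^sup>2)" by (simp only: sum_distrib_left)
    also have "\<dots> \<le> t\<^sup>2 * K\<^sup>2 * real n * (1 / real n)"
      using False by (intro mult_left_mono sum_inverse_square_le) auto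
    also have "\<dots> = t\<^sup>2 * K\<^sup>2" using False by simp
    also have "\<dots> \<le> t\<^sup>2 * (1 + K)\<^sup>2" using K_nonneg by (intro mult_left_mono power_mono) auto
    finally show ?thesis .
  qed
  ultimately show ?thesis unfolding sum_split_square by (simp add: distrib_right)
qed simp

lemma array_bound_small: "array_bound s t n j \<le> (\<bar>s\<bar> + \<bar>t\<bar>) * (1 + K) / sqrt (real n)"
\<comment> \<open>For \<open>n = 0\<close> both sides are 0, the right one through division by
  zero.\<close>
proof (cases "n = 0 \<or> j < n")
  case True
  then show ?thesis using K_nonneg by (auto simp: array_bound_def divide_right_mono)
next
  case False
  then have n: "0 < real n" "real n \<le> real (Suc j)" by auto
  have "sqrt (real n) * (K / real (Suc j)) \<le> sqrt (real n) * (K / real n)"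
    using n K_nonneg by (intro mult_left_mono divide_left_mono) auto
  also have "\<dots> = K / sqrt (real n)" using n real_sqrt_mult_self[of "real n"] by (simp add: field_simps)
  also have "\<dots> \<le> (1 + K) / sqrt (real n)" by (intro divide_right_mono) auto
  finally have "\<bar>t\<bar> * (sqrt (real n) * (K / real (Suc j))) \<le> \<bar>t\<bar> * ((1 + K) / sqrt (real n))" by (intro mult_left_mono) auto
  moreover have "0 \<le> \<bar>s\<bar> * ((1 + K) / sqrt (real n))" using K_nonneg by simp
  moreover have "array_bound s t n j = \<bar>t\<bar> * (sqrt (real n) * (K / real (Suc j)))"
    using False by (simp only: array_bound_def if_False de_Morgan_disj mult.assoc)
  moreover have "(\<bar>s\<bar> + \<bar>t\<bar>) * (1 + K) / sqrt (real n) = \<bar>s\<bar> * ((1 + K) / sqrt (real n)) + \<bar>t\<bar> * ((1 + K) / sqrt (real n))"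
    by (simp only: distrib_right times_divide_eq_right add_divide_distrib[symmetric])
  ultimately show ?thesis by linarith
qed

text \<open>The first block is a Cesaro mean of \<open>fluct_var\<close>, the second a tail average
  of the rescaled \<open>drift_var\<close>. No index carries both \<open>s\<close> and
  \<open>t\<close>, so no mixed term appears.\<close>

lemma array_variance_lim:
  "AE w in M. (\<lambda>n. \<Sum>j<n\<^sup>2. cexp j (\<lambda>w. (array s t n j w)\<^sup>2) w) \<longlonglongrightarrow> s\<^sup>2 * U w + t\<^sup>2 * V w"
  using variance_limits array_square[of s t]
proof eventually_elim
  case (elim w)
  have eq: "(\<Sum>j<n\<^sup>2. cexp j (\<lambda>w. (array s t n j w)\<^sup>2) w)
    = s\<^sup>2 * ((\<Sum>j<n. fluct_var j w) / real n)
      + t\<^sup>2 * (\<Sum>j=n..<n\<^sup>2. real n / (real (Suc j))\<^sup>2 * ((real (Suc j))\<^sup>2 * drift_var j w))" for n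
  proof -
    have "(\<Sum>j<n. cexp j (\<lambda>w. (array s t n j w)\<^sup>2) w) = s\<^sup>2 * ((\<Sum>j<n. fluct_var j w) / real n)"
      using elim(2) by (simp add: sum_distrib_left sum_divide_distrib)
    moreover have "(\<Sum>j=n..<n\<^sup>2. cexp j (\<lambda>w. (array s t n j w)\<^sup>2) w)
       = (\<Sum>j=n..<n\<^sup>2. t\<^sup>2 * (real n / (real (Suc j))\<^sup>2 * ((real (Suc j))\<^sup>2 * drift_var j w)))"
      by (rule sum.cong) (auto simp: elim(2) simp del: of_nat_Suc)
    ultimately show ?thesis unfolding sum_split_square by (simp only: sum_distrib_left)
  qed
  have "(\<lambda>j. (real (Suc j))\<^sup>2 * drift_var j w) \<longlonglongrightarrow> V w" "(\<lambda>j. fluct_var j w) \<longlonglongrightarrow> U w"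
    using elim(1) by blast+
  then show ?case unfolding eq by (intro tendsto_intros cesaro_mean_tendsto tail_weighted_average_tendsto)
qed


section \<open>Mean error of the approximation by the array\<close>

lemma gap_square:
  assumes p: "0 < p" "p \<le> q"
  shows "(\<integral>w. (prop q w - prop p w)\<^sup>2 \<partial>M) \<le> (2 * K\<^sup>2 + 8 * K ^ 4) / real p"
proof -
  have rem: "AE w in M. (\<Sum>j=p..<q. remainder j w)\<^sup>2 \<le> 4 * K ^ 4 / real p"
    using remainder_AE
  proof eventually_elim
    case (elim w)
    have "\<bar>\<Sum>j=p..<q. remainder j w\<bar> \<le> (\<Sum>j=p..<q. 2 * K\<^sup>2 * (1 / (real (Suc j))\<^sup>2))"
      by (rule order_trans[OF sum_abs], rule sum_mono) (use elim in \<open>simp del: of_nat_Suc\<close>)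
    also have "\<dots> = 2 * K\<^sup>2 * (\<Sum>j=p..<q. 1 / (real (Suc j))\<^sup>2)" by (simp only: sum_distrib_left)
    also have "\<dots> \<le> 2 * K\<^sup>2 * (1 / real p)" using p by (intro mult_left_mono sum_inverse_square_le) auto
    finally have "(\<Sum>j=p..<q. remainder j w)\<^sup>2 \<le> (2 * K\<^sup>2 * (1 / real p))\<^sup>2" by (rule square_le_of_abs_le)
    also have "\<dots> = 4 * K ^ 4 * (1 / real p)\<^sup>2"
    proof -
      have "(2 * K\<^sup>2 * y)\<^sup>2 = 4 * K ^ 4 * y\<^sup>2" for y by algebra
      then show ?thesis .
    qed
    also have "\<dots> \<le> 4 * K ^ 4 * (1 / real p)"
      using p by (intro mult_left_mono) (auto simp: power2_eq_square divide_simps)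
    finally show ?case by simp
  qed
  \<comment> \<open>By the inequality (x + y)^2 \<le> 2 x^2 + 2 y^2 the drift and remainder parts
    separate; doubling their bounds \<open>K\<^sup>2 / p\<close> and \<open>4 * K ^ 4 / p\<close>
    gives the constants.\<close>
  have "(\<integral>w. (prop q w - prop p w)\<^sup>2 \<partial>M) \<le> (\<integral>w. 2 * (\<Sum>j=p..<q. drift j w)\<^sup>2 + 8 * K ^ 4 / real p \<partial>M)"
  proof (rule integral_mono_AE)
    show "AE w in M. (prop q w - prop p w)\<^sup>2 \<le> 2 * (\<Sum>j=p..<q. drift j w)\<^sup>2 + 8 * K ^ 4 / real p"
      using rem
    proof eventually_elim
      case (elim w)
      have "(x + y)\<^sup>2 \<le> 2 * x\<^sup>2 + 2 * y\<^sup>2" for x y :: real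
        using zero_le_power2[of "x - y"] by (simp add: power2_eq_square algebra_simps)
      from this[of "\<Sum>j=p..<q. drift j w" "\<Sum>j=p..<q. remainder j w"] elim
      show ?case unfolding prop_telescope[OF p(2)] by simp
    qed
    show "integrable M (\<lambda>w. (prop q w - prop p w)\<^sup>2)"
    proof (rule integrable_const_bound[where B=1])
      have "\<bar>prop q w - prop p w\<bar> \<le> 1" for w using prop_bounds[of q w] prop_bounds[of p w] by linarith
      then show "AE w in M. norm ((prop q w - prop p w)\<^sup>2) \<le> 1"
        using square_le_of_abs_le[of _ 1] by (intro AE_I2) simp
    qed measurable
  qed (use drift_square_sum in simp)
  also have "\<dots> = 2 * (\<integral>w. (\<Sum>j=p..<q. drift j w)\<^sup>2 \<partial>M) + 8 * K ^ 4 / real p"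
    using drift_square_sum(1)[of p q] by (simp add: prob_space)
  also have "(\<integral>w. (\<Sum>j=p..<q. drift j w)\<^sup>2 \<partial>M) \<le> (\<Sum>j=p..<q. (K / real (Suc j))\<^sup>2)"
    by (rule drift_square_sum(2))
  also have "\<dots> = K\<^sup>2 * (\<Sum>j=p..<q. 1 / (real (Suc j))\<^sup>2)" by (simp add: power_divide sum_distrib_left)
  also have "\<dots> \<le> K\<^sup>2 * (1 / real p)" using p by (intro mult_left_mono sum_inverse_square_le) auto
  finally show ?thesis by (simp add: add_divide_distrib)
qed

text \<open>The bound of \<open>gap_square\<close> is uniform in \<open>q\<close>, so it survives
  the passage to the limit \<open>q \<longlonglongrightarrow> \<infinity>\<close> by dominated
  convergence. At \<open>p = n\<^sup>2\<close> it is of order \<open>1 / n\<close>, which outweighs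
  the factor \<open>sqrt n\<close> in \<open>err\<close>.\<close>

lemma limit_gap_bound:
  assumes p: "0 < p"
  shows "integrable M (\<lambda>w. prop p w - Z w)"
    and "(\<integral>w. \<bar>prop p w - Z w\<bar> \<partial>M) \<le> sqrt ((2 * K\<^sup>2 + 8 * K ^ 4) / real p)"
proof -
  have Z01: "AE w in M. 0 \<le> Z w \<and> Z w \<le> 1"
    using prop_lim
  proof eventually_elim
    case (elim w)
    show ?case using LIMSEQ_le_const[OF elim, of 0] LIMSEQ_le_const2[OF elim, of 1] prop_bounds by blast
  qed
  have bnd: "AE w in M. (prop p w - Z w)\<^sup>2 \<le> 1"
    using Z01
  proof eventually_elim
    case (elim w)
    then have "\<bar>prop p w - Z w\<bar> \<le> 1" using prop_bounds[of p w] by linarith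
    then show ?case using square_le_of_abs_le[of _ 1] by simp
  qed
  have int: "integrable M (\<lambda>w. (prop p w - Z w)\<^sup>2)"
    by (rule integrable_const_bound[where B=1]) (use bnd in auto)
  have "(\<lambda>q. \<integral>w. (prop q w - prop p w)\<^sup>2 \<partial>M) \<longlonglongrightarrow> (\<integral>w. (Z w - prop p w)\<^sup>2 \<partial>M)"
  proof (rule integral_dominated_convergence[where w = "\<lambda>_. 1"])
    show "AE w in M. (\<lambda>q. (prop q w - prop p w)\<^sup>2) \<longlonglongrightarrow> (Z w - prop p w)\<^sup>2"
      using prop_lim by eventually_elim (intro tendsto_intros)
    have "\<bar>prop q w - prop p w\<bar> \<le> 1" for q w using prop_bounds[of q w] prop_bounds[of p w] by linarith
    then show "AE w in M. norm ((prop q w - prop p w)\<^sup>2) \<le> 1" for q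
      using square_le_of_abs_le[of _ 1] by (intro AE_I2) simp
  qed auto
  then have "(\<integral>w. (Z w - prop p w)\<^sup>2 \<partial>M) \<le> (2 * K\<^sup>2 + 8 * K ^ 4) / real p"
    by (rule LIMSEQ_le_const2) (use gap_square[OF p] in blast)
  then have sq: "(\<integral>w. (prop p w - Z w)\<^sup>2 \<partial>M) \<le> (2 * K\<^sup>2 + 8 * K ^ 4) / real p"
    by (simp add: power2_commute)
  have meas: "(\<lambda>w. prop p w - Z w) \<in> borel_measurable M" by measurable
  show "integrable M (\<lambda>w. prop p w - Z w)" by (rule integral_abs_le_sqrt(1)[OF meas int])
  show "(\<integral>w. \<bar>prop p w - Z w\<bar> \<partial>M) \<le> sqrt ((2 * K\<^sup>2 + 8 * K ^ 4) / real p)"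
    using integral_abs_le_sqrt(2)[OF meas int] real_sqrt_le_mono[OF sq] by linarith
qed

definition "err_bound s t n = \<bar>s\<bar> * (2 * K\<^sup>2) * (harm n / sqrt (real n))
  + \<bar>t\<bar> * (2 * K\<^sup>2) * (sqrt (real n) / real n)
  + \<bar>t\<bar> * sqrt (2 * K\<^sup>2 + 8 * K ^ 4) * (sqrt (real n) / real n)"

lemma err_M[measurable]: "err s t n \<in> borel_measurable M"
  unfolding err_def[abs_def] by measurable

lemma err_integral:
  assumes n: "0 < n"
  shows "integrable M (err s t n)" "(\<integral>w. \<bar>err s t n w\<bar> \<partial>M) \<le> err_bound s t n"
proof -
  let ?e = "\<bar>s\<bar> * (2 * K\<^sup>2) * (harm n / sqrt (real n)) + \<bar>t\<bar> * (2 * K\<^sup>2) * (sqrt (real n) / real n)"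
  define g where "g w = ?e + \<bar>t\<bar> * sqrt (real n) * \<bar>prop (n\<^sup>2) w - Z w\<bar>" for w
  have n2: "0 < n\<^sup>2" "n \<le> n\<^sup>2" using n by (auto simp: power2_eq_square)
  have le: "AE w in M. \<bar>err s t n w\<bar> \<le> g w"
    using remainder_AE
  proof eventually_elim
    case (elim w)
    have "\<bar>\<Sum>j<n. real (Suc j) * remainder j w\<bar> \<le> (\<Sum>j<n. 2 * K\<^sup>2 * inverse (real (Suc j)))"
    proof (rule order_trans[OF sum_abs], rule sum_mono)
      fix j
      have "real (Suc j) * \<bar>remainder j w\<bar> \<le> real (Suc j) * (2 * K\<^sup>2 / (real (Suc j))\<^sup>2)"
        using elim by (intro mult_left_mono) auto
      also have "\<dots> = 2 * K\<^sup>2 * inverse (real (Suc j))" by (simp add: power2_eq_square[of "real (Suc j)"] divide_inverse del: of_nat_Suc)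
      finally show "\<bar>real (Suc j) * remainder j w\<bar> \<le> 2 * K\<^sup>2 * inverse (real (Suc j))" by (simp only: abs_mult abs_of_nat)
    qed
    also have "\<dots> = 2 * K\<^sup>2 * harm n"
    proof -
      have "harm n = (\<Sum>j<n. inverse (real (Suc j)))" unfolding harm_def
        by (rule sum.reindex_bij_witness[of _ Suc "\<lambda>i. i - 1"]) auto
      then show ?thesis by (simp only: sum_distrib_left)
    qed
    finally have 1: "\<bar>\<Sum>j<n. real (Suc j) * remainder j w\<bar> \<le> 2 * K\<^sup>2 * harm n" .
    have "\<bar>\<Sum>j=n..<n\<^sup>2. remainder j w\<bar> \<le> (\<Sum>j=n..<n\<^sup>2. 2 * K\<^sup>2 * (1 / (real (Suc j))\<^sup>2))"
      by (rule order_trans[OF sum_abs], rule sum_mono) (use elim in \<open>simp del: of_nat_Suc\<close>)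
    also have "\<dots> = 2 * K\<^sup>2 * (\<Sum>j=n..<n\<^sup>2. 1 / (real (Suc j))\<^sup>2)" by (simp only: sum_distrib_left)
    also have "\<dots> \<le> 2 * K\<^sup>2 * (1 / real n)" using n by (intro mult_left_mono sum_inverse_square_le) auto
    finally have 2: "\<bar>\<Sum>j=n..<n\<^sup>2. remainder j w\<bar> \<le> 2 * K\<^sup>2 * (1 / real n)" .
    define E1 E2 E3 where "E1 = s / sqrt (real n) * (\<Sum>j<n. real (Suc j) * remainder j w)"
      and "E2 = t * sqrt (real n) * (\<Sum>j=n..<n\<^sup>2. remainder j w)"
      and "E3 = t * sqrt (real n) * (prop (n\<^sup>2) w - Z w)"
    have "\<bar>E1\<bar> \<le> \<bar>s\<bar> / sqrt (real n) * (2 * K\<^sup>2 * harm n)"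
      unfolding E1_def abs_mult abs_divide using 1 by (intro mult_mono) auto
    moreover have "\<bar>E2\<bar> \<le> \<bar>t\<bar> * sqrt (real n) * (2 * K\<^sup>2 * (1 / real n))"
      unfolding E2_def abs_mult using 2 by (intro mult_mono) auto
    moreover have "\<bar>E3\<bar> = \<bar>t\<bar> * sqrt (real n) * \<bar>prop (n\<^sup>2) w - Z w\<bar>" unfolding E3_def by (simp add: abs_mult)
    moreover have "err s t n w = - E1 - E2 + E3" unfolding err_def E1_def E2_def E3_def by simp
    then have "\<bar>err s t n w\<bar> \<le> \<bar>E1\<bar> + \<bar>E2\<bar> + \<bar>E3\<bar>" by linarith
    moreover have "\<bar>s\<bar> / sqrt (real n) * (2 * K\<^sup>2 * harm n) = \<bar>s\<bar> * (2 * K\<^sup>2) * (harm n / sqrt (real n))"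
      "\<bar>t\<bar> * sqrt (real n) * (2 * K\<^sup>2 * (1 / real n)) = \<bar>t\<bar> * (2 * K\<^sup>2) * (sqrt (real n) / real n)" by simp_all
    ultimately show ?case unfolding g_def by linarith
  qed
  have int_g: "integrable M g" unfolding g_def[abs_def]
    using limit_gap_bound(1)[OF n2(1)] by simp
  show int: "integrable M (err s t n)"
    by (rule Bochner_Integration.integrable_bound[OF int_g]) (use le in \<open>auto elim: eventually_mono\<close>)
  have "(\<integral>w. \<bar>err s t n w\<bar> \<partial>M) \<le> (\<integral>w. g w \<partial>M)"
    by (rule integral_mono_AE) (use int int_g le in auto)
  also have "\<dots> = ?e + \<bar>t\<bar> * sqrt (real n) * (\<integral>w. \<bar>prop (n\<^sup>2) w - Z w\<bar> \<partial>M)"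
    unfolding g_def using limit_gap_bound(1)[OF n2(1)] by (simp add: prob_space)
  also have "\<dots> \<le> ?e + \<bar>t\<bar> * sqrt (real n) * sqrt ((2 * K\<^sup>2 + 8 * K ^ 4) / real (n\<^sup>2))"
    by (intro add_left_mono mult_left_mono limit_gap_bound n2) auto
  also have "sqrt ((2 * K\<^sup>2 + 8 * K ^ 4) / real (n\<^sup>2)) = sqrt (2 * K\<^sup>2 + 8 * K ^ 4) / real n"
    by (simp add: real_sqrt_divide)
  finally show "(\<integral>w. \<bar>err s t n w\<bar> \<partial>M) \<le> err_bound s t n" by (simp add: err_bound_def mult_ac)
qed

lemma err_bound_lim: "(\<lambda>n. err_bound s t n) \<longlonglongrightarrow> 0"
proof -
  \<comment> \<open>The harmonic sum differs from the logarithm by a convergent sequence, and the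
    logarithm is negligible against the square root.\<close>
  have "(\<lambda>n. (harm n - ln (real n)) * (1 / sqrt (real n)) + ln (real n) / sqrt (real n)) \<longlonglongrightarrow> euler_mascheroni * 0 + 0"
  proof (intro tendsto_add tendsto_mult)
    show "(\<lambda>n. harm n - ln (real n)) \<longlonglongrightarrow> (euler_mascheroni :: real)" by (rule euler_mascheroni_LIMSEQ)
    show "(\<lambda>n. 1 / sqrt (real n)) \<longlonglongrightarrow> 0" by real_asymp
    show "(\<lambda>n. ln (real n) / sqrt (real n)) \<longlonglongrightarrow> 0" by real_asymp
  qed
  then have h: "(\<lambda>n. harm n / sqrt (real n) :: real) \<longlonglongrightarrow> 0" by (simp add: diff_divide_distrib)
  have r: "(\<lambda>n. sqrt (real n) / real n) \<longlonglongrightarrow> 0" by real_asymp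
  have "(\<lambda>n. err_bound s t n) \<longlonglongrightarrow> \<bar>s\<bar> * (2 * K\<^sup>2) * 0 + \<bar>t\<bar> * (2 * K\<^sup>2) * 0 + \<bar>t\<bar> * sqrt (2 * K\<^sup>2 + 8 * K ^ 4) * 0"
    unfolding err_bound_def by (intro tendsto_intros h r)
  then show ?thesis by simp
qed

lemma gap_M[measurable]: "mean_gap n \<in> borel_measurable M" "limit_gap n \<in> borel_measurable M"
proof -
  have "(\<lambda>w. inverse (num j w) * smp j w) \<in> borel_measurable M" for j by measurable
  then have [measurable]: "urn_mean N X n \<in> borel_measurable M"
    unfolding urn_mean_eq[abs_def] by measurable
  show "mean_gap n \<in> borel_measurable M" "limit_gap n \<in> borel_measurable M" by measurable
qed

text \<open>Orthogonality bounds the second moment of the array sum uniformly in \<open>n\<close>.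
  With the convergence of \<open>err_bound\<close> this yields the first moment bounds behind
  tightness.\<close>

lemma gap_integral_bound:
  "integrable M (\<lambda>w. gap s t n w)"
  "(\<integral>w. \<bar>gap s t n w\<bar> \<partial>M) \<le> sqrt ((s\<^sup>2 + t\<^sup>2) * (1 + K)\<^sup>2) + \<bar>err_bound s t n\<bar>"
proof -
  let ?T = "\<lambda>w. \<Sum>j<n\<^sup>2. array s t n j w"
  have [measurable]: "array s t n j \<in> borel_measurable M" for j by (rule measurable_G[OF array_Hist])
  have sq: "integrable M (\<lambda>w. (?T w)\<^sup>2)" "(\<integral>w. (?T w)\<^sup>2 \<partial>M) \<le> (s\<^sup>2 + t\<^sup>2) * (1 + K)\<^sup>2"
    using martingale_difference_square_sum[of "array s t n" "array_bound s t n" 0 "n\<^sup>2", OF array_Hist array_AE array_mean]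
      array_bound_square_sum[of s t n] by (auto simp: lessThan_atLeast0)
  have T_int: "integrable M ?T" by (rule integral_abs_le_sqrt(1)[OF _ sq(1)]) measurable
  have T: "(\<integral>w. \<bar>?T w\<bar> \<partial>M) \<le> sqrt ((s\<^sup>2 + t\<^sup>2) * (1 + K)\<^sup>2)"
    by (rule order_trans[OF integral_abs_le_sqrt(2)[OF _ sq(1)] real_sqrt_le_mono[OF sq(2)]]) measurable
  have err: "integrable M (err s t n)" "(\<integral>w. \<bar>err s t n w\<bar> \<partial>M) \<le> \<bar>err_bound s t n\<bar>"
  proof -
    show "integrable M (err s t n)"
      using err_integral(1)[of n s t] by (cases "n = 0") (auto simp: err_def[abs_def])
    show "(\<integral>w. \<bar>err s t n w\<bar> \<partial>M) \<le> \<bar>err_bound s t n\<bar>"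
      using err_integral(2)[of n s t] by (cases "n = 0") (auto simp: err_def[abs_def])
  qed
  show "integrable M (\<lambda>w. gap s t n w)"
    unfolding gap_decomposition using T_int err(1) by (rule Bochner_Integration.integrable_add)
  have "(\<integral>w. \<bar>gap s t n w\<bar> \<partial>M) \<le> (\<integral>w. \<bar>?T w\<bar> + \<bar>err s t n w\<bar> \<partial>M)"
    unfolding gap_decomposition using T_int err(1) by (intro integral_mono) auto
  also have "\<dots> = (\<integral>w. \<bar>?T w\<bar> \<partial>M) + (\<integral>w. \<bar>err s t n w\<bar> \<partial>M)"
    using T_int err(1) by (intro Bochner_Integration.integral_add) auto
  finally show "(\<integral>w. \<bar>gap s t n w\<bar> \<partial>M) \<le> sqrt ((s\<^sup>2 + t\<^sup>2) * (1 + K)\<^sup>2) + \<bar>err_bound s t n\<bar>"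
    using T err(2) by linarith
qed

text \<open>\<open>iexp\<close> is 1-Lipschitz on the reals, so replacing the gap by the array sum
  changes the characteristic function by at most the mean of
  \<open>\<bar>err s t n\<bar>\<close>.\<close>

lemma gap_char_lim:
  assumes F[measurable]: "F \<in> sets M"
  shows "(\<lambda>n. \<integral>w. of_real (indicator F w) * iexp (gap s t n w) \<partial>M)
    \<longlonglongrightarrow> (\<integral>w. of_real (indicator F w * exp (- (s\<^sup>2 * U w + t\<^sup>2 * V w) / 2)) \<partial>M)"
proof -
  let ?T = "\<lambda>n w. \<Sum>j<n\<^sup>2. array s t n j w"
  have [measurable]: "array s t n j \<in> borel_measurable M" for n j by (rule measurable_G[OF array_Hist])
  have main: "(\<lambda>n. \<integral>w. of_real (indicator F w) * iexp (?T n w) \<partial>M)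
    \<longlonglongrightarrow> (\<integral>w. of_real (indicator F w * exp (- (s\<^sup>2 * U w + t\<^sup>2 * V w) / 2)) \<partial>M)"
  proof (rule martingale_array_stable_char[OF array_Hist array_AE array_mean array_bound_square_sum
        array_bound_small _ _ array_variance_lim])
    show "(\<lambda>n. (\<bar>s\<bar> + \<bar>t\<bar>) * (1 + K) / sqrt (real n)) \<longlonglongrightarrow> 0"
      by (intro real_tendsto_divide_at_top[OF tendsto_const] filterlim_compose[OF sqrt_at_top] filterlim_real_sequentially)
    show "filterlim (\<lambda>n::nat. n\<^sup>2) at_top sequentially"
      by (rule filterlim_at_top_mono[OF filterlim_ident]) (auto simp: power2_eq_square)
    show "\<bar>indicator F x\<bar> \<le> (1 :: real)" for x by (simp add: indicator_def)
  qed measurable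
  have "(\<lambda>n. (\<integral>w. of_real (indicator F w) * iexp (gap s t n w) \<partial>M)
      - (\<integral>w. of_real (indicator F w) * iexp (?T n w) \<partial>M)) \<longlonglongrightarrow> 0"
  proof (rule Lim_null_comparison[OF _ err_bound_lim[of s t]])
    show "\<forall>\<^sub>F n in sequentially. norm ((\<integral>w. of_real (indicator F w) * iexp (gap s t n w) \<partial>M)
      - (\<integral>w. of_real (indicator F w) * iexp (?T n w) \<partial>M)) \<le> err_bound s t n"
      using eventually_gt_at_top[of 0]
    proof eventually_elim
      case (elim n)
      have int: "integrable M (\<lambda>w. of_real (indicator F w) * iexp (h w))" if [measurable]: "h \<in> borel_measurable M" for h
        by (rule integrable_const_bound[where B=1]) (auto simp: norm_mult indicator_def)
      have gap_meas: "(\<lambda>w. gap s t n w) \<in> borel_measurable M" by measurable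
      have T_meas: "?T n \<in> borel_measurable M" by measurable
      have diff: "(\<integral>w. of_real (indicator F w) * iexp (gap s t n w) \<partial>M)
          - (\<integral>w. of_real (indicator F w) * iexp (?T n w) \<partial>M)
        = (\<integral>w. of_real (indicator F w) * iexp (gap s t n w) - of_real (indicator F w) * iexp (?T n w) \<partial>M)"
        by (intro Bochner_Integration.integral_diff[symmetric] int gap_meas T_meas)
      have "norm ((\<integral>w. of_real (indicator F w) * iexp (gap s t n w) \<partial>M)
          - (\<integral>w. of_real (indicator F w) * iexp (?T n w) \<partial>M)) \<le> (\<integral>w. norm (of_real (indicator F w) * iexp (gap s t n w) - of_real (indicator F w) * iexp (?T n w)) \<partial>M)"
        unfolding diff by (rule integral_norm_bound)
      also have "\<dots> \<le> (\<integral>w. \<bar>err s t n w\<bar> \<partial>M)"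
      proof (rule integral_mono)
        show "integrable M (\<lambda>w. norm (of_real (indicator F w) * iexp (gap s t n w) - of_real (indicator F w) * iexp (?T n w)))"
          by (intro integrable_norm Bochner_Integration.integrable_diff int gap_meas T_meas)
        show "integrable M (\<lambda>w. \<bar>err s t n w\<bar>)" using err_integral(1)[OF elim] by simp
        fix w
        have "norm (of_real (indicator F w) * iexp (gap s t n w) - of_real (indicator F w) * iexp (?T n w))
          \<le> norm (iexp (gap s t n w) - iexp (?T n w))"
          by (simp only: right_diff_distrib[symmetric] norm_mult) (simp add: indicator_def)
        also have "\<dots> \<le> \<bar>(gap s t n w) - ?T n w\<bar>" by (rule iexp_diff_le)
        also have "\<dots> = \<bar>err s t n w\<bar>" unfolding gap_decomposition by simp
        finally show "norm (of_real (indicator F w) * iexp (gap s t n w) - of_real (indicator F w) * iexp (?T n w)) \<le> \<bar>err s t n w\<bar>" .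
      qed
      also have "\<dots> \<le> err_bound s t n" by (rule err_integral(2)[OF elim])
      finally show ?case .
    qed
  qed
  from tendsto_add[OF this main] show ?thesis by simp
qed

theorem gaps_converge_stably:
  "converges_stably M (\<lambda>n w. (mean_gap n w, limit_gap n w))
     (\<lambda>w. centred_normal (U w) \<Otimes>\<^sub>M centred_normal (V w))"
proof -
  have "Bseq (\<lambda>n. err_bound 1 0 n)" "Bseq (\<lambda>n. err_bound 0 1 n)"
    using err_bound_lim by (auto intro!: convergent_imp_Bseq convergentI)
  then obtain B1 B2 where B: "\<And>n. \<bar>err_bound 1 0 n\<bar> \<le> B1" "\<And>n. \<bar>err_bound 0 1 n\<bar> \<le> B2"
    by (auto simp: Bseq_def)
  \<comment> \<open>The choices (1, 0) and (0, 1) for \<open>s\<close> and \<open>t\<close> isolate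
    the two coordinates.\<close>
  have int: "integrable M (mean_gap n)" "integrable M (limit_gap n)" for n
    using gap_integral_bound(1)[of 1 n 0] gap_integral_bound(1)[of 0 n 1] by simp_all
  have abs: "(\<integral>w. \<bar>mean_gap n w\<bar> \<partial>M) \<le> (1 + K) + B1" "(\<integral>w. \<bar>limit_gap n w\<bar> \<partial>M) \<le> (1 + K) + B2" for n
    using gap_integral_bound(2)[of 1 n 0] gap_integral_bound(2)[of 0 n 1] B(1)[of n] B(2)[of n] K_nonneg by simp_all
  have pair_le: "norm (x, y) \<le> \<bar>x\<bar> + \<bar>y\<bar>" for x y :: real
    using norm_Pair_le[of x y] by simp
  have Y: "(\<lambda>w. (mean_gap n w, limit_gap n w)) \<in> borel_measurable M" for n
    by (intro borel_measurable_Pair gap_M)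
  have Y_int: "integrable M (\<lambda>w. (mean_gap n w, limit_gap n w))" for n
    by (rule Bochner_Integration.integrable_bound[of M "\<lambda>w. \<bar>mean_gap n w\<bar> + \<bar>limit_gap n w\<bar>"])
      (use int Y pair_le in auto)
  show ?thesis
  proof (rule converges_stably_normal_pair[OF Y U_M V_M variances_nonneg Y_int])
    fix n
    have "(\<integral>w. norm (mean_gap n w, limit_gap n w) \<partial>M) \<le> (\<integral>w. \<bar>mean_gap n w\<bar> + \<bar>limit_gap n w\<bar> \<partial>M)"
      using int Y_int pair_le by (intro integral_mono) auto
    also have "\<dots> = (\<integral>w. \<bar>mean_gap n w\<bar> \<partial>M) + (\<integral>w. \<bar>limit_gap n w\<bar> \<partial>M)"
      using int by simp
    also have "\<dots> \<le> ((1 + K) + B1) + ((1 + K) + B2)" by (intro add_mono abs)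
    finally show "(\<integral>w. norm (mean_gap n w, limit_gap n w) \<partial>M) \<le> ((1 + K) + B1) + ((1 + K) + B2)" .
  next
    fix F s t
    assume "F \<in> sets M"
    from gap_char_lim[OF this, of s t]
    show "(\<lambda>n. \<integral>x. of_real (indicator F x) * iexp (s * fst (mean_gap n x, limit_gap n x) + t * snd (mean_gap n x, limit_gap n x)) \<partial>M)
         \<longlonglongrightarrow> (\<integral>x. of_real (indicator F x * exp (- (s\<^sup>2 * U x + t\<^sup>2 * V x) / 2)) \<partial>M)"
      by simp
  qed
qed

end

theorem theorem3p13:
  fixes M :: "'w measure"
    and a b :: nat
    and N X A B :: "nat \<Rightarrow> 'w \<Rightarrow> nat"
    and C :: int
    and m :: "nat \<Rightarrow> real" and m_lim q\<^sub>A q\<^sub>B q\<^sub>A\<^sub>B :: real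
    and N_lim Q L :: "'w \<Rightarrow> real"
  assumes "urn_model M a b N X A B"
    and "\<And>n. n \<ge> 1 \<Longrightarrow> AE \<omega> in M. int (max (max (A n \<omega>) (B n \<omega>)) (N n \<omega>)) \<le> C"
    and "\<And>n. n \<ge> 1 \<Longrightarrow> (\<integral>\<omega>. real (A n \<omega>) \<partial>M) = m n"
    and "\<And>n. n \<ge> 1 \<Longrightarrow> (\<integral>\<omega>. real (B n \<omega>) \<partial>M) = m n"
    and "m \<longlonglongrightarrow> m_lim" and "m_lim > 0"
    and "N_lim \<in> borel_measurable M" and "AE \<omega> in M. N_lim \<omega> > 0"
    and "Q \<in> borel_measurable M" and "AE \<omega> in M. Q \<omega> > 0"
    and "L \<in> borel_measurable M" and "AE \<omega> in M. L \<omega> > 0" and "\<exists>c. AE \<omega> in M. L \<omega> \<le> c"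
    and "AE \<omega> in M. (\<lambda>n. real_cond_exp M (urn_F M N X A B (n - 1)) (\<lambda>\<omega>. real (N n \<omega>)) \<omega>)
           \<longlonglongrightarrow> N_lim \<omega>"
    and "AE \<omega> in M. (\<lambda>n. real_cond_exp M (urn_F M N X A B (n - 1)) (\<lambda>\<omega>. (real (N n \<omega>))\<^sup>2) \<omega>)
           \<longlonglongrightarrow> Q \<omega>"
    and "AE \<omega> in M. (\<lambda>n. real_cond_exp M (urn_F M N X A B (n - 1)) (\<lambda>\<omega>. inverse (real (N n \<omega>))) \<omega>)
           \<longlonglongrightarrow> L \<omega>"
    and "(\<lambda>n. \<integral>\<omega>. (real (A n \<omega>))\<^sup>2 \<partial>M) \<longlonglongrightarrow> q\<^sub>A" and "q\<^sub>A > 0"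
    and "(\<lambda>n. \<integral>\<omega>. (real (B n \<omega>))\<^sup>2 \<partial>M) \<longlonglongrightarrow> q\<^sub>B" and "q\<^sub>B > 0"
    and "(\<lambda>n. \<integral>\<omega>. real (A n \<omega>) * real (B n \<omega>) \<partial>M) \<longlonglongrightarrow> q\<^sub>A\<^sub>B" and "q\<^sub>A\<^sub>B > 0"
  shows "let Z = (\<lambda>\<omega>. lim (\<lambda>n. urn_Z a b N X A B n \<omega>));
             V = (\<lambda>\<omega>. Z \<omega> * (1 - Z \<omega>) *
                   (N_lim \<omega> * ((1 - Z \<omega>)\<^sup>2 * q\<^sub>A + (Z \<omega>)\<^sup>2 * q\<^sub>B + 2 * Z \<omega> * (1 - Z \<omega>) * q\<^sub>A\<^sub>B)
                    + Z \<omega> * (1 - Z \<omega>) * Q \<omega> * (q\<^sub>A + q\<^sub>B - 2 * q\<^sub>A\<^sub>B))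
                   / (m_lim * N_lim \<omega>)\<^sup>2);
             U = (\<lambda>\<omega>. V \<omega> + Z \<omega> * (1 - Z \<omega>) * (L \<omega> - 2 * inverse (N_lim \<omega>)))
         in (AE \<omega> in M. (\<lambda>n. urn_Z a b N X A B n \<omega>) \<longlonglongrightarrow> Z \<omega>) \<and>
            converges_stably M
              (\<lambda>n \<omega>. (sqrt (real n) * (urn_mean N X n \<omega> - urn_Z a b N X A B n \<omega>),
                      sqrt (real n) * (urn_Z a b N X A B n \<omega> - Z \<omega>)))
              (\<lambda>\<omega>. centred_normal (U \<omega>) \<Otimes>\<^sub>M centred_normal (V \<omega>))"
proof -
  \<comment> \<open>Interpretation in two stages, because the assumptions of \<open>urn_clt\<close>
    mention \<open>qA\<close>, \<open>qB\<close> and \<open>qAB\<close>, which are defined in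
    \<open>balanced_urn\<close>.\<close>
  interpret B: balanced_urn M a b N X A B "nat C" m
  proof (intro balanced_urn.intro bounded_urn.intro bounded_urn_axioms.intro balanced_urn_axioms.intro assms(1))
    show "AE \<omega> in M. A n \<omega> \<le> nat C \<and> B n \<omega> \<le> nat C \<and> N n \<omega> \<le> nat C" if "n \<ge> 1" for n
      using assms(2)[OF that] by eventually_elim linarith
  qed (use assms(3,4) in auto)
  interpret urn_clt M a b N X A B "nat C" m m_lim q\<^sub>A q\<^sub>B q\<^sub>A\<^sub>B N_lim Q L
  proof unfold_locales
    \<comment> \<open>The hypotheses pair draw \<open>n\<close> with history \<open>n - 1\<close>;
      shifting the sequences by one pairs draw \<open>Suc j\<close> with history
      \<open>j\<close>.\<close>
    show "AE \<omega> in M. (\<lambda>j. real_cond_exp M (urn_F M N X A B j) (\<lambda>\<omega>. real (N (Suc j) \<omega>)) \<omega>) \<longlonglongrightarrow> N_lim \<omega>"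
      using assms(14) by eventually_elim (drule LIMSEQ_Suc, simp)
    show "AE \<omega> in M. (\<lambda>j. real_cond_exp M (urn_F M N X A B j) (\<lambda>\<omega>. (real (N (Suc j) \<omega>))\<^sup>2) \<omega>) \<longlonglongrightarrow> Q \<omega>"
      using assms(15) by eventually_elim (drule LIMSEQ_Suc, simp)
    show "AE \<omega> in M. (\<lambda>j. real_cond_exp M (urn_F M N X A B j) (\<lambda>\<omega>. inverse (real (N (Suc j) \<omega>))) \<omega>) \<longlonglongrightarrow> L \<omega>"
      using assms(16) by eventually_elim (drule LIMSEQ_Suc, simp)
    show "B.qA \<longlonglongrightarrow> q\<^sub>A" "B.qB \<longlonglongrightarrow> q\<^sub>B" "B.qAB \<longlonglongrightarrow> q\<^sub>A\<^sub>B"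
      unfolding B.qA_def[abs_def] B.qB_def[abs_def] B.qAB_def[abs_def] by (rule assms(17,19,21)[THEN LIMSEQ_Suc])+
  qed (use assms in auto)
  show ?thesis
    using prop_lim gaps_converge_stably
    unfolding Let_def U_def[abs_def] V_def[abs_def] Z_def[abs_def] by simp
qed

end
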